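(* Let $(\mathcal C,X,\tau)$ be a trivalent ribbon category over $\mathbb C$ with $\dim\mathcal C(4)\le5$ satisfying (QEJac-$\alpha$) with $v$ a primitive third or sixth root of unity (and some $\alpha\in\mathbb C$), and let $d=\mathrm{ev}\circ\mathrm{coev}$. Then, after possibly rescaling the self-duality of $X$, $X$ is a $G2(d)$-algebra object in $\mathcal C$, i.e. the braiding of $\mathcal C$ is symmetric and there is a symmetric ribbon functor $G2(d)\to\mathcal C$ sending the strand to $X$ and the trivalent vertex to $\tau$.
   Context: For an object $X$ of a ribbon category $\mathcal C$, $\mathcal C(n)=\mathrm{Hom}(X^{\otimes n},\mathbf 1_{\mathcal C})$. A trivalent ribbon category $(\mathcal C,X,\tau)$ over $R$ is an $R$-linear ribbon category with a self-dual object $X$ (chosen self-duality $\mathrm{ev}:X\otimes X\to\mathbf 1_{\mathcal C}$, $\mathrm{coev}:\mathbf 1_{\mathcal C}\to X\otimes X$, well defined up to a non-zero scalar) such that $\mathcal C(1)=0$; $\mathcal C(0),\mathcal C(2),\mathcal C(3)$ are free of rank 1 generated respectively by the empty diagram, the strand $\mathrm{ev}$, and a "trivalent vertex" $\tau\in\mathcal C(3)$; $\mathcal C$ is generated as a ribbon category by $\tau$; and the circle $d=\mathrm{ev}\circ\mathrm{coev}$ and bigon value $b$ ($m\circ\delta=b\,\mathrm{id}_X$) are non-zero. Then $X$ is symmetrically self-dual and $\tau$ rotationally invariant. Diagrams as morphisms: $m=(\tau\otimes\mathrm{id}_X)(\mathrm{id}_X\otimes\mathrm{id}_X\otimes\mathrm{coev})$,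 $\delta=(m\otimes \mathrm{id}_X)(\mathrm{id}_X\otimes\mathrm{coev})$; in $\mathrm{End}(X\otimes X)$: $\mathbf 1$ the identity, $U=\mathrm{coev}\circ\mathrm{ev}$, $I=\delta\circ m$, $H=(\mathrm{id}_X\otimes m)(\delta\otimes\mathrm{id}_X)$, $\sigma=c_{X,X}^{-1}$ (negative crossing, over-strand from bottom right to top left); in a symmetric category $s$ denotes the symmetry. (QEJac-$\alpha$) holds for $v\in\mathbb C\setminus\{0\}$, $\alpha\in\mathbb C$ if $v^{-3}H\sigma+vI-v^{-1}H+\alpha[\sigma+v^4U+v^{-4}\mathbf 1]=0$ and in addition $\mathrm{ev}\circ\mathrm{coev}=d$, $m\circ\mathrm{coev}=0$, $m\circ\delta=b\,\mathrm{id}_X$, $H\circ\delta=t\delta$, $\sigma\circ\delta=-v^6\delta$, $\sigma\circ\mathrm{coev}=v^{12}\mathrm{coev}$ for some scalars $d,b,t$. $G2(d)$ is the symmetric ribbon category generated by one symmetrically self-dual object (the strand) and a rotationally invariant trivalent vertex (morphisms: linear combinations of trivalent graphs with symmetric crossings up to isotopy) modulo: $\mathrm{ev}\circ\mathrm{coev}=d$; $s\circ\mathrm{coev}=\mathrm{coev}$; $s\circ\delta=-\delta$; $m\circ\mathrm{coev}=0$; $m\circ\delta=(1-d)\,\mathrm{id}$; $H\circ\delta=(d-4)\,\delta$; and $I+H=2s-\mathbf 1-U$. *)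

theory Defs
  imports Complex_Main "Jordan_Normal_Form.VS_Connect"
begin

hide_const (open) Modules.module_hom

section \<open>Ribbon categories over the complex numbers\<close>

text \<open>
  All elements of the type \<open>'o\<close> are objects. \<open>Hom C a b\<close> is the complex vector space of
  morphisms from \<open>a\<close> to \<open>b\<close> (only the module fields of the record are used), and \<open>f \<cdot> g\<close> is the
  composite \<open>f\<close> after \<open>g\<close>. Monoidal categories are not assumed to be strict:
  \<open>assoc C a b c\<close> goes from \<open>(a \<boxdot> b) \<boxdot> c\<close> to \<open>a \<boxdot> (b \<boxdot> c)\<close>, \<open>lunit C a\<close> from \<open>unit_ob C \<boxdot> a\<close> to \<open>a\<close>
  and \<open>runit C a\<close> from \<open>a \<boxdot> unit_ob C\<close> to \<open>a\<close>.
\<close>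

record ('o, 'm) cat_data =
  Hom :: "'o \<Rightarrow> 'o \<Rightarrow> (complex, 'm) module"
  ident :: "'o \<Rightarrow> 'm"
  comp_mor :: "'m \<Rightarrow> 'm \<Rightarrow> 'm"  (infixl \<open>\<cdot>\<index>\<close> 70)
  unit_ob :: "'o"
  tensor_ob :: "'o \<Rightarrow> 'o \<Rightarrow> 'o"  (infixl \<open>\<boxdot>\<index>\<close> 75)
  tensor_mor :: "'m \<Rightarrow> 'm \<Rightarrow> 'm"  (infixl \<open>\<boxtimes>\<index>\<close> 75)
  assoc :: "'o \<Rightarrow> 'o \<Rightarrow> 'o \<Rightarrow> 'm"
  lunit :: "'o \<Rightarrow> 'm"
  runit :: "'o \<Rightarrow> 'm"
  braid :: "'o \<Rightarrow> 'o \<Rightarrow> 'm"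
  twist :: "'o \<Rightarrow> 'm"

abbreviation Mor :: "('o, 'm, 'x) cat_data_scheme \<Rightarrow> 'o \<Rightarrow> 'o \<Rightarrow> 'm set" where
  "Mor C a b \<equiv> carrier (Hom C a b)"

definition inverse_pair :: "('o, 'm, 'x) cat_data_scheme \<Rightarrow> 'o \<Rightarrow> 'o \<Rightarrow> 'm \<Rightarrow> 'm \<Rightarrow> bool" where
  "inverse_pair C a b f g \<longleftrightarrow> f \<in> Mor C a b \<and> g \<in> Mor C b a \<and>
     g \<cdot>\<^bsub>C\<^esub> f = ident C a \<and> f \<cdot>\<^bsub>C\<^esub> g = ident C b"

definition is_iso :: "('o, 'm, 'x) cat_data_scheme \<Rightarrow> 'o \<Rightarrow> 'o \<Rightarrow> 'm \<Rightarrow> bool" where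
  "is_iso C a b f \<longleftrightarrow> (\<exists>g. inverse_pair C a b f g)"

definition inv_mor :: "('o, 'm, 'x) cat_data_scheme \<Rightarrow> 'o \<Rightarrow> 'o \<Rightarrow> 'm \<Rightarrow> 'm" where
  "inv_mor C a b f = (THE g. inverse_pair C a b f g)"

abbreviation assoc_inv :: "('o, 'm, 'x) cat_data_scheme \<Rightarrow> 'o \<Rightarrow> 'o \<Rightarrow> 'o \<Rightarrow> 'm" where
  "assoc_inv C a b c \<equiv>
     inv_mor C (a \<boxdot>\<^bsub>C\<^esub> b \<boxdot>\<^bsub>C\<^esub> c) (a \<boxdot>\<^bsub>C\<^esub> (b \<boxdot>\<^bsub>C\<^esub> c)) (assoc C a b c)"

abbreviation lunit_inv :: "('o, 'm, 'x) cat_data_scheme \<Rightarrow> 'o \<Rightarrow> 'm" where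
  "lunit_inv C a \<equiv> inv_mor C (unit_ob C \<boxdot>\<^bsub>C\<^esub> a) a (lunit C a)"

abbreviation runit_inv :: "('o, 'm, 'x) cat_data_scheme \<Rightarrow> 'o \<Rightarrow> 'm" where
  "runit_inv C a \<equiv> inv_mor C (a \<boxdot>\<^bsub>C\<^esub> unit_ob C) a (runit C a)"

abbreviation braid_inv :: "('o, 'm, 'x) cat_data_scheme \<Rightarrow> 'o \<Rightarrow> 'o \<Rightarrow> 'm" where
  "braid_inv C a b \<equiv> inv_mor C (a \<boxdot>\<^bsub>C\<^esub> b) (b \<boxdot>\<^bsub>C\<^esub> a) (braid C a b)"

locale linear_category =
  fixes C :: "('o, 'm) cat_data" (structure)
  assumes Hom_vectorspace: "vectorspace class_ring (Hom C a b)"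
    and ident_closed: "ident C a \<in> Mor C a a"
    and comp_closed: "\<lbrakk>f \<in> Mor C b c; g \<in> Mor C a b\<rbrakk> \<Longrightarrow> f \<cdot> g \<in> Mor C a c"
    and comp_assoc: "\<lbrakk>f \<in> Mor C c d; g \<in> Mor C b c; h \<in> Mor C a b\<rbrakk> \<Longrightarrow> f \<cdot> g \<cdot> h = f \<cdot> (g \<cdot> h)"
    and ident_comp: "f \<in> Mor C a b \<Longrightarrow> ident C b \<cdot> f = f"
    and comp_ident: "f \<in> Mor C a b \<Longrightarrow> f \<cdot> ident C a = f"
    and comp_linear_left:
      "g \<in> Mor C a b \<Longrightarrow> (\<lambda>f. f \<cdot> g) \<in> module_hom class_ring (Hom C b c) (Hom C a c)"
    and comp_linear_right:
      "f \<in> Mor C b c \<Longrightarrow> (\<lambda>g. f \<cdot> g) \<in> module_hom class_ring (Hom C a b) (Hom C a c)"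

locale linear_monoidal_category = linear_category C
  for C :: "('o, 'm) cat_data" (structure) +
  assumes tensor_closed:
      "\<lbrakk>f \<in> Mor C a b; g \<in> Mor C c d\<rbrakk> \<Longrightarrow> f \<boxtimes> g \<in> Mor C (a \<boxdot> c) (b \<boxdot> d)"
    and tensor_ident: "ident C a \<boxtimes> ident C b = ident C (a \<boxdot> b)"
    and interchange:
      "\<lbrakk>f \<in> Mor C b c; g \<in> Mor C a b; h \<in> Mor C b' c'; k \<in> Mor C a' b'\<rbrakk>
        \<Longrightarrow> (f \<cdot> g) \<boxtimes> (h \<cdot> k) = (f \<boxtimes> h) \<cdot> (g \<boxtimes> k)"
    and tensor_linear_left:
      "g \<in> Mor C c d \<Longrightarrow> (\<lambda>f. f \<boxtimes> g) \<in> module_hom class_ring (Hom C a b) (Hom C (a \<boxdot> c) (b \<boxdot> d))"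
    and tensor_linear_right:
      "f \<in> Mor C a b \<Longrightarrow> (\<lambda>g. f \<boxtimes> g) \<in> module_hom class_ring (Hom C c d) (Hom C (a \<boxdot> c) (b \<boxdot> d))"
    and assoc_iso: "is_iso C (a \<boxdot> b \<boxdot> c) (a \<boxdot> (b \<boxdot> c)) (assoc C a b c)"
    and lunit_iso: "is_iso C (unit_ob C \<boxdot> a) a (lunit C a)"
    and runit_iso: "is_iso C (a \<boxdot> unit_ob C) a (runit C a)"
    and assoc_natural:
      "\<lbrakk>f \<in> Mor C a a'; g \<in> Mor C b b'; h \<in> Mor C c c'\<rbrakk>
        \<Longrightarrow> assoc C a' b' c' \<cdot> (f \<boxtimes> g \<boxtimes> h) = (f \<boxtimes> (g \<boxtimes> h)) \<cdot> assoc C a b c"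
    and lunit_natural:
      "f \<in> Mor C a b \<Longrightarrow> lunit C b \<cdot> (ident C (unit_ob C) \<boxtimes> f) = f \<cdot> lunit C a"
    and runit_natural:
      "f \<in> Mor C a b \<Longrightarrow> runit C b \<cdot> (f \<boxtimes> ident C (unit_ob C)) = f \<cdot> runit C a"
    and pentagon:
      "assoc C a b (c \<boxdot> d) \<cdot> assoc C (a \<boxdot> b) c d =
       (ident C a \<boxtimes> assoc C b c d) \<cdot> assoc C a (b \<boxdot> c) d \<cdot> (assoc C a b c \<boxtimes> ident C d)"
    and triangle:
      "(ident C a \<boxtimes> lunit C b) \<cdot> assoc C a (unit_ob C) b = runit C a \<boxtimes> ident C b"

locale linear_braided_category = linear_monoidal_category C
  for C :: "('o, 'm) cat_data" (structure) +
  assumes braid_iso: "is_iso C (a \<boxdot> b) (b \<boxdot> a) (braid C a b)"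
    and braid_natural:
      "\<lbrakk>f \<in> Mor C a a'; g \<in> Mor C b b'\<rbrakk>
        \<Longrightarrow> braid C a' b' \<cdot> (f \<boxtimes> g) = (g \<boxtimes> f) \<cdot> braid C a b"
    and hexagon1:
      "assoc C b c a \<cdot> braid C a (b \<boxdot> c) \<cdot> assoc C a b c =
       (ident C b \<boxtimes> braid C a c) \<cdot> assoc C b a c \<cdot> (braid C a b \<boxtimes> ident C c)"
    and hexagon2:
      "assoc_inv C c a b \<cdot> braid C (a \<boxdot> b) c \<cdot> assoc_inv C a b c =
       (braid C a c \<boxtimes> ident C b) \<cdot> assoc_inv C a c b \<cdot> (ident C a \<boxtimes> braid C b c)"

text \<open>\<open>a'\<close> is a dual of \<open>a\<close>, with evaluation \<open>e : a' \<boxdot> a \<rightarrow> unit\<close> and coevaluation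
  \<open>k : unit \<rightarrow> a \<boxdot> a'\<close>. The two equations are the zigzag identities.\<close>

definition is_dual :: "('o, 'm, 'x) cat_data_scheme \<Rightarrow> 'o \<Rightarrow> 'o \<Rightarrow> 'm \<Rightarrow> 'm \<Rightarrow> bool" where
  "is_dual C a a' e k \<longleftrightarrow>
     e \<in> Mor C (a' \<boxdot>\<^bsub>C\<^esub> a) (unit_ob C) \<and> k \<in> Mor C (unit_ob C) (a \<boxdot>\<^bsub>C\<^esub> a') \<and>
     runit C a \<cdot>\<^bsub>C\<^esub> (ident C a \<boxtimes>\<^bsub>C\<^esub> e) \<cdot>\<^bsub>C\<^esub> assoc C a a' a \<cdot>\<^bsub>C\<^esub>
       (k \<boxtimes>\<^bsub>C\<^esub> ident C a) \<cdot>\<^bsub>C\<^esub> lunit_inv C a = ident C a \<and>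
     lunit C a' \<cdot>\<^bsub>C\<^esub> (e \<boxtimes>\<^bsub>C\<^esub> ident C a') \<cdot>\<^bsub>C\<^esub> assoc_inv C a' a a' \<cdot>\<^bsub>C\<^esub>
       (ident C a' \<boxtimes>\<^bsub>C\<^esub> k) \<cdot>\<^bsub>C\<^esub> runit_inv C a' = ident C a'"

text \<open>The last equation in \<open>rigid\<close> says that \<open>twist C a'\<close> is the dual morphism of \<open>twist C a\<close>;
  it does not depend on the choice of the dual \<open>(a', e, k)\<close>.\<close>

locale ribbon_category = linear_braided_category C
  for C :: "('o, 'm) cat_data" (structure) +
  assumes twist_iso: "is_iso C a a (twist C a)"
    and twist_natural: "f \<in> Mor C a b \<Longrightarrow> twist C b \<cdot> f = f \<cdot> twist C a"
    and balancing:
      "twist C (a \<boxdot> b) = braid C b a \<cdot> braid C a b \<cdot> (twist C a \<boxtimes> twist C b)"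
    and rigid:
      "\<exists>a' e k. is_dual C a a' e k \<and>
         e \<cdot> (twist C a' \<boxtimes> ident C a) = e \<cdot> (ident C a' \<boxtimes> twist C a)"

definition symmetric_braiding :: "('o, 'm, 'x) cat_data_scheme \<Rightarrow> bool" where
  "symmetric_braiding C \<longleftrightarrow>
     (\<forall>a b. braid C b a \<cdot>\<^bsub>C\<^esub> braid C a b = ident C (a \<boxdot>\<^bsub>C\<^esub> b))"

locale symmetric_ribbon_category = ribbon_category C
  for C :: "('o, 'm) cat_data" (structure) +
  assumes symmetric: "symmetric_braiding C"

text \<open>A ribbon functor is a linear strong monoidal functor compatible with braiding and twist;
  duals are then preserved automatically. \<open>J0\<close> and \<open>J\<close> are its unit and tensor constraints.\<close>

locale ribbon_functor =
  C: ribbon_category C + D: ribbon_category D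
  for C :: "('o, 'm) cat_data" and D :: "('p, 'n) cat_data" +
  fixes Fo :: "'o \<Rightarrow> 'p" and Fm :: "'m \<Rightarrow> 'n" and J0 :: 'n and J :: "'o \<Rightarrow> 'o \<Rightarrow> 'n"
  assumes linear: "Fm \<in> module_hom class_ring (Hom C a b) (Hom D (Fo a) (Fo b))"
    and preserves_ident: "Fm (ident C a) = ident D (Fo a)"
    and preserves_comp:
      "\<lbrakk>f \<in> Mor C b c; g \<in> Mor C a b\<rbrakk> \<Longrightarrow> Fm (f \<cdot>\<^bsub>C\<^esub> g) = Fm f \<cdot>\<^bsub>D\<^esub> Fm g"
    and J0_iso: "is_iso D (unit_ob D) (Fo (unit_ob C)) J0"
    and J_iso: "is_iso D (Fo a \<boxdot>\<^bsub>D\<^esub> Fo b) (Fo (a \<boxdot>\<^bsub>C\<^esub> b)) (J a b)"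
    and J_natural:
      "\<lbrakk>f \<in> Mor C a a'; g \<in> Mor C b b'\<rbrakk>
        \<Longrightarrow> Fm (f \<boxtimes>\<^bsub>C\<^esub> g) \<cdot>\<^bsub>D\<^esub> J a b = J a' b' \<cdot>\<^bsub>D\<^esub> (Fm f \<boxtimes>\<^bsub>D\<^esub> Fm g)"
    and preserves_assoc:
      "Fm (assoc C a b c) \<cdot>\<^bsub>D\<^esub> J (a \<boxdot>\<^bsub>C\<^esub> b) c \<cdot>\<^bsub>D\<^esub> (J a b \<boxtimes>\<^bsub>D\<^esub> ident D (Fo c)) =
       J a (b \<boxdot>\<^bsub>C\<^esub> c) \<cdot>\<^bsub>D\<^esub> (ident D (Fo a) \<boxtimes>\<^bsub>D\<^esub> J b c) \<cdot>\<^bsub>D\<^esub> assoc D (Fo a) (Fo b) (Fo c)"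
    and preserves_lunit:
      "Fm (lunit C a) \<cdot>\<^bsub>D\<^esub> J (unit_ob C) a \<cdot>\<^bsub>D\<^esub> (J0 \<boxtimes>\<^bsub>D\<^esub> ident D (Fo a)) = lunit D (Fo a)"
    and preserves_runit:
      "Fm (runit C a) \<cdot>\<^bsub>D\<^esub> J a (unit_ob C) \<cdot>\<^bsub>D\<^esub> (ident D (Fo a) \<boxtimes>\<^bsub>D\<^esub> J0) = runit D (Fo a)"
    and preserves_braid:
      "Fm (braid C a b) \<cdot>\<^bsub>D\<^esub> J a b = J b a \<cdot>\<^bsub>D\<^esub> braid D (Fo a) (Fo b)"
    and preserves_twist: "Fm (twist C a) = twist D (Fo a)"

locale symmetric_ribbon_functor =
  ribbon_functor C D Fo Fm J0 J +
  C: symmetric_ribbon_category C + D: symmetric_ribbon_category D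
  for C :: "('o, 'm) cat_data" and D :: "('p, 'n) cat_data" and Fo Fm J0 J

section \<open>Diagrams built from a self-duality and a trivalent vertex\<close>

text \<open>Powers are bracketed to the left; in particular \<open>tensor_pow C X 3 = X \<boxdot> X \<boxdot> X\<close>.\<close>

fun tensor_pow :: "('o, 'm, 'x) cat_data_scheme \<Rightarrow> 'o \<Rightarrow> nat \<Rightarrow> 'o" where
  "tensor_pow C X 0 = unit_ob C"
| "tensor_pow C X (Suc 0) = X"
| "tensor_pow C X (Suc (Suc n)) = tensor_pow C X (Suc n) \<boxdot>\<^bsub>C\<^esub> X"

definition C_space :: "('o, 'm, 'x) cat_data_scheme \<Rightarrow> 'o \<Rightarrow> nat \<Rightarrow> (complex, 'm) module" where
  "C_space C X n = Hom C (tensor_pow C X n) (unit_ob C)"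

definition merge_mor :: "('o, 'm, 'x) cat_data_scheme \<Rightarrow> 'o \<Rightarrow> 'm \<Rightarrow> 'm \<Rightarrow> 'm" where
  "merge_mor C X coev \<tau> =
     lunit C X \<cdot>\<^bsub>C\<^esub> (\<tau> \<boxtimes>\<^bsub>C\<^esub> ident C X) \<cdot>\<^bsub>C\<^esub> assoc_inv C (X \<boxdot>\<^bsub>C\<^esub> X) X X \<cdot>\<^bsub>C\<^esub>
       (ident C (X \<boxdot>\<^bsub>C\<^esub> X) \<boxtimes>\<^bsub>C\<^esub> coev) \<cdot>\<^bsub>C\<^esub> runit_inv C (X \<boxdot>\<^bsub>C\<^esub> X)"

definition split_mor :: "('o, 'm, 'x) cat_data_scheme \<Rightarrow> 'o \<Rightarrow> 'm \<Rightarrow> 'm \<Rightarrow> 'm" where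
  "split_mor C X coev \<tau> =
     (merge_mor C X coev \<tau> \<boxtimes>\<^bsub>C\<^esub> ident C X) \<cdot>\<^bsub>C\<^esub> assoc_inv C X X X \<cdot>\<^bsub>C\<^esub>
       (ident C X \<boxtimes>\<^bsub>C\<^esub> coev) \<cdot>\<^bsub>C\<^esub> runit_inv C X"

definition H_mor :: "('o, 'm, 'x) cat_data_scheme \<Rightarrow> 'o \<Rightarrow> 'm \<Rightarrow> 'm \<Rightarrow> 'm" where
  "H_mor C X coev \<tau> =
     (ident C X \<boxtimes>\<^bsub>C\<^esub> merge_mor C X coev \<tau>) \<cdot>\<^bsub>C\<^esub> assoc C X X X \<cdot>\<^bsub>C\<^esub>
       (split_mor C X coev \<tau> \<boxtimes>\<^bsub>C\<^esub> ident C X)"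

definition I_mor :: "('o, 'm, 'x) cat_data_scheme \<Rightarrow> 'o \<Rightarrow> 'm \<Rightarrow> 'm \<Rightarrow> 'm" where
  "I_mor C X coev \<tau> = split_mor C X coev \<tau> \<cdot>\<^bsub>C\<^esub> merge_mor C X coev \<tau>"

section \<open>Trivalent ribbon categories\<close>

inductive_set tensor_words :: "('o, 'm, 'x) cat_data_scheme \<Rightarrow> 'o \<Rightarrow> 'o set"
  for C X where
  "unit_ob C \<in> tensor_words C X"
| "X \<in> tensor_words C X"
| "\<lbrakk>a \<in> tensor_words C X; b \<in> tensor_words C X\<rbrakk> \<Longrightarrow> a \<boxdot>\<^bsub>C\<^esub> b \<in> tensor_words C X"

text \<open>\<open>generated C X ev coev \<tau> a b f\<close>: the morphism \<open>f : a \<rightarrow> b\<close> between tensor words in \<open>X\<close> lies in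
  the smallest family of morphisms that contains \<open>\<tau>\<close>, the self-duality of \<open>X\<close> and the structure
  morphisms and is closed under composites, tensor products and linear combinations.\<close>

inductive generated ::
    "('o, 'm, 'x) cat_data_scheme \<Rightarrow> 'o \<Rightarrow> 'm \<Rightarrow> 'm \<Rightarrow> 'm \<Rightarrow> 'o \<Rightarrow> 'o \<Rightarrow> 'm \<Rightarrow> bool"
  for C X ev coev \<tau> where
  gen_tau: "generated C X ev coev \<tau> (tensor_pow C X 3) (unit_ob C) \<tau>"
| gen_ev: "generated C X ev coev \<tau> (X \<boxdot>\<^bsub>C\<^esub> X) (unit_ob C) ev"
| gen_coev: "generated C X ev coev \<tau> (unit_ob C) (X \<boxdot>\<^bsub>C\<^esub> X) coev"
| gen_ident: "a \<in> tensor_words C X \<Longrightarrow> generated C X ev coev \<tau> a a (ident C a)"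
| gen_assoc: "\<lbrakk>a \<in> tensor_words C X; b \<in> tensor_words C X; c \<in> tensor_words C X\<rbrakk> \<Longrightarrow>
    generated C X ev coev \<tau> (a \<boxdot>\<^bsub>C\<^esub> b \<boxdot>\<^bsub>C\<^esub> c) (a \<boxdot>\<^bsub>C\<^esub> (b \<boxdot>\<^bsub>C\<^esub> c)) (assoc C a b c)"
| gen_assoc_inv: "\<lbrakk>a \<in> tensor_words C X; b \<in> tensor_words C X; c \<in> tensor_words C X\<rbrakk> \<Longrightarrow>
    generated C X ev coev \<tau> (a \<boxdot>\<^bsub>C\<^esub> (b \<boxdot>\<^bsub>C\<^esub> c)) (a \<boxdot>\<^bsub>C\<^esub> b \<boxdot>\<^bsub>C\<^esub> c) (assoc_inv C a b c)"
| gen_lunit: "a \<in> tensor_words C X \<Longrightarrow>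
    generated C X ev coev \<tau> (unit_ob C \<boxdot>\<^bsub>C\<^esub> a) a (lunit C a)"
| gen_lunit_inv: "a \<in> tensor_words C X \<Longrightarrow>
    generated C X ev coev \<tau> a (unit_ob C \<boxdot>\<^bsub>C\<^esub> a) (lunit_inv C a)"
| gen_runit: "a \<in> tensor_words C X \<Longrightarrow>
    generated C X ev coev \<tau> (a \<boxdot>\<^bsub>C\<^esub> unit_ob C) a (runit C a)"
| gen_runit_inv: "a \<in> tensor_words C X \<Longrightarrow>
    generated C X ev coev \<tau> a (a \<boxdot>\<^bsub>C\<^esub> unit_ob C) (runit_inv C a)"
| gen_braid: "\<lbrakk>a \<in> tensor_words C X; b \<in> tensor_words C X\<rbrakk> \<Longrightarrow>
    generated C X ev coev \<tau> (a \<boxdot>\<^bsub>C\<^esub> b) (b \<boxdot>\<^bsub>C\<^esub> a) (braid C a b)"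
| gen_braid_inv: "\<lbrakk>a \<in> tensor_words C X; b \<in> tensor_words C X\<rbrakk> \<Longrightarrow>
    generated C X ev coev \<tau> (b \<boxdot>\<^bsub>C\<^esub> a) (a \<boxdot>\<^bsub>C\<^esub> b) (braid_inv C a b)"
| gen_twist: "a \<in> tensor_words C X \<Longrightarrow> generated C X ev coev \<tau> a a (twist C a)"
| gen_twist_inv: "a \<in> tensor_words C X \<Longrightarrow>
    generated C X ev coev \<tau> a a (inv_mor C a a (twist C a))"
| gen_comp: "\<lbrakk>generated C X ev coev \<tau> b c f; generated C X ev coev \<tau> a b g\<rbrakk> \<Longrightarrow>
    generated C X ev coev \<tau> a c (f \<cdot>\<^bsub>C\<^esub> g)"
| gen_tensor: "\<lbrakk>generated C X ev coev \<tau> a b f; generated C X ev coev \<tau> c d g\<rbrakk> \<Longrightarrow>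
    generated C X ev coev \<tau> (a \<boxdot>\<^bsub>C\<^esub> c) (b \<boxdot>\<^bsub>C\<^esub> d) (f \<boxtimes>\<^bsub>C\<^esub> g)"
| gen_zero: "\<lbrakk>a \<in> tensor_words C X; b \<in> tensor_words C X\<rbrakk> \<Longrightarrow>
    generated C X ev coev \<tau> a b \<zero>\<^bsub>Hom C a b\<^esub>"
| gen_add: "\<lbrakk>generated C X ev coev \<tau> a b f; generated C X ev coev \<tau> a b g\<rbrakk> \<Longrightarrow>
    generated C X ev coev \<tau> a b (f \<oplus>\<^bsub>Hom C a b\<^esub> g)"
| gen_smult: "generated C X ev coev \<tau> a b f \<Longrightarrow>
    generated C X ev coev \<tau> a b (r \<odot>\<^bsub>Hom C a b\<^esub> f)"

text \<open>That \<open>C\<close> is generated as a ribbon category by \<open>\<tau>\<close> is expressed by \<open>objects_generated\<close> and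
  \<open>morphisms_generated\<close>. Neither direct sums nor summands are adjoined; duals need no separate
  closure condition because \<open>X\<close> is self-dual.\<close>

locale trivalent_ribbon_category = ribbon_category C
  for C :: "('o, 'm) cat_data" (structure) +
  fixes X :: 'o and ev coev \<tau> :: 'm
  assumes self_dual: "is_dual C X X ev coev"
    and C0: "vectorspace.basis class_ring (C_space C X 0) {ident C (unit_ob C)}"
    and C1: "Mor C X (unit_ob C) = {\<zero>\<^bsub>Hom C X (unit_ob C)\<^esub>}"
    and C2: "vectorspace.basis class_ring (C_space C X 2) {ev}"
    and C3: "vectorspace.basis class_ring (C_space C X 3) {\<tau>}"
    and objects_generated: "\<exists>a' \<in> tensor_words C X. \<exists>f. is_iso C a a' f"
    and morphisms_generated:
      "\<lbrakk>a \<in> tensor_words C X; b \<in> tensor_words C X; f \<in> Mor C a b\<rbrakk>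
        \<Longrightarrow> generated C X ev coev \<tau> a b f"
    and circle_nonzero:
      "\<exists>d. d \<noteq> 0 \<and> ev \<cdot> coev = d \<odot>\<^bsub>Hom C (unit_ob C) (unit_ob C)\<^esub> ident C (unit_ob C)"
    and bigon_nonzero:
      "\<exists>b. b \<noteq> 0 \<and> merge_mor C X coev \<tau> \<cdot> split_mor C X coev \<tau> = b \<odot>\<^bsub>Hom C X X\<^esub> ident C X"

definition QEJac ::
    "('o, 'm, 'x) cat_data_scheme \<Rightarrow> 'o \<Rightarrow> 'm \<Rightarrow> 'm \<Rightarrow> 'm \<Rightarrow> complex \<Rightarrow> complex \<Rightarrow> bool" where
  "QEJac C X ev coev \<tau> v \<alpha> \<longleftrightarrow>
     (let E = Hom C (X \<boxdot>\<^bsub>C\<^esub> X) (X \<boxdot>\<^bsub>C\<^esub> X);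
          m = merge_mor C X coev \<tau>; \<delta> = split_mor C X coev \<tau>;
          H = H_mor C X coev \<tau>; I = I_mor C X coev \<tau>;
          U = coev \<cdot>\<^bsub>C\<^esub> ev; \<sigma> = braid_inv C X X
      in v \<noteq> 0 \<and>
         (v powi (-3) \<odot>\<^bsub>E\<^esub> (H \<cdot>\<^bsub>C\<^esub> \<sigma>)) \<oplus>\<^bsub>E\<^esub> (v \<odot>\<^bsub>E\<^esub> I) \<ominus>\<^bsub>E\<^esub> (v powi (-1) \<odot>\<^bsub>E\<^esub> H) \<oplus>\<^bsub>E\<^esub>
           (\<alpha> \<odot>\<^bsub>E\<^esub> (\<sigma> \<oplus>\<^bsub>E\<^esub> (v ^ 4 \<odot>\<^bsub>E\<^esub> U) \<oplus>\<^bsub>E\<^esub> (v powi (-4) \<odot>\<^bsub>E\<^esub> ident C (X \<boxdot>\<^bsub>C\<^esub> X))))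
           = \<zero>\<^bsub>E\<^esub> \<and>
         (\<exists>d b t.
            ev \<cdot>\<^bsub>C\<^esub> coev = d \<odot>\<^bsub>Hom C (unit_ob C) (unit_ob C)\<^esub> ident C (unit_ob C) \<and>
            m \<cdot>\<^bsub>C\<^esub> coev = \<zero>\<^bsub>Hom C (unit_ob C) X\<^esub> \<and>
            m \<cdot>\<^bsub>C\<^esub> \<delta> = b \<odot>\<^bsub>Hom C X X\<^esub> ident C X \<and>
            H \<cdot>\<^bsub>C\<^esub> \<delta> = t \<odot>\<^bsub>Hom C X (X \<boxdot>\<^bsub>C\<^esub> X)\<^esub> \<delta> \<and>
            \<sigma> \<cdot>\<^bsub>C\<^esub> \<delta> = (- (v ^ 6)) \<odot>\<^bsub>Hom C X (X \<boxdot>\<^bsub>C\<^esub> X)\<^esub> \<delta> \<and>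
            \<sigma> \<cdot>\<^bsub>C\<^esub> coev = v ^ 12 \<odot>\<^bsub>Hom C (unit_ob C) (X \<boxdot>\<^bsub>C\<^esub> X)\<^esub> coev))"

definition primitive_root_of_unity :: "nat \<Rightarrow> complex \<Rightarrow> bool" where
  "primitive_root_of_unity n z \<longleftrightarrow> 0 < n \<and> z ^ n = 1 \<and> (\<forall>k. 0 < k \<and> k < n \<longrightarrow> z ^ k \<noteq> 1)"

section \<open>The category \<open>G2(d)\<close>\<close>

text \<open>
  The presentation of \<open>G2(d)\<close> as a symmetric ribbon category. Its objects are the numbers of
  strands, its morphisms are classes of typed diagram expressions. The congruence \<open>g2_eq d\<close>
  consists of the axioms of a linear strict symmetric monoidal category, the isotopies of the
  strand and the vertex, and the defining relations. All twists are trivial, as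
  kinks can be removed by \<open>s \<circ> coev = coev\<close>.
\<close>

datatype diagram =
    DId nat
  | DComp diagram diagram  (infixl \<open>\<circ>\<^sub>D\<close> 70)
  | DTens diagram diagram  (infixl \<open>\<otimes>\<^sub>D\<close> 75)
  | DZero nat nat
  | DPlus diagram diagram  (infixl \<open>+\<^sub>D\<close> 65)
  | DScale complex diagram  (infixr \<open>*\<^sub>D\<close> 67)
  | DSwap nat nat
  | DCap
  | DCup
  | DVertex

inductive typed :: "diagram \<Rightarrow> nat \<Rightarrow> nat \<Rightarrow> bool" where
  "typed (DId n) n n"
| "\<lbrakk>typed f b c; typed g a b\<rbrakk> \<Longrightarrow> typed (f \<circ>\<^sub>D g) a c"
| "\<lbrakk>typed f a b; typed g c d\<rbrakk> \<Longrightarrow> typed (f \<otimes>\<^sub>D g) (a + c) (b + d)"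
| "typed (DZero a b) a b"
| "\<lbrakk>typed f a b; typed g a b\<rbrakk> \<Longrightarrow> typed (f +\<^sub>D g) a b"
| "typed f a b \<Longrightarrow> typed (r *\<^sub>D f) a b"
| "typed (DSwap a b) (a + b) (b + a)"
| "typed DCap 2 0"
| "typed DCup 0 2"
| "typed DVertex 3 0"

definition d_merge :: diagram where
  "d_merge = (DVertex \<otimes>\<^sub>D DId 1) \<circ>\<^sub>D (DId 2 \<otimes>\<^sub>D DCup)"

definition d_split :: diagram where
  "d_split = (d_merge \<otimes>\<^sub>D DId 1) \<circ>\<^sub>D (DId 1 \<otimes>\<^sub>D DCup)"

definition d_H :: diagram where
  "d_H = (DId 1 \<otimes>\<^sub>D d_merge) \<circ>\<^sub>D (d_split \<otimes>\<^sub>D DId 1)"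

definition d_I :: diagram where
  "d_I = d_split \<circ>\<^sub>D d_merge"

definition d_U :: diagram where
  "d_U = DCup \<circ>\<^sub>D DCap"

text \<open>The first leg of the vertex is bent around to the right.\<close>

definition d_rotated_vertex :: diagram where
  "d_rotated_vertex = DCap \<circ>\<^sub>D (DId 1 \<otimes>\<^sub>D DVertex \<otimes>\<^sub>D DId 1) \<circ>\<^sub>D (DId 3 \<otimes>\<^sub>D DCup)"

inductive g2_eq :: "complex \<Rightarrow> nat \<Rightarrow> nat \<Rightarrow> diagram \<Rightarrow> diagram \<Rightarrow> bool" for d where
  cong_refl: "typed f a b \<Longrightarrow> g2_eq d a b f f"
| cong_sym: "g2_eq d a b f g \<Longrightarrow> g2_eq d a b g f"
| cong_trans: "\<lbrakk>g2_eq d a b f g; g2_eq d a b g h\<rbrakk> \<Longrightarrow> g2_eq d a b f h"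
| cong_comp: "\<lbrakk>g2_eq d b c f f'; g2_eq d a b g g'\<rbrakk> \<Longrightarrow> g2_eq d a c (f \<circ>\<^sub>D g) (f' \<circ>\<^sub>D g')"
| cong_tens: "\<lbrakk>g2_eq d a b f f'; g2_eq d a' b' g g'\<rbrakk>
    \<Longrightarrow> g2_eq d (a + a') (b + b') (f \<otimes>\<^sub>D g) (f' \<otimes>\<^sub>D g')"
| cong_plus: "\<lbrakk>g2_eq d a b f f'; g2_eq d a b g g'\<rbrakk> \<Longrightarrow> g2_eq d a b (f +\<^sub>D g) (f' +\<^sub>D g')"
| cong_scale: "g2_eq d a b f f' \<Longrightarrow> g2_eq d a b (r *\<^sub>D f) (r *\<^sub>D f')"
  \<comment> \<open>vector spaces\<close>
| plus_assoc: "\<lbrakk>typed f a b; typed g a b; typed h a b\<rbrakk>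
    \<Longrightarrow> g2_eq d a b (f +\<^sub>D g +\<^sub>D h) (f +\<^sub>D (g +\<^sub>D h))"
| plus_comm: "\<lbrakk>typed f a b; typed g a b\<rbrakk> \<Longrightarrow> g2_eq d a b (f +\<^sub>D g) (g +\<^sub>D f)"
| plus_zero: "typed f a b \<Longrightarrow> g2_eq d a b (f +\<^sub>D DZero a b) f"
| scale_zero: "typed f a b \<Longrightarrow> g2_eq d a b (0 *\<^sub>D f) (DZero a b)"
| scale_one: "typed f a b \<Longrightarrow> g2_eq d a b (1 *\<^sub>D f) f"
| scale_scale: "typed f a b \<Longrightarrow> g2_eq d a b (r *\<^sub>D s *\<^sub>D f) ((r * s) *\<^sub>D f)"
| scale_add: "typed f a b \<Longrightarrow> g2_eq d a b ((r + s) *\<^sub>D f) (r *\<^sub>D f +\<^sub>D s *\<^sub>D f)"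
| scale_plus: "\<lbrakk>typed f a b; typed g a b\<rbrakk>
    \<Longrightarrow> g2_eq d a b (r *\<^sub>D (f +\<^sub>D g)) (r *\<^sub>D f +\<^sub>D r *\<^sub>D g)"
  \<comment> \<open>category and bilinearity of the composition\<close>
| comp_assoc: "\<lbrakk>typed f c e; typed g b c; typed h a b\<rbrakk>
    \<Longrightarrow> g2_eq d a e (f \<circ>\<^sub>D g \<circ>\<^sub>D h) (f \<circ>\<^sub>D (g \<circ>\<^sub>D h))"
| id_comp: "typed f a b \<Longrightarrow> g2_eq d a b (DId b \<circ>\<^sub>D f) f"
| comp_id: "typed f a b \<Longrightarrow> g2_eq d a b (f \<circ>\<^sub>D DId a) f"
| comp_plus_left: "\<lbrakk>typed f b c; typed f' b c; typed g a b\<rbrakk>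
    \<Longrightarrow> g2_eq d a c ((f +\<^sub>D f') \<circ>\<^sub>D g) (f \<circ>\<^sub>D g +\<^sub>D f' \<circ>\<^sub>D g)"
| comp_plus_right: "\<lbrakk>typed f b c; typed g a b; typed g' a b\<rbrakk>
    \<Longrightarrow> g2_eq d a c (f \<circ>\<^sub>D (g +\<^sub>D g')) (f \<circ>\<^sub>D g +\<^sub>D f \<circ>\<^sub>D g')"
| comp_scale_left: "\<lbrakk>typed f b c; typed g a b\<rbrakk>
    \<Longrightarrow> g2_eq d a c ((r *\<^sub>D f) \<circ>\<^sub>D g) (r *\<^sub>D (f \<circ>\<^sub>D g))"
| comp_scale_right: "\<lbrakk>typed f b c; typed g a b\<rbrakk>
    \<Longrightarrow> g2_eq d a c (f \<circ>\<^sub>D (r *\<^sub>D g)) (r *\<^sub>D (f \<circ>\<^sub>D g))"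
  \<comment> \<open>strict monoidal structure and bilinearity of the tensor product\<close>
| tens_assoc: "\<lbrakk>typed f a b; typed f' a' b'; typed f'' a'' b''\<rbrakk>
    \<Longrightarrow> g2_eq d (a + a' + a'') (b + b' + b'') (f \<otimes>\<^sub>D f' \<otimes>\<^sub>D f'') (f \<otimes>\<^sub>D (f' \<otimes>\<^sub>D f''))"
| id_tens: "typed f a b \<Longrightarrow> g2_eq d a b (DId 0 \<otimes>\<^sub>D f) f"
| tens_id: "typed f a b \<Longrightarrow> g2_eq d a b (f \<otimes>\<^sub>D DId 0) f"
| id_tens_id: "g2_eq d (a + b) (a + b) (DId a \<otimes>\<^sub>D DId b) (DId (a + b))"
| interchange: "\<lbrakk>typed f b c; typed g a b; typed f' b' c'; typed g' a' b'\<rbrakk>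
    \<Longrightarrow> g2_eq d (a + a') (c + c')
          ((f \<circ>\<^sub>D g) \<otimes>\<^sub>D (f' \<circ>\<^sub>D g')) ((f \<otimes>\<^sub>D f') \<circ>\<^sub>D (g \<otimes>\<^sub>D g'))"
| tens_plus_left: "\<lbrakk>typed f a b; typed f' a b; typed g a' b'\<rbrakk>
    \<Longrightarrow> g2_eq d (a + a') (b + b') ((f +\<^sub>D f') \<otimes>\<^sub>D g) (f \<otimes>\<^sub>D g +\<^sub>D f' \<otimes>\<^sub>D g)"
| tens_plus_right: "\<lbrakk>typed f a b; typed g a' b'; typed g' a' b'\<rbrakk>
    \<Longrightarrow> g2_eq d (a + a') (b + b') (f \<otimes>\<^sub>D (g +\<^sub>D g')) (f \<otimes>\<^sub>D g +\<^sub>D f \<otimes>\<^sub>D g')"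
| tens_scale_left: "\<lbrakk>typed f a b; typed g a' b'\<rbrakk>
    \<Longrightarrow> g2_eq d (a + a') (b + b') ((r *\<^sub>D f) \<otimes>\<^sub>D g) (r *\<^sub>D (f \<otimes>\<^sub>D g))"
| tens_scale_right: "\<lbrakk>typed f a b; typed g a' b'\<rbrakk>
    \<Longrightarrow> g2_eq d (a + a') (b + b') (f \<otimes>\<^sub>D (r *\<^sub>D g)) (r *\<^sub>D (f \<otimes>\<^sub>D g))"
  \<comment> \<open>symmetry\<close>
| swap_natural: "\<lbrakk>typed f a b; typed g a' b'\<rbrakk>
    \<Longrightarrow> g2_eq d (a + a') (b' + b) (DSwap b b' \<circ>\<^sub>D (f \<otimes>\<^sub>D g)) ((g \<otimes>\<^sub>D f) \<circ>\<^sub>D DSwap a a')"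
| swap_swap: "g2_eq d (a + b) (a + b) (DSwap b a \<circ>\<^sub>D DSwap a b) (DId (a + b))"
| swap_hexagon: "g2_eq d (a + b + c) (c + a + b)
    (DSwap (a + b) c) ((DSwap a c \<otimes>\<^sub>D DId b) \<circ>\<^sub>D (DId a \<otimes>\<^sub>D DSwap b c))"
  \<comment> \<open>symmetrically self-dual strand, rotationally invariant vertex\<close>
| zigzag_left: "g2_eq d 1 1 ((DCap \<otimes>\<^sub>D DId 1) \<circ>\<^sub>D (DId 1 \<otimes>\<^sub>D DCup)) (DId 1)"
| zigzag_right: "g2_eq d 1 1 ((DId 1 \<otimes>\<^sub>D DCap) \<circ>\<^sub>D (DCup \<otimes>\<^sub>D DId 1)) (DId 1)"
| cap_swap: "g2_eq d 2 0 (DCap \<circ>\<^sub>D DSwap 1 1) DCap"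
| rotation: "g2_eq d 3 0 d_rotated_vertex DVertex"
  \<comment> \<open>defining relations\<close>
| circle: "g2_eq d 0 0 (DCap \<circ>\<^sub>D DCup) (d *\<^sub>D DId 0)"
| swap_cup: "g2_eq d 0 2 (DSwap 1 1 \<circ>\<^sub>D DCup) DCup"
| swap_split: "g2_eq d 1 2 (DSwap 1 1 \<circ>\<^sub>D d_split) ((-1) *\<^sub>D d_split)"
| lollipop: "g2_eq d 0 1 (d_merge \<circ>\<^sub>D DCup) (DZero 0 1)"
| bigon: "g2_eq d 1 1 (d_merge \<circ>\<^sub>D d_split) ((1 - d) *\<^sub>D DId 1)"
| triangle: "g2_eq d 1 2 (d_H \<circ>\<^sub>D d_split) ((d - 4) *\<^sub>D d_split)"
| I_H: "g2_eq d 2 2 (d_I +\<^sub>D d_H)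
    (2 *\<^sub>D DSwap 1 1 +\<^sub>D (-1) *\<^sub>D DId 2 +\<^sub>D (-1) *\<^sub>D d_U)"

definition g2_class :: "complex \<Rightarrow> diagram \<Rightarrow> diagram set" where
  "g2_class d f = {g. \<exists>a b. g2_eq d a b f g}"

definition G2_Hom :: "complex \<Rightarrow> nat \<Rightarrow> nat \<Rightarrow> (complex, diagram set) module" where
  "G2_Hom d a b =
     \<lparr>carrier = {f. typed f a b} // {(f, g). g2_eq d a b f g},
      mult = undefined, one = undefined,
      zero = g2_class d (DZero a b),
      add = (\<lambda>F G. \<Union>f\<in>F. \<Union>g\<in>G. g2_class d (f +\<^sub>D g)),
      smult = (\<lambda>r F. \<Union>f\<in>F. g2_class d (r *\<^sub>D f))\<rparr>"

definition G2 :: "complex \<Rightarrow> (nat, diagram set) cat_data" where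
  "G2 d =
     \<lparr>Hom = G2_Hom d,
      ident = (\<lambda>a. g2_class d (DId a)),
      comp_mor = (\<lambda>F G. \<Union>f\<in>F. \<Union>g\<in>G. g2_class d (f \<circ>\<^sub>D g)),
      unit_ob = 0,
      tensor_ob = (+),
      tensor_mor = (\<lambda>F G. \<Union>f\<in>F. \<Union>g\<in>G. g2_class d (f \<otimes>\<^sub>D g)),
      assoc = (\<lambda>a b c. g2_class d (DId (a + b + c))),
      lunit = (\<lambda>a. g2_class d (DId a)),
      runit = (\<lambda>a. g2_class d (DId a)),
      braid = (\<lambda>a b. g2_class d (DSwap a b)),
      twist = (\<lambda>a. g2_class d (DId a))\<rparr>"

text \<open>The last three conjuncts say that, up to the constraints of the functor, the cap, the cup and
  the vertex of \<open>G2(d)\<close> are sent to \<open>ev\<close>, \<open>coev\<close> and \<open>\<tau>\<close>.\<close>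

definition G2_algebra_object ::
    "('o, 'm) cat_data \<Rightarrow> 'o \<Rightarrow> 'm \<Rightarrow> 'm \<Rightarrow> 'm \<Rightarrow> complex \<Rightarrow> bool" where
  "G2_algebra_object C X ev coev \<tau> d \<longleftrightarrow>
     symmetric_braiding C \<and>
     (\<exists>Fo Fm J0 J. symmetric_ribbon_functor (G2 d) C Fo Fm J0 J \<and>
        Fo 1 = X \<and>
        Fm (g2_class d DCap) \<cdot>\<^bsub>C\<^esub> J 1 1 = J0 \<cdot>\<^bsub>C\<^esub> ev \<and>
        Fm (g2_class d DCup) \<cdot>\<^bsub>C\<^esub> J0 = J 1 1 \<cdot>\<^bsub>C\<^esub> coev \<and>
        Fm (g2_class d DVertex) \<cdot>\<^bsub>C\<^esub> J 2 1 \<cdot>\<^bsub>C\<^esub> (J 1 1 \<boxtimes>\<^bsub>C\<^esub> ident C X) = J0 \<cdot>\<^bsub>C\<^esub> \<tau>)"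

text \<open>The rest of the theory verifies that \<open>G2 d\<close> is a symmetric ribbon category.\<close>

lemma (in linear_category) inv_mor_eqI:
  assumes "inverse_pair C a b f g" shows "inv_mor C a b f = g"
  unfolding inv_mor_def
proof (rule the_equality[of "inverse_pair C a b f", OF assms])
  fix h assume h: "inverse_pair C a b f h"
  have "h = h \<cdot> ident C b" using h by (intro comp_ident[symmetric, of h b a]) (simp add: inverse_pair_def)
  also have "\<dots> = h \<cdot> f \<cdot> g"
    using h assms comp_assoc[of h b a f a g b] by (simp add: inverse_pair_def)
  also have "\<dots> = g"
    using h assms ident_comp[of g b a] by (simp add: inverse_pair_def)
  finally show "h = g" .
qed

primrec d_src :: "diagram \<Rightarrow> nat" where
  "d_src (DId n) = n" | "d_src (f \<circ>\<^sub>D g) = d_src g" | "d_src (f \<otimes>\<^sub>D g) = d_src f + d_src g"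
| "d_src (DZero a b) = a" | "d_src (f +\<^sub>D g) = d_src f" | "d_src (r *\<^sub>D f) = d_src f"
| "d_src (DSwap a b) = a + b" | "d_src DCap = 2" | "d_src DCup = 0" | "d_src DVertex = 3"

primrec d_tgt :: "diagram \<Rightarrow> nat" where
  "d_tgt (DId n) = n" | "d_tgt (f \<circ>\<^sub>D g) = d_tgt f" | "d_tgt (f \<otimes>\<^sub>D g) = d_tgt f + d_tgt g"
| "d_tgt (DZero a b) = b" | "d_tgt (f +\<^sub>D g) = d_tgt f" | "d_tgt (r *\<^sub>D f) = d_tgt f"
| "d_tgt (DSwap a b) = b + a" | "d_tgt DCap = 0" | "d_tgt DCup = 2" | "d_tgt DVertex = 0"

primrec d_wt :: "diagram \<Rightarrow> bool" where
  "d_wt (DId n) = True" | "d_wt (f \<circ>\<^sub>D g) = (d_wt f \<and> d_wt g \<and> d_src f = d_tgt g)"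
| "d_wt (f \<otimes>\<^sub>D g) = (d_wt f \<and> d_wt g)" | "d_wt (DZero a b) = True"
| "d_wt (f +\<^sub>D g) = (d_wt f \<and> d_wt g \<and> d_src f = d_src g \<and> d_tgt f = d_tgt g)"
| "d_wt (r *\<^sub>D f) = d_wt f"
| "d_wt (DSwap a b) = True" | "d_wt DCap = True" | "d_wt DCup = True" | "d_wt DVertex = True"

lemma typed_iff: "typed f a b \<longleftrightarrow> d_wt f \<and> d_src f = a \<and> d_tgt f = b"
proof
  show "typed f a b \<Longrightarrow> d_wt f \<and> d_src f = a \<and> d_tgt f = b" by (induction rule: typed.induct) auto
  have "d_wt f \<Longrightarrow> typed f (d_src f) (d_tgt f)"
  proof (induction f)
    case (DComp f g)
    then show ?case using typed.intros(2)[of f "d_src f" "d_tgt f" g "d_src g"] by simp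
  qed (simp_all add: typed.intros(1,3-10))
  then show "d_wt f \<and> d_src f = a \<and> d_tgt f = b \<Longrightarrow> typed f a b" by auto
qed

lemmas d_defs = d_merge_def d_split_def d_H_def d_I_def d_U_def d_rotated_vertex_def

lemma g2_eq_typed: "g2_eq d a b f g \<Longrightarrow> typed f a b \<and> typed g a b"
  unfolding typed_iff
  by (induction rule: g2_eq.induct) (simp_all add: typed_iff d_defs)

context fixes d :: complex begin

private abbreviation (input) "Cl \<equiv> g2_class d"

lemma g2_class_eq: "typed f a b \<Longrightarrow> Cl f = {g. g2_eq d a b f g}"
  unfolding g2_class_def using g2_eq_typed by (fastforce simp: typed_iff)

lemma g2_class_eqI: "g2_eq d a b f g \<Longrightarrow> Cl f = Cl g"
  using g2_eq_typed[of d a b f g] g2_class_eq[of f a b] g2_class_eq[of g a b]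
  by (blast intro: g2_eq.cong_sym g2_eq.cong_trans)

lemma g2_class_memE: "g \<in> Cl f \<Longrightarrow> typed f a b \<Longrightarrow> g2_eq d a b f g"
  using g2_class_eq by auto

lemma g2_class_self: "typed f a b \<Longrightarrow> f \<in> Cl f"
  using g2_class_eq g2_eq.cong_refl by auto

private lemma UN_g2_class:
  assumes "typed f a b" "typed g a' b'"
    and "\<And>f' g'. g2_eq d a b f f' \<Longrightarrow> g2_eq d a' b' g g' \<Longrightarrow> Cl (op f' g') = Cl (op f g)"
  shows "(\<Union>x\<in>Cl f. \<Union>y\<in>Cl g. Cl (op x y)) = Cl (op f g)"
proof -
  have "Cl (op x y) = Cl (op f g)" if "x \<in> Cl f" "y \<in> Cl g" for x y
    using assms(3) g2_class_memE[OF that(1) assms(1)] g2_class_memE[OF that(2) assms(2)] by blast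
  with g2_class_self[OF assms(1)] g2_class_self[OF assms(2)] show ?thesis by blast
qed

lemma comp_g2_class: "typed f b c \<Longrightarrow> typed g a b \<Longrightarrow> Cl f \<cdot>\<^bsub>G2 d\<^esub> Cl g = Cl (f \<circ>\<^sub>D g)"
  unfolding G2_def by simp (rule UN_g2_class, assumption, assumption, rule g2_class_eqI[OF g2_eq.cong_sym[OF g2_eq.cong_comp]])

lemma tens_g2_class: "typed f a b \<Longrightarrow> typed g a' b' \<Longrightarrow> Cl f \<boxtimes>\<^bsub>G2 d\<^esub> Cl g = Cl (f \<otimes>\<^sub>D g)"
  unfolding G2_def by simp (rule UN_g2_class, assumption, assumption, rule g2_class_eqI[OF g2_eq.cong_sym[OF g2_eq.cong_tens]])

lemma add_g2_class: "typed f a b \<Longrightarrow> typed g a b \<Longrightarrow> Cl f \<oplus>\<^bsub>Hom (G2 d) a b\<^esub> Cl g = Cl (f +\<^sub>D g)"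
  unfolding G2_def G2_Hom_def by simp (rule UN_g2_class, assumption, assumption, rule g2_class_eqI[OF g2_eq.cong_sym[OF g2_eq.cong_plus]])

lemma smult_g2_class: assumes "typed f a b" shows "r \<odot>\<^bsub>Hom (G2 d) a b\<^esub> Cl f = Cl (r *\<^sub>D f)"
proof -
  have "Cl (r *\<^sub>D x) = Cl (r *\<^sub>D f)" if "x \<in> Cl f" for x
    by (rule g2_class_eqI[OF g2_eq.cong_sym[OF g2_eq.cong_scale[OF g2_class_memE[OF that assms]]]])
  with g2_class_self[OF assms] have "(\<Union>x\<in>Cl f. Cl (r *\<^sub>D x)) = Cl (r *\<^sub>D f)" by blast
  then show ?thesis unfolding G2_def G2_Hom_def by simp
qed

lemma zero_g2_class: "\<zero>\<^bsub>Hom (G2 d) a b\<^esub> = Cl (DZero a b)"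
  unfolding G2_def G2_Hom_def by simp

lemma Mor_G2: "Mor (G2 d) a b = {Cl f | f. typed f a b}"
proof -
  have "{(f, g). g2_eq d a b f g} `` {f} = Cl f" if "typed f a b" for f
    using g2_class_eq[OF that] by auto
  then show ?thesis unfolding G2_def G2_Hom_def quotient_def by auto
qed

lemma G2_simps:
  "ident (G2 d) a = Cl (DId a)" "unit_ob (G2 d) = 0" "a \<boxdot>\<^bsub>G2 d\<^esub> b = a + b"
  "assoc (G2 d) a b c = Cl (DId (a + b + c))" "lunit (G2 d) a = Cl (DId a)"
  "runit (G2 d) a = Cl (DId a)" "braid (G2 d) a b = Cl (DSwap a b)" "twist (G2 d) a = Cl (DId a)"
  by (simp_all add: G2_def)

lemma comp_g2_class': "d_wt f \<Longrightarrow> d_wt g \<Longrightarrow> d_src f = d_tgt g \<Longrightarrow> Cl f \<cdot>\<^bsub>G2 d\<^esub> Cl g = Cl (f \<circ>\<^sub>D g)"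
  by (rule comp_g2_class) (auto simp: typed_iff)

lemma tens_g2_class': "d_wt f \<Longrightarrow> d_wt g \<Longrightarrow> Cl f \<boxtimes>\<^bsub>G2 d\<^esub> Cl g = Cl (f \<otimes>\<^sub>D g)"
  by (rule tens_g2_class) (auto simp: typed_iff)

lemma G2_vectorspace: "vectorspace class_ring (Hom (G2 d) a b)"
proof -
  have ag: "abelian_group (Hom (G2 d) a b)"
  proof (rule abelian_groupI)
    fix x assume "x \<in> Mor (G2 d) a b"
    then obtain f where f: "x = Cl f" "typed f a b" by (auto simp: Mor_G2)
    have t: "typed ((-1) *\<^sub>D f) a b" by (rule typed.intros(6), rule f)
    have "g2_eq d a b ((-1) *\<^sub>D f +\<^sub>D f) ((-1) *\<^sub>D f +\<^sub>D 1 *\<^sub>D f)"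
      using f t by (intro g2_eq.cong_plus g2_eq.cong_refl g2_eq.cong_sym[OF g2_eq.scale_one])
    moreover have "g2_eq d a b ((-1) *\<^sub>D f +\<^sub>D 1 *\<^sub>D f) (((-1) + 1) *\<^sub>D f)"
      using f by (intro g2_eq.cong_sym[OF g2_eq.scale_add])
    moreover have "g2_eq d a b (((-1) + 1) *\<^sub>D f) (DZero a b)"
      using f g2_eq.scale_zero by simp
    ultimately have "Cl ((-1) *\<^sub>D f +\<^sub>D f) = Cl (DZero a b)"
      using g2_class_eqI by metis
    then have "Cl ((-1) *\<^sub>D f) \<oplus>\<^bsub>Hom (G2 d) a b\<^esub> x = \<zero>\<^bsub>Hom (G2 d) a b\<^esub>"
      using add_g2_class[OF t f(2)] zero_g2_class f by simp
    then show "\<exists>y\<in>Mor (G2 d) a b. y \<oplus>\<^bsub>Hom (G2 d) a b\<^esub> x = \<zero>\<^bsub>Hom (G2 d) a b\<^esub>"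
      using t by (auto simp: Mor_G2)
    have "Cl (DZero a b +\<^sub>D f) = Cl f"
      by (rule g2_class_eqI, rule g2_eq.cong_trans, rule g2_eq.plus_comm, rule typed.intros, rule f, rule g2_eq.plus_zero, rule f)
    then show "\<zero>\<^bsub>Hom (G2 d) a b\<^esub> \<oplus>\<^bsub>Hom (G2 d) a b\<^esub> x = x"
      using f add_g2_class[of "DZero a b" a b f] typed.intros(4) by (simp add: zero_g2_class)
  next
    fix x y assume "x \<in> Mor (G2 d) a b" "y \<in> Mor (G2 d) a b"
    then obtain f g where f: "x = Cl f" "typed f a b" "y = Cl g" "typed g a b"
      by (auto simp: Mor_G2)
    show "x \<oplus>\<^bsub>Hom (G2 d) a b\<^esub> y \<in> Mor (G2 d) a b"
      using f typed.intros(5) by (auto simp: add_g2_class Mor_G2)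
    show "x \<oplus>\<^bsub>Hom (G2 d) a b\<^esub> y = y \<oplus>\<^bsub>Hom (G2 d) a b\<^esub> x"
      using f by (simp add: add_g2_class) (rule g2_class_eqI, rule g2_eq.plus_comm)
    fix z assume "z \<in> Mor (G2 d) a b"
    then obtain h where h: "z = Cl h" "typed h a b" by (auto simp: Mor_G2)
    show "x \<oplus>\<^bsub>Hom (G2 d) a b\<^esub> y \<oplus>\<^bsub>Hom (G2 d) a b\<^esub> z = x \<oplus>\<^bsub>Hom (G2 d) a b\<^esub> (y \<oplus>\<^bsub>Hom (G2 d) a b\<^esub> z)"
      using f h by (simp add: add_g2_class typed.intros(5)) (rule g2_class_eqI, rule g2_eq.plus_assoc)
  qed (auto simp: zero_g2_class Mor_G2 intro: typed.intros(4))
  have "module class_ring (Hom (G2 d) a b)"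
  proof (rule moduleI)
    show "cring (class_ring :: complex ring)" by (rule domain.axioms(1), rule field.axioms(1), rule class_field) 
    show "abelian_group (Hom (G2 d) a b)" by (rule ag)
    fix r s :: complex and x assume "x \<in> Mor (G2 d) a b"
    then obtain f where f: "x = Cl f" "typed f a b" by (auto simp: Mor_G2)
    show "r \<odot>\<^bsub>Hom (G2 d) a b\<^esub> x \<in> Mor (G2 d) a b"
      using f typed.intros(6) by (auto simp: smult_g2_class Mor_G2)
    show "(r \<oplus>\<^bsub>class_ring\<^esub> s) \<odot>\<^bsub>Hom (G2 d) a b\<^esub> x =
        r \<odot>\<^bsub>Hom (G2 d) a b\<^esub> x \<oplus>\<^bsub>Hom (G2 d) a b\<^esub> s \<odot>\<^bsub>Hom (G2 d) a b\<^esub> x"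
      using f by (simp add: smult_g2_class add_g2_class typed.intros(6)) (rule g2_class_eqI, rule g2_eq.scale_add)
    show "(r \<otimes>\<^bsub>class_ring\<^esub> s) \<odot>\<^bsub>Hom (G2 d) a b\<^esub> x =
        r \<odot>\<^bsub>Hom (G2 d) a b\<^esub> (s \<odot>\<^bsub>Hom (G2 d) a b\<^esub> x)"
      using f by (simp add: smult_g2_class typed.intros(6)) (rule g2_class_eqI[OF g2_eq.cong_sym[OF g2_eq.scale_scale]])
    show "\<one>\<^bsub>class_ring\<^esub> \<odot>\<^bsub>Hom (G2 d) a b\<^esub> x = x"
      using f by (simp add: smult_g2_class) (rule g2_class_eqI, rule g2_eq.scale_one)
    fix y assume "y \<in> Mor (G2 d) a b"
    then obtain g where g: "y = Cl g" "typed g a b" by (auto simp: Mor_G2)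
    show "r \<odot>\<^bsub>Hom (G2 d) a b\<^esub> (x \<oplus>\<^bsub>Hom (G2 d) a b\<^esub> y) =
        r \<odot>\<^bsub>Hom (G2 d) a b\<^esub> x \<oplus>\<^bsub>Hom (G2 d) a b\<^esub> r \<odot>\<^bsub>Hom (G2 d) a b\<^esub> y"
      using f g by (simp add: smult_g2_class add_g2_class typed.intros(5,6)) (rule g2_class_eqI, rule g2_eq.scale_plus)
  qed
  then show ?thesis by (simp add: vectorspace_def class_field)
qed

private lemma G2_homI:
  assumes "\<And>f. typed f a b \<Longrightarrow> \<phi> (Cl f) = Cl (\<psi> f) \<and> typed (\<psi> f) a' b'"
    and "\<And>f g. typed f a b \<Longrightarrow> typed g a b \<Longrightarrow> g2_eq d a' b' (\<psi> (f +\<^sub>D g)) (\<psi> f +\<^sub>D \<psi> g)"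
    and "\<And>r f. typed f a b \<Longrightarrow> g2_eq d a' b' (\<psi> (r *\<^sub>D f)) (r *\<^sub>D \<psi> f)"
  shows "\<phi> \<in> module_hom class_ring (Hom (G2 d) a b) (Hom (G2 d) a' b')"
proof -
  have "\<phi> (Cl f \<oplus>\<^bsub>Hom (G2 d) a b\<^esub> Cl g) = \<phi> (Cl f) \<oplus>\<^bsub>Hom (G2 d) a' b'\<^esub> \<phi> (Cl g)"
    if "typed f a b" "typed g a b" for f g
    using that assms(1)[of f] assms(1)[of g] assms(1)[of "f +\<^sub>D g"] typed.intros(5)[OF that]
      g2_class_eqI[OF assms(2)[OF that]] by (simp add: add_g2_class)
  moreover have "\<phi> (r \<odot>\<^bsub>Hom (G2 d) a b\<^esub> Cl f) = r \<odot>\<^bsub>Hom (G2 d) a' b'\<^esub> \<phi> (Cl f)"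
    if "typed f a b" for r f
    using that assms(1)[of f] assms(1)[of "r *\<^sub>D f"] typed.intros(6)[OF that]
      g2_class_eqI[OF assms(3)[OF that]] by (simp add: smult_g2_class)
  moreover have "\<phi> (Cl f) \<in> Mor (G2 d) a' b'" if "typed f a b" for f
    using assms(1)[OF that] by (auto simp: Mor_G2)
  ultimately show ?thesis unfolding LinearCombinations.module_hom_def by (auto simp: Mor_G2)
qed

private lemma Mor_E: "x \<in> Mor (G2 d) a b \<Longrightarrow> (\<And>f. x = Cl f \<Longrightarrow> typed f a b \<Longrightarrow> P) \<Longrightarrow> P"
  by (auto simp: Mor_G2)

lemma g2_class_id_comp: "d_wt f \<Longrightarrow> d_tgt f = b \<Longrightarrow> Cl (DId b \<circ>\<^sub>D f) = Cl f"
  by (rule g2_class_eqI, rule g2_eq.id_comp) (auto simp: typed_iff)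
lemma g2_class_comp_id: "d_wt f \<Longrightarrow> d_src f = a \<Longrightarrow> Cl (f \<circ>\<^sub>D DId a) = Cl f"
  by (rule g2_class_eqI, rule g2_eq.comp_id) (auto simp: typed_iff)
lemma g2_class_id_id: "Cl (DId a \<otimes>\<^sub>D DId b) = Cl (DId (a + b))"
  by (rule g2_class_eqI, rule g2_eq.id_tens_id)
lemma g2_class_tens_assoc: "d_wt f \<Longrightarrow> d_wt g \<Longrightarrow> d_wt h \<Longrightarrow> Cl (f \<otimes>\<^sub>D g \<otimes>\<^sub>D h) = Cl (f \<otimes>\<^sub>D (g \<otimes>\<^sub>D h))"
  by (rule g2_class_eqI, rule g2_eq.tens_assoc) (auto simp: typed_iff)
lemma g2_class_tens_id: "d_wt f \<Longrightarrow> Cl (f \<otimes>\<^sub>D DId 0) = Cl f"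
  by (rule g2_class_eqI, rule g2_eq.tens_id) (auto simp: typed_iff)
lemma g2_class_id_tens: "d_wt f \<Longrightarrow> Cl (DId 0 \<otimes>\<^sub>D f) = Cl f"
  by (rule g2_class_eqI, rule g2_eq.id_tens) (auto simp: typed_iff)

lemma g2_class_comp_assoc: "d_wt f \<Longrightarrow> d_wt g \<Longrightarrow> d_wt h \<Longrightarrow> d_src f = d_tgt g \<Longrightarrow> d_src g = d_tgt h
    \<Longrightarrow> Cl (f \<circ>\<^sub>D g \<circ>\<^sub>D h) = Cl (f \<circ>\<^sub>D (g \<circ>\<^sub>D h))"
  by (rule g2_class_eqI, rule g2_eq.comp_assoc) (auto simp: typed_iff)
lemma g2_class_interchange: "d_wt f \<Longrightarrow> d_wt g \<Longrightarrow> d_wt h \<Longrightarrow> d_wt k \<Longrightarrow> d_src f = d_tgt g \<Longrightarrow> d_src h = d_tgt k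
    \<Longrightarrow> Cl ((f \<circ>\<^sub>D g) \<otimes>\<^sub>D (h \<circ>\<^sub>D k)) = Cl ((f \<otimes>\<^sub>D h) \<circ>\<^sub>D (g \<otimes>\<^sub>D k))"
  by (rule g2_class_eqI, rule g2_eq.interchange) (auto simp: typed_iff)

private lemma comp_left_hom: assumes "g \<in> Mor (G2 d) a b"
  shows "(\<lambda>f. f \<cdot>\<^bsub>G2 d\<^esub> g) \<in> module_hom class_ring (Hom (G2 d) b c) (Hom (G2 d) a c)"
proof -
  from assms obtain g' where g: "g = Cl g'" "typed g' a b" by (rule Mor_E)
  show ?thesis unfolding g(1)
    by (rule G2_homI[where \<psi> = "\<lambda>f. f \<circ>\<^sub>D g'"])
      (use g(2) in \<open>auto simp: comp_g2_class intro: typed.intros(2) g2_eq.comp_plus_left g2_eq.comp_scale_left\<close>)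
qed

private lemma comp_right_hom: assumes "f \<in> Mor (G2 d) b c"
  shows "(\<lambda>g. f \<cdot>\<^bsub>G2 d\<^esub> g) \<in> module_hom class_ring (Hom (G2 d) a b) (Hom (G2 d) a c)"
proof -
  from assms obtain g' where g: "f = Cl g'" "typed g' b c" by (rule Mor_E)
  show ?thesis unfolding g(1)
    by (rule G2_homI[where \<psi> = "\<lambda>f. g' \<circ>\<^sub>D f"])
      (use g(2) in \<open>auto simp: comp_g2_class intro: typed.intros(2) g2_eq.comp_plus_right g2_eq.comp_scale_right\<close>)
qed

private lemma tens_left_hom: assumes "g \<in> Mor (G2 d) a' b'"
  shows "(\<lambda>f. f \<boxtimes>\<^bsub>G2 d\<^esub> g) \<in> module_hom class_ring (Hom (G2 d) a b) (Hom (G2 d) (a + a') (b + b'))"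
proof -
  from assms obtain g' where g: "g = Cl g'" "typed g' a' b'" by (rule Mor_E)
  show ?thesis unfolding g(1)
    by (rule G2_homI[where \<psi> = "\<lambda>f. f \<otimes>\<^sub>D g'"])
      (use g(2) in \<open>auto simp: tens_g2_class intro: typed.intros(3) g2_eq.tens_plus_left g2_eq.tens_scale_left\<close>)
qed

private lemma tens_right_hom: assumes "f \<in> Mor (G2 d) a b"
  shows "(\<lambda>g. f \<boxtimes>\<^bsub>G2 d\<^esub> g) \<in> module_hom class_ring (Hom (G2 d) a' b') (Hom (G2 d) (a + a') (b + b'))"
proof -
  from assms obtain g' where g: "f = Cl g'" "typed g' a b" by (rule Mor_E)
  show ?thesis unfolding g(1)
    by (rule G2_homI[where \<psi> = "\<lambda>f. g' \<otimes>\<^sub>D f"])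
      (use g(2) in \<open>auto simp: tens_g2_class intro: typed.intros(3) g2_eq.tens_plus_right g2_eq.tens_scale_right\<close>)
qed

lemma g2_class_closed: "d_wt f \<Longrightarrow> d_src f = a \<Longrightarrow> d_tgt f = b \<Longrightarrow> Cl f \<in> Mor (G2 d) a b"
  by (auto simp: Mor_G2 typed_iff)

private lemma Mor_E': "x \<in> Mor (G2 d) a b \<Longrightarrow> (\<And>f. x = Cl f \<Longrightarrow> d_wt f \<Longrightarrow> d_src f = a \<Longrightarrow> d_tgt f = b \<Longrightarrow> P) \<Longrightarrow> P"
  by (auto simp: Mor_G2 typed_iff)

lemma G2_linear_category: "linear_category (G2 d)"
  apply (rule linear_category.intro)
         apply (rule G2_vectorspace)
        apply (simp add: G2_simps g2_class_closed)
       apply (elim Mor_E', simp add: comp_g2_class' g2_class_closed)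
      apply (elim Mor_E', simp add: comp_g2_class' g2_class_comp_assoc)
     apply (elim Mor_E', simp add: G2_simps comp_g2_class' g2_class_id_comp)
    apply (elim Mor_E', simp add: G2_simps comp_g2_class' g2_class_comp_id)
   apply (erule comp_left_hom)
  apply (erule comp_right_hom)
  done

interpretation G: linear_category "G2 d" by (rule G2_linear_category)

private lemma id_pair: "inverse_pair (G2 d) a a (Cl (DId a)) (Cl (DId a))"
  unfolding inverse_pair_def by (simp add: G2_simps comp_g2_class' g2_class_id_comp g2_class_closed)

private lemma id_iso: "is_iso (G2 d) a a (Cl (DId a))" using id_pair by (auto simp: is_iso_def)

private lemma inv_id: "inv_mor (G2 d) a a (Cl (DId a)) = Cl (DId a)"
  by (rule G.inv_mor_eqI[OF id_pair])

lemma G2_monoidal: "linear_monoidal_category (G2 d)"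
  apply (rule linear_monoidal_category.intro, rule G2_linear_category, rule linear_monoidal_category_axioms.intro)
  unfolding G2_simps
              apply (elim Mor_E', simp add: tens_g2_class' g2_class_closed)
             apply (simp add: tens_g2_class' g2_class_id_id)
            apply (elim Mor_E', simp add: comp_g2_class' tens_g2_class' g2_class_interchange)
           apply (erule tens_left_hom)
          apply (erule tens_right_hom)
         apply (simp add: id_iso add.assoc[symmetric])
        apply (simp add: id_iso)
       apply (simp add: id_iso)
      apply (elim Mor_E', simp add: comp_g2_class' tens_g2_class' g2_class_id_comp g2_class_comp_id g2_class_tens_assoc)
     apply (elim Mor_E', simp add: comp_g2_class' tens_g2_class' g2_class_id_comp g2_class_comp_id g2_class_id_tens)
    apply (elim Mor_E', simp add: comp_g2_class' tens_g2_class' g2_class_id_comp g2_class_comp_id g2_class_tens_id)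
   apply (simp add: comp_g2_class' tens_g2_class' g2_class_id_id g2_class_id_comp g2_class_comp_id add.assoc)
  apply (simp add: comp_g2_class' tens_g2_class' g2_class_id_id g2_class_id_comp g2_class_comp_id add.assoc)
  done

lemma g2_class_swap_swap: "Cl (DSwap b a \<circ>\<^sub>D DSwap a b) = Cl (DId (a + b))"
  by (rule g2_class_eqI, rule g2_eq.swap_swap)

private lemma swap_pair: "inverse_pair (G2 d) (a + b) (b + a) (Cl (DSwap a b)) (Cl (DSwap b a))"
  unfolding inverse_pair_def by (simp add: G2_simps comp_g2_class' g2_class_swap_swap g2_class_closed add.commute)

lemma g2_class_swap_natural: "d_wt f \<Longrightarrow> d_wt g \<Longrightarrow> d_src f = a \<Longrightarrow> d_src g = b \<Longrightarrow> d_tgt f = a' \<Longrightarrow> d_tgt g = b' \<Longrightarrow>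
    Cl (DSwap a' b' \<circ>\<^sub>D (f \<otimes>\<^sub>D g)) = Cl ((g \<otimes>\<^sub>D f) \<circ>\<^sub>D DSwap a b)"
  by (rule g2_class_eqI, rule g2_eq.swap_natural) (auto simp: typed_iff)

lemma g2_class_hexagon: "Cl (DSwap (a + b) c) = Cl ((DSwap a c \<otimes>\<^sub>D DId b) \<circ>\<^sub>D (DId a \<otimes>\<^sub>D DSwap b c))"
  by (rule g2_class_eqI, rule g2_eq.swap_hexagon)

definition g2_ok :: "diagram set \<Rightarrow> bool" where "g2_ok x \<longleftrightarrow> (\<exists>f. d_wt f \<and> x = Cl f)"
definition g2_src :: "diagram set \<Rightarrow> nat" where "g2_src x = d_src (SOME f. f \<in> x)"
definition g2_tgt :: "diagram set \<Rightarrow> nat" where "g2_tgt x = d_tgt (SOME f. f \<in> x)"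

private abbreviation (input) cmp (infixl "\<star>" 70) where "x \<star> y \<equiv> x \<cdot>\<^bsub>G2 d\<^esub> y"
private abbreviation (input) tns (infixl "\<diamondop>" 75) where "x \<diamondop> y \<equiv> x \<boxtimes>\<^bsub>G2 d\<^esub> y"
private abbreviation (input) Id where "Id a \<equiv> Cl (DId a)"

private lemma cs_ct: assumes "d_wt f" shows "g2_src (Cl f) = d_src f" "g2_tgt (Cl f) = d_tgt f"
proof -
  have t: "typed f (d_src f) (d_tgt f)" using assms by (simp add: typed_iff)
  have "(SOME g. g \<in> Cl f) \<in> Cl f" using g2_class_self[OF t] by (rule someI)
  then have "typed (SOME g. g \<in> Cl f) (d_src f) (d_tgt f)" using g2_class_memE[OF _ t] g2_eq_typed by blast
  then show "g2_src (Cl f) = d_src f" "g2_tgt (Cl f) = d_tgt f" by (simp_all add: g2_src_def g2_tgt_def typed_iff)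
qed

private lemma ok_Cl: "d_wt f \<Longrightarrow> g2_ok (Cl f)" by (auto simp: g2_ok_def)

private lemma okE: "g2_ok x \<Longrightarrow> (\<And>f. x = Cl f \<Longrightarrow> d_wt f \<Longrightarrow> P) \<Longrightarrow> P" by (auto simp: g2_ok_def)

private lemma ok_comp: "g2_ok x \<Longrightarrow> g2_ok y \<Longrightarrow> g2_src x = g2_tgt y \<Longrightarrow> g2_ok (x \<star> y) \<and> g2_src (x \<star> y) = g2_src y \<and> g2_tgt (x \<star> y) = g2_tgt x"
  by (elim okE) (simp add: comp_g2_class' cs_ct ok_Cl)
private lemma ok_tens: "g2_ok x \<Longrightarrow> g2_ok y \<Longrightarrow> g2_ok (x \<diamondop> y) \<and> g2_src (x \<diamondop> y) = g2_src x + g2_src y \<and> g2_tgt (x \<diamondop> y) = g2_tgt x + g2_tgt y"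
  by (elim okE) (simp add: tens_g2_class' cs_ct ok_Cl)

private lemma ok_Id: "g2_ok (Id a)" "g2_src (Id a) = a" "g2_tgt (Id a) = a" by (simp_all add: cs_ct ok_Cl)
private lemma ok_Cap: "g2_ok (Cl DCap)" "g2_src (Cl DCap) = 2" "g2_tgt (Cl DCap) = 0" by (simp_all add: cs_ct ok_Cl)
private lemma ok_Cup: "g2_ok (Cl DCup)" "g2_src (Cl DCup) = 0" "g2_tgt (Cl DCup) = 2" by (simp_all add: cs_ct ok_Cl)
private lemma ok_Swap: "g2_ok (Cl (DSwap a b))" "g2_src (Cl (DSwap a b)) = a + b" "g2_tgt (Cl (DSwap a b)) = b + a"
  by (simp_all add: cs_ct ok_Cl)
private lemmas ok_simps = ok_comp ok_tens ok_Id ok_Cap ok_Cup ok_Swap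

private lemma Mor_ok: "x \<in> Mor (G2 d) a b \<longleftrightarrow> g2_ok x \<and> g2_src x = a \<and> g2_tgt x = b"
  by (auto simp: Mor_G2 typed_iff cs_ct ok_Cl elim!: okE)

private lemma c_assoc: "g2_ok x \<Longrightarrow> g2_ok y \<Longrightarrow> g2_ok z \<Longrightarrow> g2_src x = g2_tgt y \<Longrightarrow> g2_src y = g2_tgt z \<Longrightarrow> x \<star> y \<star> z = x \<star> (y \<star> z)"
  by (elim okE) (simp add: cs_ct comp_g2_class' g2_class_comp_assoc)
private lemma c_id: "g2_ok x \<Longrightarrow> g2_tgt x = a \<Longrightarrow> Id a \<star> x = x" "g2_ok x \<Longrightarrow> g2_src x = a \<Longrightarrow> x \<star> Id a = x"
  by (elim okE, simp add: cs_ct comp_g2_class' g2_class_id_comp g2_class_comp_id)+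
private lemma t_assoc: "g2_ok x \<Longrightarrow> g2_ok y \<Longrightarrow> g2_ok z \<Longrightarrow> x \<diamondop> y \<diamondop> z = x \<diamondop> (y \<diamondop> z)"
  by (elim okE) (simp add: tens_g2_class' g2_class_tens_assoc)
private lemma t_id: "g2_ok x \<Longrightarrow> Id 0 \<diamondop> x = x" "g2_ok x \<Longrightarrow> x \<diamondop> Id 0 = x"
  by (elim okE, simp add: tens_g2_class' g2_class_id_tens g2_class_tens_id)+
private lemma t_id_id: "Id a \<diamondop> Id b = Id (a + b)" by (simp add: tens_g2_class' g2_class_id_id)
private lemma inter: "g2_ok x \<Longrightarrow> g2_ok y \<Longrightarrow> g2_ok z \<Longrightarrow> g2_ok w \<Longrightarrow> g2_src x = g2_tgt y \<Longrightarrow> g2_src z = g2_tgt w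
    \<Longrightarrow> (x \<diamondop> z) \<star> (y \<diamondop> w) = (x \<star> y) \<diamondop> (z \<star> w)"
  by (elim okE) (simp add: cs_ct comp_g2_class' tens_g2_class' g2_class_interchange)

private lemma c_hexagon: "Cl (DSwap (a + b) c) = (Cl (DSwap a c) \<diamondop> Id b) \<star> (Id a \<diamondop> Cl (DSwap b c))"
  by (simp add: comp_g2_class' tens_g2_class' g2_class_hexagon add_ac)

private lemma c_swap: "Cl (DSwap b a) \<star> Cl (DSwap a b) = Id (a + b)"
  by (simp add: comp_g2_class' g2_class_swap_swap add_ac)

private lemma c_hexagon': "Cl (DSwap a (b + c)) = (Id b \<diamondop> Cl (DSwap a c)) \<star> (Cl (DSwap a b) \<diamondop> Id c)"
    (is "?X = ?P \<star> ?Q")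
proof -
  let ?S = "Cl (DSwap (b + c) a)" and ?R = "Cl (DSwap b a) \<diamondop> Id c" and ?T = "Id b \<diamondop> Cl (DSwap c a)"
  note simps = ok_simps add_ac
  have "?Q \<star> ?R = Id (b + a) \<diamondop> Id c" by (subst inter) (simp_all add: simps c_swap c_id)
  then have QR: "?Q \<star> ?R = Id (b + a + c)" by (simp add: t_id_id)
  have "?P \<star> ?T = Id b \<diamondop> Id (c + a)" by (subst inter) (simp_all add: simps c_swap c_id)
  then have PT: "?P \<star> ?T = Id (b + c + a)" by (simp add: t_id_id add_ac)
  have "(?P \<star> ?Q) \<star> (?R \<star> ?T) = ?P \<star> (?Q \<star> (?R \<star> ?T))" by (rule c_assoc) (simp_all add: simps)
  also have "?Q \<star> (?R \<star> ?T) = ?Q \<star> ?R \<star> ?T" by (rule c_assoc[symmetric]) (simp_all add: simps)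
  also have "?P \<star> (?Q \<star> ?R \<star> ?T) = ?P \<star> ?T"
    unfolding QR by (subst c_id(1)) (simp_all add: simps)
  also note PT
  finally have PS: "(?P \<star> ?Q) \<star> ?S = Id (b + c + a)" by (simp only: c_hexagon)
  have "?P \<star> ?Q = (?P \<star> ?Q) \<star> Id (a + (b + c))" by (rule c_id(2)[symmetric]) (simp_all add: simps)
  also have "\<dots> = (?P \<star> ?Q) \<star> (?S \<star> ?X)" by (simp only: c_swap)
  also have "\<dots> = (?P \<star> ?Q) \<star> ?S \<star> ?X" by (rule c_assoc[symmetric]) (simp_all add: simps)
  also have "\<dots> = ?X" by (simp only: PS) (rule c_id, simp_all add: simps)
  finally show ?thesis by (rule sym)
qed

lemma G2_braided: "linear_braided_category (G2 d)"
proof (rule linear_braided_category.intro, rule G2_monoidal, rule linear_braided_category_axioms.intro,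
    unfold G2_simps)
  show "is_iso (G2 d) (a + b) (b + a) (Cl (DSwap a b))" for a b
    using swap_pair by (auto simp: is_iso_def)
next
  fix f a a' g b b' assume "f \<in> Mor (G2 d) a a'" "g \<in> Mor (G2 d) b b'"
  then show "Cl (DSwap a' b') \<star> (f \<diamondop> g) = (g \<diamondop> f) \<star> Cl (DSwap a b)"
    by (elim Mor_E') (simp add: comp_g2_class' tens_g2_class' g2_class_swap_natural add_ac)
next
  fix a b c
  show "Id (b + c + a) \<star> Cl (DSwap a (b + c)) \<star> Id (a + b + c) =
      (Id b \<diamondop> Cl (DSwap a c)) \<star> Id (b + a + c) \<star> (Cl (DSwap a b) \<diamondop> Id c)"
    by (simp add: c_id ok_simps c_hexagon'[symmetric] add_ac)
  show "inv_mor (G2 d) (c + a + b) (c + (a + b)) (Id (c + a + b)) \<star> Cl (DSwap (a + b) c) \<star>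
      inv_mor (G2 d) (a + b + c) (a + (b + c)) (Id (a + b + c)) =
      (Cl (DSwap a c) \<diamondop> Id b) \<star> inv_mor (G2 d) (a + c + b) (a + (c + b)) (Id (a + c + b)) \<star>
      (Id a \<diamondop> Cl (DSwap b c))"
    using c_hexagon[of a b c] by (simp add: c_id ok_simps inv_id add_ac)
qed

private lemma whisker: "g2_ok x \<Longrightarrow> g2_ok y \<Longrightarrow> g2_src x = g2_tgt y \<Longrightarrow>
    (Id a \<diamondop> (x \<diamondop> Id b)) \<star> (Id a \<diamondop> (y \<diamondop> Id b)) = Id a \<diamondop> ((x \<star> y) \<diamondop> Id b)"
  by (simp add: inter ok_simps c_id)

private lemma four:
  assumes "x = a1 \<star> a2" "y = b1 \<star> b2" "a2 \<star> b1 = m1 \<star> m2" "a1 \<star> m1 = Id n" "m2 \<star> b2 = Id n"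
    "g2_ok a1" "g2_ok a2" "g2_ok b1" "g2_ok b2" "g2_ok m1" "g2_ok m2" "g2_src a1 = g2_tgt a2" "g2_src a2 = g2_tgt b1" "g2_src b1 = g2_tgt b2"
    "g2_src a1 = g2_tgt m1" "g2_src m1 = g2_tgt m2" "g2_src m2 = g2_tgt b2"
  shows "x \<star> y = Id n"
proof -
  have "x \<star> y = a1 \<star> ((a2 \<star> b1) \<star> b2)" using assms(1,2,6-14) by (simp add: c_assoc ok_simps)
  also have "\<dots> = a1 \<star> m1 \<star> (m2 \<star> b2)" unfolding assms(3) using assms(6-) by (simp add: c_assoc ok_simps)
  also have "\<dots> = Id n" unfolding assms(4,5) by (simp add: c_id ok_simps)
  finally show ?thesis .
qed

lemma G2_dual:
  "\<exists>e k. g2_ok e \<and> g2_ok k \<and> g2_src e = n + n \<and> g2_tgt e = 0 \<and> g2_src k = 0 \<and> g2_tgt k = n + n \<and>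
     (Id n \<diamondop> e) \<star> (k \<diamondop> Id n) = Id n \<and> (e \<diamondop> Id n) \<star> (Id n \<diamondop> k) = Id n"
proof (induction n)
  case 0
  show ?case by (intro exI[of _ "Id 0"]) (simp add: ok_simps t_id_id c_id)
next
  case (Suc n)
  then obtain E K where E: "g2_ok E" "g2_src E = n + n" "g2_tgt E = 0" and K: "g2_ok K" "g2_src K = 0" "g2_tgt K = n + n"
    and z1: "(Id n \<diamondop> E) \<star> (K \<diamondop> Id n) = Id n" and z2: "(E \<diamondop> Id n) \<star> (Id n \<diamondop> K) = Id n" by blast
  let ?u = "Cl DCup" and ?p = "Cl DCap" and ?A = "Id n" and ?B = "Id 1"
  note ok = ok_simps E K
  let ?k = "(?A \<diamondop> ?u \<diamondop> ?A) \<star> K" and ?e = "?p \<star> (?B \<diamondop> E \<diamondop> ?B)"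
  have y1: "(?B \<diamondop> ?p) \<star> (?u \<diamondop> ?B) = ?B"
    by (simp add: comp_g2_class' tens_g2_class') (rule g2_class_eqI, rule g2_eq.zigzag_right[unfolded One_nat_def])
  have y2: "(?p \<diamondop> ?B) \<star> (?B \<diamondop> ?u) = ?B"
    by (simp add: comp_g2_class' tens_g2_class') (rule g2_class_eqI, rule g2_eq.zigzag_left[unfolded One_nat_def])
  have uE: "(Id 2 \<diamondop> E) \<star> (?u \<diamondop> Id (n + n)) = ?u \<star> E"
  proof -
    have "(Id 2 \<diamondop> E) \<star> (?u \<diamondop> Id (n + n)) = ?u \<diamondop> E" by (subst inter) (simp_all add: ok c_id)
    also have "\<dots> = (?u \<star> Id 0) \<diamondop> (Id 0 \<star> E)" by (simp add: ok c_id)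
    also have "\<dots> = (?u \<diamondop> Id 0) \<star> (Id 0 \<diamondop> E)" by (subst inter) (simp_all add: ok)
    finally show ?thesis by (simp add: ok t_id)
  qed
  have Eu: "(E \<diamondop> Id 2) \<star> (Id (n + n) \<diamondop> ?u) = ?u \<star> E"
  proof -
    have "(E \<diamondop> Id 2) \<star> (Id (n + n) \<diamondop> ?u) = E \<diamondop> ?u" by (subst inter) (simp_all add: ok c_id)
    also have "\<dots> = (Id 0 \<star> E) \<diamondop> (?u \<star> Id 0)" by (simp add: ok c_id)
    also have "\<dots> = (Id 0 \<diamondop> ?u) \<star> (E \<diamondop> Id 0)" by (subst inter) (simp_all add: ok)
    finally show ?thesis by (simp add: ok t_id)
  qed
  have IA: "Id (Suc n) = ?A \<diamondop> ?B" and IB: "Id (Suc n) = ?B \<diamondop> ?A"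
    and I2: "Id 2 = ?B \<diamondop> ?B" and Inn: "Id (n + n) = ?A \<diamondop> ?A" by (simp_all add: t_id_id numeral_2_eq_2)
  have "(Id (Suc n) \<diamondop> ?e) \<star> (?k \<diamondop> Id (Suc n)) = Id (Suc n)"
  proof (rule four)
    show "Id (Suc n) \<diamondop> ?e = (Id (Suc n) \<diamondop> ?p) \<star> (Id (Suc n) \<diamondop> (?B \<diamondop> E \<diamondop> ?B))"
      by (subst inter) (simp_all add: ok c_id)
    show "?k \<diamondop> Id (Suc n) = ((?A \<diamondop> ?u \<diamondop> ?A) \<diamondop> Id (Suc n)) \<star> (K \<diamondop> Id (Suc n))"
      by (subst inter) (simp_all add: ok c_id)
    have "Id (Suc n) \<diamondop> (?B \<diamondop> E \<diamondop> ?B) = ?A \<diamondop> (Id 2 \<diamondop> E \<diamondop> ?B)"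
      unfolding IA I2 by (simp add: ok t_assoc del: One_nat_def)
    moreover have "(?A \<diamondop> ?u \<diamondop> ?A) \<diamondop> Id (Suc n) = ?A \<diamondop> (?u \<diamondop> Id (n + n) \<diamondop> ?B)"
      unfolding IA Inn by (simp add: ok t_assoc del: One_nat_def)
    ultimately show "(Id (Suc n) \<diamondop> (?B \<diamondop> E \<diamondop> ?B)) \<star> ((?A \<diamondop> ?u \<diamondop> ?A) \<diamondop> Id (Suc n)) =
        (?A \<diamondop> (?u \<diamondop> ?B)) \<star> (?A \<diamondop> (E \<diamondop> ?B))"
      by (simp add: whisker ok uE)
    have "Id (Suc n) \<diamondop> ?p = ?A \<diamondop> (?B \<diamondop> ?p)"
      unfolding IA by (simp add: ok t_assoc del: One_nat_def)
    then have "(Id (Suc n) \<diamondop> ?p) \<star> (?A \<diamondop> (?u \<diamondop> ?B)) = ?A \<diamondop> ((?B \<diamondop> ?p) \<star> (?u \<diamondop> ?B))"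
      by (simp only:) (subst inter, simp_all add: ok c_id)
    then show "(Id (Suc n) \<diamondop> ?p) \<star> (?A \<diamondop> (?u \<diamondop> ?B)) = Id (Suc n)"
      by (simp only: y1 IA)
    have "(?A \<diamondop> (E \<diamondop> ?B)) \<star> (K \<diamondop> Id (Suc n)) = (?A \<diamondop> E \<diamondop> ?B) \<star> (K \<diamondop> ?A \<diamondop> ?B)"
      unfolding IA by (simp add: ok t_assoc del: One_nat_def)
    also have "\<dots> = ((?A \<diamondop> E) \<star> (K \<diamondop> ?A)) \<diamondop> ?B" by (subst inter) (simp_all add: ok c_id)
    finally show "(?A \<diamondop> (E \<diamondop> ?B)) \<star> (K \<diamondop> Id (Suc n)) = Id (Suc n)" by (simp only: z1 IA)
  qed (simp_all add: ok)
  moreover have "(?e \<diamondop> Id (Suc n)) \<star> (Id (Suc n) \<diamondop> ?k) = Id (Suc n)"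
  proof (rule four)
    show "?e \<diamondop> Id (Suc n) = (?p \<diamondop> Id (Suc n)) \<star> ((?B \<diamondop> E \<diamondop> ?B) \<diamondop> Id (Suc n))"
      by (subst inter) (simp_all add: ok c_id)
    show "Id (Suc n) \<diamondop> ?k = (Id (Suc n) \<diamondop> (?A \<diamondop> ?u \<diamondop> ?A)) \<star> (Id (Suc n) \<diamondop> K)"
      by (subst inter) (simp_all add: ok c_id)
    have "(?B \<diamondop> E \<diamondop> ?B) \<diamondop> Id (Suc n) = ?B \<diamondop> (E \<diamondop> Id 2 \<diamondop> ?A)"
      unfolding IB I2 by (simp add: ok t_assoc del: One_nat_def)
    moreover have "Id (Suc n) \<diamondop> (?A \<diamondop> ?u \<diamondop> ?A) = ?B \<diamondop> (Id (n + n) \<diamondop> ?u \<diamondop> ?A)"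
      unfolding IB Inn by (simp add: ok t_assoc del: One_nat_def)
    ultimately show "((?B \<diamondop> E \<diamondop> ?B) \<diamondop> Id (Suc n)) \<star> (Id (Suc n) \<diamondop> (?A \<diamondop> ?u \<diamondop> ?A)) =
        (?B \<diamondop> (?u \<diamondop> ?A)) \<star> (?B \<diamondop> (E \<diamondop> ?A))"
      by (simp add: whisker ok Eu)
    have "(?p \<diamondop> Id (Suc n)) \<star> (?B \<diamondop> (?u \<diamondop> ?A)) = (?p \<diamondop> ?B \<diamondop> ?A) \<star> (?B \<diamondop> ?u \<diamondop> ?A)"
      unfolding IB by (simp add: ok t_assoc del: One_nat_def)
    also have "\<dots> = ((?p \<diamondop> ?B) \<star> (?B \<diamondop> ?u)) \<diamondop> ?A" by (subst inter) (simp_all add: ok c_id)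
    finally show "(?p \<diamondop> Id (Suc n)) \<star> (?B \<diamondop> (?u \<diamondop> ?A)) = Id (Suc n)" by (simp only: y2 IB)
    have "Id (Suc n) \<diamondop> K = ?B \<diamondop> (?A \<diamondop> K)"
      unfolding IB by (simp add: ok t_assoc del: One_nat_def)
    then have "(?B \<diamondop> (E \<diamondop> ?A)) \<star> (Id (Suc n) \<diamondop> K) = ?B \<diamondop> ((E \<diamondop> ?A) \<star> (?A \<diamondop> K))"
      by (simp only:) (subst inter, simp_all add: ok c_id)
    then show "(?B \<diamondop> (E \<diamondop> ?A)) \<star> (Id (Suc n) \<diamondop> K) = Id (Suc n)" by (simp only: z2 IB)
  qed (simp_all add: ok)
  ultimately show ?case by (intro exI[of _ ?e] exI[of _ ?k]) (simp add: ok)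
qed

lemma G2_symmetric_ribbon: "symmetric_ribbon_category (G2 d)"
proof (rule symmetric_ribbon_category.intro)
  show "symmetric_ribbon_category_axioms (G2 d)"
    by (rule symmetric_ribbon_category_axioms.intro)
      (simp add: symmetric_braiding_def G2_simps c_swap)
  show "ribbon_category (G2 d)"
  proof (rule ribbon_category.intro, rule G2_braided, rule ribbon_category_axioms.intro, unfold G2_simps)
    show "is_iso (G2 d) a a (Id a)" for a by (rule id_iso)
    show "Id b \<star> f = f \<star> Id a" if "f \<in> Mor (G2 d) a b" for f a b
      using that by (simp add: Mor_ok c_id)
    show "Id (a + b) = Cl (DSwap b a) \<star> Cl (DSwap a b) \<star> (Id a \<diamondop> Id b)" for a b
      by (simp add: c_swap t_id_id c_id ok_simps)
    fix a
    obtain e k where "g2_ok e" "g2_ok k" "g2_src e = a + a" "g2_tgt e = 0" "g2_src k = 0" "g2_tgt k = a + a"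
      "(Id a \<diamondop> e) \<star> (k \<diamondop> Id a) = Id a" "(e \<diamondop> Id a) \<star> (Id a \<diamondop> k) = Id a"
      using G2_dual[of a] by blast
    then have "is_dual (G2 d) a a e k"
      by (simp add: is_dual_def G2_simps Mor_ok inv_id c_id ok_simps add.assoc)
    then show "\<exists>a' e k. is_dual (G2 d) a a' e k \<and> e \<star> (Id a' \<diamondop> Id a) = e \<star> (Id a' \<diamondop> Id a)"
      by blast
  qed
qed

end

end

theory Submission
  imports Defs
begin

text \<open>
  Put \<open>w = v^4\<close>, a primitive third root of unity. A quarter turn of \<open>X \<boxdot> X \<rightarrow> X \<boxdot> X\<close> exchanges the
  identity with \<open>U\<close>, \<open>I\<close> with \<open>H\<close> and \<open>\<sigma>\<close> with its inverse, and it fixes the square \<open>H \<cdot> H\<close>. Because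
  \<open>C(4)\<close> has dimension at most 5, these six diagrams satisfy a linear relation, which can be taken
  to be symmetric or antisymmetric under the quarter turn. Composing it with \<open>H\<close>, evaluating \<open>H \<cdot> \<sigma>\<close>
  and \<open>H \<cdot> \<sigma>\<^sup>-\<^sup>1\<close> by (QEJac) and subtracting the rotated relation cancels the square; after at most two
  such steps either the relation is \<open>\<sigma> = \<sigma>\<^sup>-\<^sup>1\<close> or the crossings have disappeared, and what is left
  forces \<open>\<sigma> = \<sigma>\<^sup>-\<^sup>1\<close>. Then (QEJac) and its
  inverse version combine to \<open>I + H = 2 s - 1 - U\<close>, up to a scalar that is absorbed into the self-duality
  by a cube root. The bigon and triangle values follow by composing (QEJac) with \<open>coev\<close> and \<open>\<delta>\<close>.
  The twist of \<open>X\<close> is a scalar \<open>z\<close> with \<open>z^2 = 1\<close>, by naturality on \<open>coev\<close>, and \<open>z^3 = 1\<close>, by naturality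
  on \<open>\<tau>\<close>. The functor interprets diagrams by recursion after the tensor product of morphisms between
  powers of \<open>X\<close> has been made strictly associative.
\<close>

text \<open>Since \<open>v^6 = 1\<close>, the crossing acts by 1 on \<open>coev\<close> and by -1 on
  \<open>split_mor\<close>, and after multiplication by \<open>v^3\<close> the relation (QEJac)
  depends on \<open>v\<close> only through \<open>w = v^4\<close> and
  \<open>\<beta> = v^3 * \<alpha>\<close>. This treats third and sixth roots at once. Rotational
  invariance of the vertex has to be derived before any quarter turn can be evaluated. It comes from
  the sign -1, from \<open>C(3)\<close> being a line and from the braid relation. No expression of
  \<open>H \<cdot> H\<close> in the six diagrams is available, so only its invariance under the
  quarter turn can be used; this is why relations are split into symmetric and antisymmetric ones.
  What survives is pinned down by the eigenvalues on \<open>coev\<close> and on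
  \<open>split_mor\<close>. Once both crossings equal \<open>s\<close>, the difference of (QEJac)
  and its inverse version reads \<open>\<beta> (1 + U - 2 s) + (w^2 - w) (I + H) = 0\<close>. Hence
  the normalization \<open>\<beta> = w^2 - w\<close>, and the cube root: \<open>I\<close> and
  \<open>H\<close> contain three copies of \<open>coev\<close> each.\<close>

section \<open>Coherence of the unit constraints\<close>

text \<open>The type of morphisms does not determine source and target, so arrows are triples of source,
  target and underlying morphism.\<close>

definition src_of :: "'o \<times> 'o \<times> 'm \<Rightarrow> 'o" where "src_of x = fst x"
definition tgt_of :: "'o \<times> 'o \<times> 'm \<Rightarrow> 'o" where "tgt_of x = fst (snd x)"
definition und :: "'o \<times> 'o \<times> 'm \<Rightarrow> 'm" where "und x = snd (snd x)"

lemma arrow_sel [simp]: "src_of (a, b, f) = a" "tgt_of (a, b, f) = b" "und (a, b, f) = f"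
  by (simp_all add: src_of_def tgt_of_def und_def)

lemma arrow_collapse [simp]: "(src_of x, tgt_of x, und x) = x"
  by (simp add: src_of_def tgt_of_def und_def)

lemma (in linear_category) is_iso_inv_mor:
  assumes "is_iso C a b f"
  shows "inverse_pair C a b f (inv_mor C a b f)"
  using assms inv_mor_eqI by (auto simp: is_iso_def)

section \<open>Arrows with explicit ends\<close>

context linear_monoidal_category
begin

definition arr :: "'o \<times> 'o \<times> 'm \<Rightarrow> bool" where
  "arr x \<longleftrightarrow> und x \<in> Mor C (src_of x) (tgt_of x)"

text \<open>Total on all triples: the ends of a composite are known without side conditions, so the
  simplifier can settle every typing condition by itself.\<close>

definition acomp (infixl "\<Zcomp>" 70) where "x \<Zcomp> y = (src_of y, tgt_of x, und x \<cdot> und y)"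

definition atens (infixl "\<Otimes>" 75) where
  "x \<Otimes> y = (src_of x \<boxdot> src_of y, tgt_of x \<boxdot> tgt_of y, und x \<boxtimes> und y)"

definition aid where "aid a = (a, a, ident C a)"
definition aassoc where "aassoc a b c = (a \<boxdot> b \<boxdot> c, a \<boxdot> (b \<boxdot> c), assoc C a b c)"
definition aassoc' where "aassoc' a b c = (a \<boxdot> (b \<boxdot> c), a \<boxdot> b \<boxdot> c, assoc_inv C a b c)"
definition alunit where "alunit a = (unit_ob C \<boxdot> a, a, lunit C a)"
definition alunit' where "alunit' a = (a, unit_ob C \<boxdot> a, lunit_inv C a)"
definition arunit where "arunit a = (a \<boxdot> unit_ob C, a, runit C a)"
definition arunit' where "arunit' a = (a, a \<boxdot> unit_ob C, runit_inv C a)"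

lemmas adefs = arr_def acomp_def atens_def aid_def aassoc_def aassoc'_def alunit_def alunit'_def
  arunit_def arunit'_def

lemma arrow_ends [simp]:
  "src_of (x \<Zcomp> y) = src_of y" "tgt_of (x \<Zcomp> y) = tgt_of x"
  "src_of (x \<Otimes> y) = src_of x \<boxdot> src_of y" "tgt_of (x \<Otimes> y) = tgt_of x \<boxdot> tgt_of y"
  "src_of (aid a) = a" "tgt_of (aid a) = a"
  "src_of (aassoc a b c) = a \<boxdot> b \<boxdot> c" "tgt_of (aassoc a b c) = a \<boxdot> (b \<boxdot> c)"
  "src_of (aassoc' a b c) = a \<boxdot> (b \<boxdot> c)" "tgt_of (aassoc' a b c) = a \<boxdot> b \<boxdot> c"
  "src_of (alunit a) = unit_ob C \<boxdot> a" "tgt_of (alunit a) = a"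
  "src_of (alunit' a) = a" "tgt_of (alunit' a) = unit_ob C \<boxdot> a"
  "src_of (arunit a) = a \<boxdot> unit_ob C" "tgt_of (arunit a) = a"
  "src_of (arunit' a) = a" "tgt_of (arunit' a) = a \<boxdot> unit_ob C"
  by (simp_all add: adefs)

lemmas iso_facts =
  is_iso_inv_mor[OF assoc_iso, unfolded inverse_pair_def]
  is_iso_inv_mor[OF lunit_iso, unfolded inverse_pair_def]
  is_iso_inv_mor[OF runit_iso, unfolded inverse_pair_def]

lemma arr_simps [simp]:
  "arr x \<Longrightarrow> arr y \<Longrightarrow> src_of x = tgt_of y \<Longrightarrow> arr (x \<Zcomp> y)"
  "arr x \<Longrightarrow> arr y \<Longrightarrow> arr (x \<Otimes> y)"
  "arr (aid a)" "arr (aassoc a b c)" "arr (aassoc' a b c)"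
  "arr (alunit a)" "arr (alunit' a)" "arr (arunit a)" "arr (arunit' a)"
  using iso_facts by (auto simp: adefs intro: comp_closed tensor_closed ident_closed)

lemma acomp_assoc [simp]:
  "arr x \<Longrightarrow> arr y \<Longrightarrow> arr z \<Longrightarrow> src_of x = tgt_of y \<Longrightarrow> src_of y = tgt_of z \<Longrightarrow>
    x \<Zcomp> y \<Zcomp> z = x \<Zcomp> (y \<Zcomp> z)"
  by (auto simp: adefs intro: comp_assoc)

lemma acomp_aid [simp]:
  "arr x \<Longrightarrow> tgt_of x = a \<Longrightarrow> aid a \<Zcomp> x = x" "arr x \<Longrightarrow> src_of x = a \<Longrightarrow> x \<Zcomp> aid a = x"
  by (auto simp: adefs ident_comp comp_ident)

lemma ainterchange:
  "arr x \<Longrightarrow> arr y \<Longrightarrow> arr z \<Longrightarrow> arr w \<Longrightarrow> src_of x = tgt_of y \<Longrightarrow> src_of z = tgt_of w \<Longrightarrow>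
    (x \<Otimes> z) \<Zcomp> (y \<Otimes> w) = (x \<Zcomp> y) \<Otimes> (z \<Zcomp> w)"
  by (auto simp: adefs intro!: interchange[symmetric])

lemma aid_atens [simp]: "aid a \<Otimes> aid b = aid (a \<boxdot> b)"
  by (simp add: adefs tensor_ident)

lemma whisker_right:
  "arr x \<Longrightarrow> arr y \<Longrightarrow> src_of x = tgt_of y \<Longrightarrow> (x \<Zcomp> y) \<Otimes> aid a = (x \<Otimes> aid a) \<Zcomp> (y \<Otimes> aid a)"
  by (simp add: ainterchange)

lemma whisker_left:
  "arr x \<Longrightarrow> arr y \<Longrightarrow> src_of x = tgt_of y \<Longrightarrow> aid a \<Otimes> (x \<Zcomp> y) = (aid a \<Otimes> x) \<Zcomp> (aid a \<Otimes> y)"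
  by (simp add: ainterchange)

lemma iso_cancel [simp]:
  "aassoc a b c \<Zcomp> aassoc' a b c = aid (a \<boxdot> (b \<boxdot> c))" "aassoc' a b c \<Zcomp> aassoc a b c = aid (a \<boxdot> b \<boxdot> c)"
  "alunit a \<Zcomp> alunit' a = aid a" "alunit' a \<Zcomp> alunit a = aid (unit_ob C \<boxdot> a)"
  "arunit a \<Zcomp> arunit' a = aid a" "arunit' a \<Zcomp> arunit a = aid (a \<boxdot> unit_ob C)"
  using iso_facts by (auto simp: adefs)

text \<open>Composites are normalized to nest to the right, so a mutually inverse pair usually
  occurs with a tail \<open>z\<close> behind it. Cancellation is therefore needed in this form as a
  rewrite rule.\<close>

lemma acancel:
  assumes "x \<Zcomp> y = aid a" "arr x" "arr y" "src_of x = tgt_of y" "arr z" "tgt_of z = src_of y"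
    "tgt_of x = a" "src_of y = a"
  shows "x \<Zcomp> (y \<Zcomp> z) = z"
  by (metis acomp_aid(1) acomp_assoc assms)

lemma iso_cancel2 [simp]:
  assumes "arr z"
  shows "tgt_of z = a \<boxdot> (b \<boxdot> c) \<Longrightarrow> aassoc a b c \<Zcomp> (aassoc' a b c \<Zcomp> z) = z"
    "tgt_of z = a \<boxdot> b \<boxdot> c \<Longrightarrow> aassoc' a b c \<Zcomp> (aassoc a b c \<Zcomp> z) = z"
    "tgt_of z = a \<Longrightarrow> alunit a \<Zcomp> (alunit' a \<Zcomp> z) = z"
    "tgt_of z = unit_ob C \<boxdot> a \<Longrightarrow> alunit' a \<Zcomp> (alunit a \<Zcomp> z) = z"
    "tgt_of z = a \<Longrightarrow> arunit a \<Zcomp> (arunit' a \<Zcomp> z) = z"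
    "tgt_of z = a \<boxdot> unit_ob C \<Longrightarrow> arunit' a \<Zcomp> (arunit a \<Zcomp> z) = z"
  using assms by (auto intro: acancel[OF iso_cancel(1)] acancel[OF iso_cancel(2)]
      acancel[OF iso_cancel(3)] acancel[OF iso_cancel(4)] acancel[OF iso_cancel(5)]
      acancel[OF iso_cancel(6)])

lemma aassoc_natural:
  "arr x \<Longrightarrow> arr y \<Longrightarrow> arr z \<Longrightarrow>
    aassoc (tgt_of x) (tgt_of y) (tgt_of z) \<Zcomp> (x \<Otimes> y \<Otimes> z) =
    (x \<Otimes> (y \<Otimes> z)) \<Zcomp> aassoc (src_of x) (src_of y) (src_of z)"
  by (simp add: adefs assoc_natural)

lemma alunit_natural: "arr x \<Longrightarrow> alunit (tgt_of x) \<Zcomp> (aid (unit_ob C) \<Otimes> x) = x \<Zcomp> alunit (src_of x)"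
  by (simp add: adefs lunit_natural)

lemma arunit_natural: "arr x \<Longrightarrow> arunit (tgt_of x) \<Zcomp> (x \<Otimes> aid (unit_ob C)) = x \<Zcomp> arunit (src_of x)"
  by (simp add: adefs runit_natural)

lemma apentagon:
  "aassoc a b (c \<boxdot> d) \<Zcomp> aassoc (a \<boxdot> b) c d =
   (aid a \<Otimes> aassoc b c d) \<Zcomp> (aassoc a (b \<boxdot> c) d \<Zcomp> (aassoc a b c \<Otimes> aid d))"
proof -
  have "aassoc a b (c \<boxdot> d) \<Zcomp> aassoc (a \<boxdot> b) c d =
      (aid a \<Otimes> aassoc b c d) \<Zcomp> aassoc a (b \<boxdot> c) d \<Zcomp> (aassoc a b c \<Otimes> aid d)"
    using pentagon[of a b c d] by (simp add: adefs)
  then show ?thesis by simp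
qed

lemma atriangle: "(aid a \<Otimes> alunit b) \<Zcomp> aassoc a (unit_ob C) b = arunit a \<Otimes> aid b"
  using triangle by (simp add: adefs)

lemma aassoc'_natural:
  assumes "arr x" "arr y" "arr z"
  shows "aassoc' (tgt_of x) (tgt_of y) (tgt_of z) \<Zcomp> (x \<Otimes> (y \<Otimes> z)) =
    (x \<Otimes> y \<Otimes> z) \<Zcomp> aassoc' (src_of x) (src_of y) (src_of z)" (is "?A' \<Zcomp> ?r = ?l \<Zcomp> ?B'")
proof -
  have "?A' \<Zcomp> ?r = ?A' \<Zcomp> (?r \<Zcomp> (aassoc (src_of x) (src_of y) (src_of z) \<Zcomp> ?B'))"
    using assms by simp
  also have "\<dots> = ?A' \<Zcomp> ((?r \<Zcomp> aassoc (src_of x) (src_of y) (src_of z)) \<Zcomp> ?B')"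
    using assms by (subst acomp_assoc) simp_all
  also have "\<dots> = ?l \<Zcomp> ?B'"
    using assms by (subst aassoc_natural[symmetric]) simp_all
  finally show ?thesis .
qed

lemma arr_eq_cancel_right:
  assumes "x \<Zcomp> z = y \<Zcomp> z" "z \<Zcomp> w = aid a" "arr x" "arr y" "arr z" "arr w"
    "src_of x = a" "src_of y = a" "tgt_of z = a" "src_of z = tgt_of w" "src_of w = a"
  shows "x = y"
  by (metis acomp_aid(2) acomp_assoc assms)

lemma arr_eq_cancel_left:
  assumes "z \<Zcomp> x = z \<Zcomp> y" "w \<Zcomp> z = aid a" "arr x" "arr y" "arr z" "arr w"
    "tgt_of x = a" "tgt_of y = a" "src_of z = a" "src_of w = tgt_of z" "tgt_of w = a"
  shows "x = y"
  by (metis acomp_aid(1) acomp_assoc assms)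

text \<open>The unit constraint conjugates \<open>x \<Otimes> aid (unit_ob C)\<close> into
  \<open>x\<close>. An equation may thus be checked after tensoring with the unit, where pentagon
  and triangle apply.\<close>

lemma tensor_unit_right_faithful:
  assumes "x \<Otimes> aid (unit_ob C) = y \<Otimes> aid (unit_ob C)" "arr x" "arr y"
    "src_of x = src_of y" "tgt_of x = tgt_of y"
  shows "x = y"
proof (rule arr_eq_cancel_right[where w = "arunit' (src_of x)"])
  show "x \<Zcomp> arunit (src_of x) = y \<Zcomp> arunit (src_of x)"
    using assms arunit_natural[of x] arunit_natural[of y] by simp
qed (use assms in auto)

lemma tensor_unit_left_faithful:
  assumes "aid (unit_ob C) \<Otimes> x = aid (unit_ob C) \<Otimes> y" "arr x" "arr y"
    "src_of x = src_of y" "tgt_of x = tgt_of y"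
  shows "x = y"
proof (rule arr_eq_cancel_right[where w = "alunit' (src_of x)"])
  show "x \<Zcomp> alunit (src_of x) = y \<Zcomp> alunit (src_of x)"
    using assms alunit_natural[of x] alunit_natural[of y] by simp
qed (use assms in auto)

text \<open>Kelly's argument: after tensoring with the unit on the right, the pentagon at
  \<open>a\<close>, \<open>b\<close>, unit, unit reduces the claim to two triangles, one for
  \<open>a \<boxdot> b\<close> and one for \<open>b\<close>.\<close>

lemma arunit_tensor: "(aid a \<Otimes> arunit b) \<Zcomp> aassoc a b (unit_ob C) = arunit (a \<boxdot> b)"
proof (rule tensor_unit_right_faithful, rule arr_eq_cancel_left[where w = "aassoc' a b (unit_ob C)"])
  let ?e = "unit_ob C"
  have "aassoc a b ?e \<Zcomp> (arunit (a \<boxdot> b) \<Otimes> aid ?e) =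
      aassoc a b ?e \<Zcomp> ((aid a \<Otimes> aid b \<Otimes> alunit ?e) \<Zcomp> aassoc (a \<boxdot> b) ?e ?e)"
    by (simp add: atriangle)
  also have "\<dots> = (aassoc a b ?e \<Zcomp> (aid a \<Otimes> aid b \<Otimes> alunit ?e)) \<Zcomp> aassoc (a \<boxdot> b) ?e ?e"
    by (subst acomp_assoc) simp_all
  also have "\<dots> = (aid a \<Otimes> (aid b \<Otimes> alunit ?e)) \<Zcomp> (aassoc a b (?e \<boxdot> ?e) \<Zcomp> aassoc (a \<boxdot> b) ?e ?e)"
    using aassoc_natural[of "aid a" "aid b" "alunit ?e"] by (simp del: aid_atens)
  also have "\<dots> = ((aid a \<Otimes> (aid b \<Otimes> alunit ?e)) \<Zcomp> (aid a \<Otimes> aassoc b ?e ?e)) \<Zcomp>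
      (aassoc a (b \<boxdot> ?e) ?e \<Zcomp> (aassoc a b ?e \<Otimes> aid ?e))"
    by (simp add: apentagon)
  also have "\<dots> = (aid a \<Otimes> (arunit b \<Otimes> aid ?e)) \<Zcomp> (aassoc a (b \<boxdot> ?e) ?e \<Zcomp> (aassoc a b ?e \<Otimes> aid ?e))"
    by (simp add: whisker_left[symmetric] atriangle)
  also have "\<dots> = ((aid a \<Otimes> (arunit b \<Otimes> aid ?e)) \<Zcomp> aassoc a (b \<boxdot> ?e) ?e) \<Zcomp> (aassoc a b ?e \<Otimes> aid ?e)"
    by (subst acomp_assoc) simp_all
  also have "\<dots> = (aassoc a b ?e \<Zcomp> (aid a \<Otimes> arunit b \<Otimes> aid ?e)) \<Zcomp> (aassoc a b ?e \<Otimes> aid ?e)"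
    using aassoc_natural[of "aid a" "arunit b" "aid ?e"] by (simp del: acomp_assoc)
  also have "\<dots> = aassoc a b ?e \<Zcomp> ((aid a \<Otimes> arunit b \<Otimes> aid ?e) \<Zcomp> (aassoc a b ?e \<Otimes> aid ?e))"
    by simp
  finally show "aassoc a b ?e \<Zcomp> (((aid a \<Otimes> arunit b) \<Zcomp> aassoc a b ?e) \<Otimes> aid ?e) =
      aassoc a b ?e \<Zcomp> (arunit (a \<boxdot> b) \<Otimes> aid ?e)"
    by (simp add: whisker_right)
qed auto

text \<open>The mirror argument, with the pentagon at unit, unit, \<open>a\<close>,
  \<open>b\<close>. Both sides are compared after composition with the invertible arrow
  \<open>?z\<close>.\<close>

lemma alunit_tensor: "alunit (a \<boxdot> b) \<Zcomp> aassoc (unit_ob C) a b = alunit a \<Otimes> aid b"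
proof (rule tensor_unit_left_faithful)
  let ?e = "unit_ob C"
  let ?z = "aassoc ?e (?e \<boxdot> a) b \<Zcomp> (aassoc ?e ?e a \<Otimes> aid b)"
  let ?w = "(aassoc' ?e ?e a \<Otimes> aid b) \<Zcomp> aassoc' ?e (?e \<boxdot> a) b"
  have "(aid ?e \<Otimes> (alunit (a \<boxdot> b) \<Zcomp> aassoc ?e a b)) \<Zcomp> ?z =
      (aid ?e \<Otimes> alunit (a \<boxdot> b)) \<Zcomp> (aassoc ?e ?e (a \<boxdot> b) \<Zcomp> aassoc (?e \<boxdot> ?e) a b)"
    by (simp add: whisker_left apentagon)
  also have "\<dots> = ((aid ?e \<Otimes> alunit (a \<boxdot> b)) \<Zcomp> aassoc ?e ?e (a \<boxdot> b)) \<Zcomp> aassoc (?e \<boxdot> ?e) a b"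
    by (subst acomp_assoc) simp_all
  also have "\<dots> = aassoc ?e a b \<Zcomp> (arunit ?e \<Otimes> aid a \<Otimes> aid b)"
    using aassoc_natural[of "arunit ?e" "aid a" "aid b"] by (simp add: atriangle)
  also have "\<dots> = (aassoc ?e a b \<Zcomp> (aid ?e \<Otimes> alunit a \<Otimes> aid b)) \<Zcomp> (aassoc ?e ?e a \<Otimes> aid b)"
    by (simp add: atriangle[symmetric] whisker_right)
  also have "\<dots> = (aid ?e \<Otimes> (alunit a \<Otimes> aid b)) \<Zcomp> ?z"
    using aassoc_natural[of "aid ?e" "alunit a" "aid b"] by simp
  finally have eq: "(aid ?e \<Otimes> (alunit (a \<boxdot> b) \<Zcomp> aassoc ?e a b)) \<Zcomp> ?z = (aid ?e \<Otimes> (alunit a \<Otimes> aid b)) \<Zcomp> ?z" .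
  have "(aassoc ?e ?e a \<Otimes> aid b) \<Zcomp> ((aassoc' ?e ?e a \<Otimes> aid b) \<Zcomp> aassoc' ?e (?e \<boxdot> a) b) = aassoc' ?e (?e \<boxdot> a) b"
    by (subst acomp_assoc[symmetric]) (simp_all add: whisker_right[symmetric])
  then have "?z \<Zcomp> ?w = aid (?e \<boxdot> (?e \<boxdot> a \<boxdot> b))" by simp
  with eq show "aid ?e \<Otimes> (alunit (a \<boxdot> b) \<Zcomp> aassoc ?e a b) = aid ?e \<Otimes> (alunit a \<Otimes> aid b)"
    by (rule arr_eq_cancel_right) auto
qed auto

text \<open>Naturality of the left unit constraint at itself gives
  \<open>alunit (e \<boxdot> e) = aid e \<Otimes> alunit e\<close> for the unit \<open>e\<close>;
  then \<open>alunit_tensor\<close> and the triangle have the same other side.\<close>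

lemma alunit_unit: "alunit (unit_ob C) = arunit (unit_ob C)"
proof (rule tensor_unit_right_faithful)
  let ?e = "unit_ob C"
  have "alunit (?e \<boxdot> ?e) = aid ?e \<Otimes> alunit ?e"
    by (rule arr_eq_cancel_left[of "alunit ?e" _ _ "alunit' ?e"]) (use alunit_natural[of "alunit ?e"] in auto)
  then show "alunit ?e \<Otimes> aid ?e = arunit ?e \<Otimes> aid ?e"
    using alunit_tensor[of ?e ?e] atriangle[of ?e ?e] by simp
qed auto

end

section \<open>Strictification on the powers of an object\<close>

text \<open>All diagram computations take place in this setting, where no associator occurs and
  objects are numbers. \<open>ok\<close> marks meaningful elements; the equations for the ends hold
  without it, so that side conditions become arithmetic.\<close>

locale strict_pro =
  fixes ok :: "'a \<Rightarrow> bool" and src tgt :: "'a \<Rightarrow> nat"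
    and cmp :: "'a \<Rightarrow> 'a \<Rightarrow> 'a"  (infixl "\<star>" 70)
    and tns :: "'a \<Rightarrow> 'a \<Rightarrow> 'a"  (infixl "\<diamondop>" 75)
    and idn :: "nat \<Rightarrow> 'a"
    and zer :: "nat \<Rightarrow> nat \<Rightarrow> 'a"
    and pls :: "'a \<Rightarrow> 'a \<Rightarrow> 'a"  (infixl "\<boxplus>" 65)
    and scl :: "complex \<Rightarrow> 'a \<Rightarrow> 'a"  (infixr "\<Odot>" 72)
  assumes ends [simp]:
      "src (x \<star> y) = src y" "tgt (x \<star> y) = tgt x"
      "src (x \<diamondop> y) = src x + src y" "tgt (x \<diamondop> y) = tgt x + tgt y"
      "src (idn a) = a" "tgt (idn a) = a" "src (zer a b) = a" "tgt (zer a b) = b"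
      "src (x \<boxplus> y) = src x" "tgt (x \<boxplus> y) = tgt x" "src (r \<Odot> x) = src x" "tgt (r \<Odot> x) = tgt x"
    and ok_simps [simp]:
      "\<lbrakk>ok x; ok y; src x = tgt y\<rbrakk> \<Longrightarrow> ok (x \<star> y)"
      "\<lbrakk>ok x; ok y\<rbrakk> \<Longrightarrow> ok (x \<diamondop> y)"
      "ok (idn a)" "ok (zer a b)"
      "\<lbrakk>ok x; ok y; src x = src y; tgt x = tgt y\<rbrakk> \<Longrightarrow> ok (x \<boxplus> y)"
      "ok x \<Longrightarrow> ok (r \<Odot> x)"
    and cmp_assoc [simp]:
      "\<lbrakk>ok x; ok y; ok z; src x = tgt y; src y = tgt z\<rbrakk> \<Longrightarrow> x \<star> y \<star> z = x \<star> (y \<star> z)"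
    and cmp_idn [simp]: "\<lbrakk>ok x; tgt x = a\<rbrakk> \<Longrightarrow> idn a \<star> x = x" "\<lbrakk>ok x; src x = a\<rbrakk> \<Longrightarrow> x \<star> idn a = x"
    and inter: "\<lbrakk>ok x; ok y; ok z; ok w; src x = tgt y; src z = tgt w\<rbrakk> \<Longrightarrow>
      (x \<diamondop> z) \<star> (y \<diamondop> w) = (x \<star> y) \<diamondop> (z \<star> w)"
    and tns_assoc: "\<lbrakk>ok x; ok y; ok z\<rbrakk> \<Longrightarrow> x \<diamondop> y \<diamondop> z = x \<diamondop> (y \<diamondop> z)"
    and tns_unit [simp]: "ok x \<Longrightarrow> idn 0 \<diamondop> x = x" "ok x \<Longrightarrow> x \<diamondop> idn 0 = x"
    and idn_idn [simp]: "idn a \<diamondop> idn b = idn (a + b)"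
    and pls_assoc: "\<lbrakk>ok x; ok y; ok z; src x = src y; tgt x = tgt y; src y = src z; tgt y = tgt z\<rbrakk>
      \<Longrightarrow> x \<boxplus> y \<boxplus> z = x \<boxplus> (y \<boxplus> z)"
    and pls_comm: "\<lbrakk>ok x; ok y; src x = src y; tgt x = tgt y\<rbrakk> \<Longrightarrow> x \<boxplus> y = y \<boxplus> x"
    and pls_zer [simp]: "\<lbrakk>ok x; src x = a; tgt x = b\<rbrakk> \<Longrightarrow> x \<boxplus> zer a b = x"
    and scl_zero [simp]: "ok x \<Longrightarrow> 0 \<Odot> x = zer (src x) (tgt x)"
    and scl_one [simp]: "ok x \<Longrightarrow> 1 \<Odot> x = x"
    and scl_scl [simp]: "ok x \<Longrightarrow> r \<Odot> s \<Odot> x = (r * s) \<Odot> x"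
    and scl_add: "ok x \<Longrightarrow> (r + s) \<Odot> x = r \<Odot> x \<boxplus> s \<Odot> x"
    and scl_pls: "\<lbrakk>ok x; ok y; src x = src y; tgt x = tgt y\<rbrakk> \<Longrightarrow> r \<Odot> (x \<boxplus> y) = r \<Odot> x \<boxplus> r \<Odot> y"
    and cmp_pls: "\<lbrakk>ok x; ok y; ok z; src x = src y; tgt x = tgt y; src x = tgt z\<rbrakk>
        \<Longrightarrow> (x \<boxplus> y) \<star> z = x \<star> z \<boxplus> y \<star> z"
      "\<lbrakk>ok x; ok y; ok z; src x = src y; tgt x = tgt y; tgt x = src z\<rbrakk>
        \<Longrightarrow> z \<star> (x \<boxplus> y) = z \<star> x \<boxplus> z \<star> y"
    and cmp_scl [simp]: "\<lbrakk>ok x; ok y; src x = tgt y\<rbrakk> \<Longrightarrow> (r \<Odot> x) \<star> y = r \<Odot> (x \<star> y)"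
      "\<lbrakk>ok x; ok y; src x = tgt y\<rbrakk> \<Longrightarrow> x \<star> (r \<Odot> y) = r \<Odot> (x \<star> y)"
    and tns_pls: "\<lbrakk>ok x; ok y; ok z; src x = src y; tgt x = tgt y\<rbrakk>
        \<Longrightarrow> (x \<boxplus> y) \<diamondop> z = x \<diamondop> z \<boxplus> y \<diamondop> z"
      "\<lbrakk>ok x; ok y; ok z; src x = src y; tgt x = tgt y\<rbrakk> \<Longrightarrow> z \<diamondop> (x \<boxplus> y) = z \<diamondop> x \<boxplus> z \<diamondop> y"
    and tns_scl [simp]: "\<lbrakk>ok x; ok y\<rbrakk> \<Longrightarrow> (r \<Odot> x) \<diamondop> y = r \<Odot> (x \<diamondop> y)"
      "\<lbrakk>ok x; ok y\<rbrakk> \<Longrightarrow> x \<diamondop> (r \<Odot> y) = r \<Odot> (x \<diamondop> y)"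

locale strict_braided_pro = strict_pro +
  fixes swp swp' :: "nat \<Rightarrow> nat \<Rightarrow> 'a"
  assumes swp_ends [simp]: "src (swp a b) = a + b" "tgt (swp a b) = b + a"
      "src (swp' a b) = b + a" "tgt (swp' a b) = a + b"
    and swp_ok [simp]: "ok (swp a b)" "ok (swp' a b)"
    and swp_inverse [simp]: "swp' a b \<star> swp a b = idn (a + b)" "swp a b \<star> swp' a b = idn (b + a)"
    and swp_natural: "\<lbrakk>ok x; ok y\<rbrakk> \<Longrightarrow>
      swp (tgt x) (tgt y) \<star> (x \<diamondop> y) = (y \<diamondop> x) \<star> swp (src x) (src y)"
    and hexagon_right: "swp a (b + c) = (idn b \<diamondop> swp a c) \<star> (swp a b \<diamondop> idn c)"
    and hexagon_left: "swp (a + b) c = (swp a c \<diamondop> idn b) \<star> (idn a \<diamondop> swp b c)"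

locale monoidal_object = linear_monoidal_category C for C :: "('o, 'm) cat_data" (structure) +
  fixes X :: 'o
begin

abbreviation P :: "nat \<Rightarrow> 'o" where "P \<equiv> tensor_pow C X"

text \<open>\<open>P 1\<close> is \<open>X\<close> and not \<open>unit_ob C \<boxdot> X\<close>, so
  appending one factor is an identity except at 0, where it is the left unit constraint.\<close>

definition step :: "nat \<Rightarrow> 'o \<times> 'o \<times> 'm" where
  "step n = (if n = 0 then alunit X else aid (P (Suc n)))"

definition step' :: "nat \<Rightarrow> 'o \<times> 'o \<times> 'm" where
  "step' n = (if n = 0 then alunit' X else aid (P (Suc n)))"

lemma P_Suc: "n \<noteq> 0 \<Longrightarrow> P (Suc n) = P n \<boxdot> X"
  by (cases n) simp_all

lemma step_simps [simp]:
  "arr (step n)" "arr (step' n)" "src_of (step n) = P n \<boxdot> X" "tgt_of (step n) = P (Suc n)"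
  "src_of (step' n) = P (Suc n)" "tgt_of (step' n) = P n \<boxdot> X"
  "step n \<Zcomp> step' n = aid (P (Suc n))" "step' n \<Zcomp> step n = aid (P n \<boxdot> X)"
  by (auto simp: step_def step'_def P_Suc)

text \<open>Transporting the tensor product along these coherence isomorphisms makes it strictly associative
  on the powers of \<open>X\<close>.\<close>

primrec join :: "nat \<Rightarrow> nat \<Rightarrow> 'o \<times> 'o \<times> 'm" where
  "join m 0 = arunit (P m)"
| "join m (Suc n) = step (m + n) \<Zcomp> ((join m n \<Otimes> aid X) \<Zcomp> (aassoc' (P m) (P n) X \<Zcomp> (aid (P m) \<Otimes> step' n)))"

primrec join' :: "nat \<Rightarrow> nat \<Rightarrow> 'o \<times> 'o \<times> 'm" where
  "join' m 0 = arunit' (P m)"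
| "join' m (Suc n) = (aid (P m) \<Otimes> step n) \<Zcomp> (aassoc (P m) (P n) X \<Zcomp> ((join' m n \<Otimes> aid X) \<Zcomp> step' (m + n)))"

lemma join_ends [simp]: "src_of (join m n) = P m \<boxdot> P n" "tgt_of (join m n) = P (m + n)"
  "src_of (join' m n) = P (m + n)" "tgt_of (join' m n) = P m \<boxdot> P n"
  by (cases n; simp)+

lemma join_arr [simp]: "arr (join m n)" "arr (join' m n)"
  by (induction n) simp_all

lemma step_cancel [simp]: "arr z \<Longrightarrow> tgt_of z = P (Suc n) \<Longrightarrow> step n \<Zcomp> (step' n \<Zcomp> z) = z"
  "arr z \<Longrightarrow> tgt_of z = P n \<boxdot> X \<Longrightarrow> step' n \<Zcomp> (step n \<Zcomp> z) = z"
  by (auto intro: acancel[OF step_simps(7)] acancel[OF step_simps(8)])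

lemma whisker_cancel:
  assumes "x \<Zcomp> y = aid a" "arr x" "arr y" "src_of x = tgt_of y" "tgt_of x = a" "src_of y = a" "arr z"
  shows "tgt_of z = a \<boxdot> b \<Longrightarrow> (x \<Otimes> aid b) \<Zcomp> ((y \<Otimes> aid b) \<Zcomp> z) = z"
    "tgt_of z = b \<boxdot> a \<Longrightarrow> (aid b \<Otimes> x) \<Zcomp> ((aid b \<Otimes> y) \<Zcomp> z) = z"
proof -
  have "(x \<Otimes> aid b) \<Zcomp> (y \<Otimes> aid b) = aid (a \<boxdot> b)" "(aid b \<Otimes> x) \<Zcomp> (aid b \<Otimes> y) = aid (b \<boxdot> a)"
    using assms by (simp_all add: ainterchange)
  then show "tgt_of z = a \<boxdot> b \<Longrightarrow> (x \<Otimes> aid b) \<Zcomp> ((y \<Otimes> aid b) \<Zcomp> z) = z"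
    "tgt_of z = b \<boxdot> a \<Longrightarrow> (aid b \<Otimes> x) \<Zcomp> ((aid b \<Otimes> y) \<Zcomp> z) = z"
    using assms by (simp_all add: acancel[of "x \<Otimes> aid b" "y \<Otimes> aid b"] acancel[of "aid b \<Otimes> x" "aid b \<Otimes> y"])
qed

lemma join_inverse [simp]: "join m n \<Zcomp> join' m n = aid (P (m + n))" "join' m n \<Zcomp> join m n = aid (P m \<boxdot> P n)"
  by (induction n) (simp_all add: whisker_cancel whisker_left[symmetric])

lemma join_cancel [simp]: "arr z \<Longrightarrow> tgt_of z = P (m + n) \<Longrightarrow> join m n \<Zcomp> (join' m n \<Zcomp> z) = z"
  "arr z \<Longrightarrow> tgt_of z = P m \<boxdot> P n \<Longrightarrow> join' m n \<Zcomp> (join m n \<Zcomp> z) = z"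
  by (auto intro: acancel[OF join_inverse(1)] acancel[OF join_inverse(2)])

text \<open>\<open>join\<close> recurses on its second argument, so this left unit law is a theorem,
  resting on \<open>alunit_tensor\<close> and, for \<open>n = 0\<close>, on
  \<open>alunit_unit\<close>. It makes \<open>idn 0\<close> a strict left unit.\<close>

lemma join_zero_left: "join 0 n = alunit (P n)"
proof (induction n)
  case 0
  show ?case by (simp add: alunit_unit)
next
  case (Suc n)
  have a: "(alunit (P n) \<Otimes> aid X) \<Zcomp> aassoc' (unit_ob C) (P n) X = alunit (P n \<boxdot> X)"
    by (simp add: alunit_tensor[symmetric])
  have "join 0 (Suc n) = step n \<Zcomp> (((alunit (P n) \<Otimes> aid X) \<Zcomp> aassoc' (unit_ob C) (P n) X) \<Zcomp> (aid (unit_ob C) \<Otimes> step' n))"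
    using Suc by simp
  also have "\<dots> = step n \<Zcomp> (alunit (tgt_of (step' n)) \<Zcomp> (aid (unit_ob C) \<Otimes> step' n))"
    unfolding a by simp
  also have "\<dots> = alunit (P (Suc n))"
    by (subst alunit_natural) simp_all
  finally show ?case .
qed

lemma join_one: "join m 1 = step m"
proof -
  have "aassoc' (P m) (unit_ob C) X \<Zcomp> (aid (P m) \<Otimes> alunit' X) = arunit' (P m) \<Otimes> aid X"
  proof (rule arr_eq_cancel_left)
    have "(arunit (P m) \<Otimes> aid X) \<Zcomp> (aassoc' (P m) (unit_ob C) X \<Zcomp> (aid (P m) \<Otimes> alunit' X)) = aid (P m \<boxdot> X)"
      by (simp add: atriangle[symmetric] ainterchange)
    moreover have "(arunit (P m) \<Otimes> aid X) \<Zcomp> (arunit' (P m) \<Otimes> aid X) = aid (P m \<boxdot> X)"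
      by (simp add: ainterchange)
    ultimately show "(arunit (P m) \<Otimes> aid X) \<Zcomp> (aassoc' (P m) (unit_ob C) X \<Zcomp> (aid (P m) \<Otimes> alunit' X)) =
        (arunit (P m) \<Otimes> aid X) \<Zcomp> (arunit' (P m) \<Otimes> aid X)"
      by simp
    show "(arunit' (P m) \<Otimes> aid X) \<Zcomp> (arunit (P m) \<Otimes> aid X) = aid (P m \<boxdot> unit_ob C \<boxdot> X)"
      by (simp add: ainterchange)
  qed simp_all
  then show ?thesis
    by (simp add: step'_def ainterchange)
qed

text \<open>The coherence fact behind strict associativity. Induction on \<open>c\<close> starts
  with \<open>arunit_tensor\<close>; the step moves one factor \<open>X\<close> through an instance
  of the pentagon.\<close>

lemma join_assoc:
  "join (a + b) c \<Zcomp> (join a b \<Otimes> aid (P c)) =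
   join a (b + c) \<Zcomp> ((aid (P a) \<Otimes> join b c) \<Zcomp> aassoc (P a) (P b) (P c))"
proof (induction c)
  case 0
  have "join (a + b) 0 \<Zcomp> (join a b \<Otimes> aid (P 0)) = join a b \<Zcomp> arunit (P a \<boxdot> P b)"
    using arunit_natural[of "join a b"] by simp
  then show ?case by (simp add: arunit_tensor)
next
  case (Suc c)
  let ?A = "P a" and ?B = "P b" and ?C = "P c"
  let ?J = "join (a + b) c" and ?K = "join a (b + c)"
  have 1: "aassoc' (P (a + b)) ?C X \<Zcomp> (join a b \<Otimes> aid (?C \<boxdot> X)) =
      (join a b \<Otimes> aid ?C \<Otimes> aid X) \<Zcomp> aassoc' (?A \<boxdot> ?B) ?C X"
    using aassoc'_natural[of "join a b" "aid ?C" "aid X"] by simp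
  have "join (a + b) (Suc c) \<Zcomp> (join a b \<Otimes> aid (P (Suc c))) =
      step (a + b + c) \<Zcomp> ((?J \<Otimes> aid X) \<Zcomp> (aassoc' (P (a + b)) ?C X \<Zcomp>
        ((aid (P (a + b)) \<Otimes> step' c) \<Zcomp> (join a b \<Otimes> aid (P (Suc c))))))"
    by simp
  also have "(aid (P (a + b)) \<Otimes> step' c) \<Zcomp> (join a b \<Otimes> aid (P (Suc c))) =
      (join a b \<Otimes> aid (?C \<boxdot> X)) \<Zcomp> (aid (?A \<boxdot> ?B) \<Otimes> step' c)"
    by (simp add: ainterchange del: tensor_pow.simps)
  also have "aassoc' (P (a + b)) ?C X \<Zcomp> ((join a b \<Otimes> aid (?C \<boxdot> X)) \<Zcomp> (aid (?A \<boxdot> ?B) \<Otimes> step' c)) =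
      (aassoc' (P (a + b)) ?C X \<Zcomp> (join a b \<Otimes> aid (?C \<boxdot> X))) \<Zcomp> (aid (?A \<boxdot> ?B) \<Otimes> step' c)"
    by simp
  also have "(?J \<Otimes> aid X) \<Zcomp> \<dots> =
      ((?J \<Zcomp> (join a b \<Otimes> aid ?C)) \<Otimes> aid X) \<Zcomp> (aassoc' (?A \<boxdot> ?B) ?C X \<Zcomp> (aid (?A \<boxdot> ?B) \<Otimes> step' c))"
    unfolding 1 by (simp add: whisker_right)
  also have "\<dots> = (?K \<Otimes> aid X) \<Zcomp> ((aid ?A \<Otimes> join b c \<Otimes> aid X) \<Zcomp>
      (((aassoc ?A ?B ?C \<Otimes> aid X) \<Zcomp> aassoc' (?A \<boxdot> ?B) ?C X) \<Zcomp> (aid (?A \<boxdot> ?B) \<Otimes> step' c)))"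
    unfolding Suc.IH by (simp add: whisker_right)
  \<comment> \<open>The pentagon with three of its associators moved to the other side as inverses;
    it is verified after composing with the associator that cancels the last factor.\<close>
  also have "(aassoc ?A ?B ?C \<Otimes> aid X) \<Zcomp> aassoc' (?A \<boxdot> ?B) ?C X =
      aassoc' ?A (?B \<boxdot> ?C) X \<Zcomp> ((aid ?A \<Otimes> aassoc' ?B ?C X) \<Zcomp> aassoc ?A ?B (?C \<boxdot> X))" (is "?l = ?r")
  proof (rule arr_eq_cancel_right)
    have "?r \<Zcomp> aassoc (?A \<boxdot> ?B) ?C X = aassoc' ?A (?B \<boxdot> ?C) X \<Zcomp>
        ((aid ?A \<Otimes> aassoc' ?B ?C X) \<Zcomp> ((aid ?A \<Otimes> aassoc ?B ?C X) \<Zcomp> (aassoc ?A (?B \<boxdot> ?C) X \<Zcomp> (aassoc ?A ?B ?C \<Otimes> aid X))))"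
      by (simp add: apentagon)
    also have "\<dots> = aassoc ?A ?B ?C \<Otimes> aid X"
      by (subst whisker_cancel(2)[where a = "?B \<boxdot> ?C \<boxdot> X"]) simp_all
    finally show "?l \<Zcomp> aassoc (?A \<boxdot> ?B) ?C X = ?r \<Zcomp> aassoc (?A \<boxdot> ?B) ?C X" by simp
    show "aassoc (?A \<boxdot> ?B) ?C X \<Zcomp> aassoc' (?A \<boxdot> ?B) ?C X = aid (?A \<boxdot> ?B \<boxdot> (?C \<boxdot> X))" by simp
  qed simp_all
  finally have lhs: "join (a + b) (Suc c) \<Zcomp> (join a b \<Otimes> aid (P (Suc c))) =
    step (a + b + c) \<Zcomp> ((?K \<Otimes> aid X) \<Zcomp> ((aid ?A \<Otimes> join b c \<Otimes> aid X) \<Zcomp>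
      ((aassoc' ?A (?B \<boxdot> ?C) X \<Zcomp> ((aid ?A \<Otimes> aassoc' ?B ?C X) \<Zcomp> aassoc ?A ?B (?C \<boxdot> X))) \<Zcomp> (aid (?A \<boxdot> ?B) \<Otimes> step' c))))" .
  have 2: "aassoc' ?A (P (b + c)) X \<Zcomp> (aid ?A \<Otimes> (join b c \<Otimes> aid X)) =
      (aid ?A \<Otimes> join b c \<Otimes> aid X) \<Zcomp> aassoc' ?A (?B \<boxdot> ?C) X"
    using aassoc'_natural[of "aid ?A" "join b c" "aid X"] by simp
  have 3: "(aid ?A \<Otimes> (aid ?B \<Otimes> step' c)) \<Zcomp> aassoc ?A ?B (P (Suc c)) =
      aassoc ?A ?B (?C \<boxdot> X) \<Zcomp> (aid (?A \<boxdot> ?B) \<Otimes> step' c)"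
    using aassoc_natural[of "aid ?A" "aid ?B" "step' c"] by simp
  have "join a (b + Suc c) \<Zcomp> ((aid ?A \<Otimes> join b (Suc c)) \<Zcomp> aassoc ?A ?B (P (Suc c))) =
      step (a + b + c) \<Zcomp> ((?K \<Otimes> aid X) \<Zcomp> (aassoc' ?A (P (b + c)) X \<Zcomp> ((aid ?A \<Otimes> step' (b + c)) \<Zcomp> ((aid ?A \<Otimes> step (b + c)) \<Zcomp>
       ((aid ?A \<Otimes> (join b c \<Otimes> aid X)) \<Zcomp> ((aid ?A \<Otimes> aassoc' ?B ?C X) \<Zcomp> ((aid ?A \<Otimes> (aid ?B \<Otimes> step' c)) \<Zcomp> aassoc ?A ?B (P (Suc c)))))))))"
    by (simp add: whisker_left add.assoc del: tensor_pow.simps)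
  also have "\<dots> = step (a + b + c) \<Zcomp> ((?K \<Otimes> aid X) \<Zcomp> ((aassoc' ?A (P (b + c)) X \<Zcomp> 
       (aid ?A \<Otimes> (join b c \<Otimes> aid X))) \<Zcomp> ((aid ?A \<Otimes> aassoc' ?B ?C X) \<Zcomp> ((aid ?A \<Otimes> (aid ?B \<Otimes> step' c)) \<Zcomp> aassoc ?A ?B (P (Suc c))))))"
    by (subst whisker_cancel(2)[where a = "P (b + c) \<boxdot> X"]) (simp_all del: tensor_pow.simps)
  finally show ?case
    unfolding lhs 2 3 by (simp add: add.assoc del: tensor_pow.simps)
qed

end

section \<open>Linear combinations of arrows\<close>

context linear_monoidal_category
begin

definition apls (infixl "\<uplus>" 65) where
  "x \<uplus> y = (src_of x, tgt_of x, und x \<oplus>\<^bsub>Hom C (src_of x) (tgt_of x)\<^esub> und y)"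
definition ascl (infixr "\<triangleright>" 72) where
  "r \<triangleright> x = (src_of x, tgt_of x, r \<odot>\<^bsub>Hom C (src_of x) (tgt_of x)\<^esub> und x)"
definition azer where "azer a b = (a, b, \<zero>\<^bsub>Hom C a b\<^esub>)"

lemmas alinear_defs = apls_def ascl_def azer_def

lemma alinear_ends [simp]:
  "src_of (x \<uplus> y) = src_of x" "tgt_of (x \<uplus> y) = tgt_of x"
  "src_of (r \<triangleright> x) = src_of x" "tgt_of (r \<triangleright> x) = tgt_of x"
  "src_of (azer a b) = a" "tgt_of (azer a b) = b"
  by (simp_all add: alinear_defs)

lemma Hom_module: "module class_ring (Hom C a b)"
  using Hom_vectorspace by (simp add: vectorspace_def)

lemma Hom_abelian_group: "abelian_group (Hom C a b)"
  using Hom_module by (rule module.axioms)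

lemma alinear_arr [simp]:
  "arr x \<Longrightarrow> arr y \<Longrightarrow> src_of x = src_of y \<Longrightarrow> tgt_of x = tgt_of y \<Longrightarrow> arr (x \<uplus> y)"
  "arr x \<Longrightarrow> arr (r \<triangleright> x)" "arr (azer a b)"
  using abelian_groupE[OF Hom_abelian_group] module.smult_closed[OF Hom_module]
  by (auto simp: alinear_defs arr_def class_ring_simps)

lemma apls_laws:
  assumes "arr x" "arr y" "src_of x = src_of y" "tgt_of x = tgt_of y"
  shows "x \<uplus> y = y \<uplus> x"
    "arr z \<Longrightarrow> src_of y = src_of z \<Longrightarrow> tgt_of y = tgt_of z \<Longrightarrow> x \<uplus> y \<uplus> z = x \<uplus> (y \<uplus> z)"
    "r \<triangleright> (x \<uplus> y) = r \<triangleright> x \<uplus> r \<triangleright> y"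
  using assms abelian_groupE(3,4)[OF Hom_abelian_group] module.smult_r_distr[OF Hom_module]
  by (auto simp: alinear_defs arr_def class_ring_simps)

lemma ascl_laws:
  assumes "arr x"
  shows "x \<uplus> azer (src_of x) (tgt_of x) = x" "0 \<triangleright> x = azer (src_of x) (tgt_of x)" "1 \<triangleright> x = x"
    "r \<triangleright> s \<triangleright> x = (r * s) \<triangleright> x" "(r + s) \<triangleright> x = r \<triangleright> x \<uplus> s \<triangleright> x"
proof -
  interpret M: Module.module "class_ring :: complex ring" "Hom C (src_of x) (tgt_of x)" by (rule Hom_module)
  have u: "und x \<in> Mor C (src_of x) (tgt_of x)" using assms by (simp add: arr_def)
  show "x \<uplus> azer (src_of x) (tgt_of x) = x" "1 \<triangleright> x = x"
    using u M.smult_one[OF u] by (simp_all add: alinear_defs class_ring_simps)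
  show "0 \<triangleright> x = azer (src_of x) (tgt_of x)"
    using M.smult_l_null[OF u] by (simp add: alinear_defs class_ring_simps)
  show "r \<triangleright> s \<triangleright> x = (r * s) \<triangleright> x" "(r + s) \<triangleright> x = r \<triangleright> x \<uplus> s \<triangleright> x"
    using M.smult_assoc1[of r s, OF _ _ u] M.smult_l_distr[of r s, OF _ _ u]
    by (simp_all add: alinear_defs class_ring_simps)
qed

lemma acomp_linear:
  assumes "arr x" "arr z"
  shows "arr y \<Longrightarrow> src_of x = src_of y \<Longrightarrow> tgt_of x = tgt_of y \<Longrightarrow> src_of x = tgt_of z \<Longrightarrow>
      (x \<uplus> y) \<Zcomp> z = x \<Zcomp> z \<uplus> y \<Zcomp> z"
    "arr y \<Longrightarrow> src_of x = src_of y \<Longrightarrow> tgt_of x = tgt_of y \<Longrightarrow> tgt_of x = src_of z \<Longrightarrow>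
      z \<Zcomp> (x \<uplus> y) = z \<Zcomp> x \<uplus> z \<Zcomp> y"
    "src_of x = tgt_of z \<Longrightarrow> (r \<triangleright> x) \<Zcomp> z = r \<triangleright> (x \<Zcomp> z)"
    "src_of z = tgt_of x \<Longrightarrow> z \<Zcomp> (r \<triangleright> x) = r \<triangleright> (z \<Zcomp> x)"
  using assms comp_linear_left comp_linear_right
  unfolding LinearCombinations.module_hom_def
  by (auto simp: alinear_defs acomp_def arr_def class_ring_simps)

lemma atens_linear:
  assumes "arr x" "arr z"
  shows "arr y \<Longrightarrow> src_of x = src_of y \<Longrightarrow> tgt_of x = tgt_of y \<Longrightarrow> (x \<uplus> y) \<Otimes> z = x \<Otimes> z \<uplus> y \<Otimes> z"
    "arr y \<Longrightarrow> src_of x = src_of y \<Longrightarrow> tgt_of x = tgt_of y \<Longrightarrow> z \<Otimes> (x \<uplus> y) = z \<Otimes> x \<uplus> z \<Otimes> y"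
    "(r \<triangleright> x) \<Otimes> z = r \<triangleright> (x \<Otimes> z)" "z \<Otimes> (r \<triangleright> x) = r \<triangleright> (z \<Otimes> x)"
  using assms tensor_linear_left tensor_linear_right
  unfolding LinearCombinations.module_hom_def
  by (auto simp: alinear_defs atens_def arr_def class_ring_simps)

end

section \<open>The braiding on arrows\<close>

context linear_braided_category
begin

definition abraid where "abraid a b = (a \<boxdot> b, b \<boxdot> a, braid C a b)"
definition abraid' where "abraid' a b = (b \<boxdot> a, a \<boxdot> b, braid_inv C a b)"

lemmas braid_facts = is_iso_inv_mor[OF braid_iso, unfolded inverse_pair_def]

lemma abraid_simps [simp]:
  "src_of (abraid a b) = a \<boxdot> b" "tgt_of (abraid a b) = b \<boxdot> a"
  "src_of (abraid' a b) = b \<boxdot> a" "tgt_of (abraid' a b) = a \<boxdot> b"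
  "arr (abraid a b)" "arr (abraid' a b)"
  "abraid a b \<Zcomp> abraid' a b = aid (b \<boxdot> a)" "abraid' a b \<Zcomp> abraid a b = aid (a \<boxdot> b)"
  using braid_facts by (auto simp: abraid_def abraid'_def adefs)

lemma abraid_natural:
  "arr x \<Longrightarrow> arr y \<Longrightarrow> abraid (tgt_of x) (tgt_of y) \<Zcomp> (x \<Otimes> y) = (y \<Otimes> x) \<Zcomp> abraid (src_of x) (src_of y)"
  by (simp add: adefs abraid_def braid_natural)

lemma ahexagon1:
  "aassoc b c a \<Zcomp> (abraid a (b \<boxdot> c) \<Zcomp> aassoc a b c) =
   (aid b \<Otimes> abraid a c) \<Zcomp> (aassoc b a c \<Zcomp> (abraid a b \<Otimes> aid c))"
proof -
  have "aassoc b c a \<Zcomp> abraid a (b \<boxdot> c) \<Zcomp> aassoc a b c =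
     (aid b \<Otimes> abraid a c) \<Zcomp> aassoc b a c \<Zcomp> (abraid a b \<Otimes> aid c)"
    using hexagon1[of b c a] by (simp add: adefs abraid_def)
  then show ?thesis by simp
qed

lemma ahexagon2:
  "aassoc' c a b \<Zcomp> (abraid (a \<boxdot> b) c \<Zcomp> aassoc' a b c) =
   (abraid a c \<Otimes> aid b) \<Zcomp> (aassoc' a c b \<Zcomp> (aid a \<Otimes> abraid b c))"
proof -
  have "aassoc' c a b \<Zcomp> abraid (a \<boxdot> b) c \<Zcomp> aassoc' a b c =
     (abraid a c \<Otimes> aid b) \<Zcomp> aassoc' a c b \<Zcomp> (aid a \<Otimes> abraid b c)"
    using hexagon2[of c a b] by (simp add: adefs abraid_def)
  then show ?thesis by simp
qed

end

section \<open>The strict monoidal category on the powers of \<open>X\<close>\<close>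

context monoidal_object
begin

text \<open>A triple \<open>(m, n, f)\<close> stands for a morphism \<open>f : P m \<rightarrow> P n\<close>.\<close>

definition lift :: "nat \<times> nat \<times> 'm \<Rightarrow> 'o \<times> 'o \<times> 'm" where
  "lift x = (P (src_of x), P (tgt_of x), und x)"

definition pok :: "nat \<times> nat \<times> 'm \<Rightarrow> bool" where "pok x \<longleftrightarrow> arr (lift x)"
definition pcmp where "pcmp x y = (src_of y, tgt_of x, und (lift x \<Zcomp> lift y))"
definition ptns where
  "ptns x y = (src_of x + src_of y, tgt_of x + tgt_of y,
     und (join (tgt_of x) (tgt_of y) \<Zcomp> ((lift x \<Otimes> lift y) \<Zcomp> join' (src_of x) (src_of y))))"
definition pidn where "pidn a = (a, a, und (aid (P a)))"
definition pzer where "pzer a b = (a, b, und (azer (P a) (P b)))"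
definition ppls where "ppls x y = (src_of x, tgt_of x, und (lift x \<uplus> lift y))"
definition pscl where "pscl r x = (src_of x, tgt_of x, und (r \<triangleright> lift x))"

text \<open>\<open>P\<close> need not be injective, so equality of lifts does not determine the
  numerical ends; they are compared separately.\<close>

lemma lift_eqI: "src_of x = src_of y \<Longrightarrow> tgt_of x = tgt_of y \<Longrightarrow> lift x = lift y \<Longrightarrow> x = y"
  by (cases x; cases y) (simp add: lift_def)

lemma und_collapse: "src_of x = a \<Longrightarrow> tgt_of x = b \<Longrightarrow> (a, b, und x) = x"
  by auto

lemma lift_simps [simp]:
  "src_of (lift x) = P (src_of x)" "tgt_of (lift x) = P (tgt_of x)" "und (lift x) = und x"
  "lift (pcmp x y) = lift x \<Zcomp> lift y"
  "lift (ptns x y) =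
     join (tgt_of x) (tgt_of y) \<Zcomp> ((lift x \<Otimes> lift y) \<Zcomp> join' (src_of x) (src_of y))"
  "lift (pidn a) = aid (P a)" "lift (pzer a b) = azer (P a) (P b)"
  "lift (ppls x y) = lift x \<uplus> lift y" "lift (pscl r x) = r \<triangleright> lift x"
  unfolding lift_def pcmp_def ptns_def pidn_def pzer_def ppls_def pscl_def
  by (simp_all add: und_collapse del: tensor_pow.simps)

lemma pro_ends [simp]:
  "src_of (pcmp x y) = src_of y" "tgt_of (pcmp x y) = tgt_of x"
  "src_of (ptns x y) = src_of x + src_of y" "tgt_of (ptns x y) = tgt_of x + tgt_of y"
  "src_of (pidn a) = a" "tgt_of (pidn a) = a" "src_of (pzer a b) = a" "tgt_of (pzer a b) = b"
  "src_of (ppls x y) = src_of x" "tgt_of (ppls x y) = tgt_of x"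
  "src_of (pscl r x) = src_of x" "tgt_of (pscl r x) = tgt_of x"
  by (simp_all add: pcmp_def ptns_def pidn_def pzer_def ppls_def pscl_def)

lemma join'_assoc:
  "(join' a b \<Otimes> aid (P c)) \<Zcomp> join' (a + b) c =
   aassoc' (P a) (P b) (P c) \<Zcomp> ((aid (P a) \<Otimes> join' b c) \<Zcomp> join' a (b + c))" (is "?l = ?r")
proof (rule arr_eq_cancel_left)
  let ?z = "join (a + b) c \<Zcomp> (join a b \<Otimes> aid (P c))"
  have l: "?z \<Zcomp> ?l = aid (P (a + b + c))" "?l \<Zcomp> ?z = aid (P a \<boxdot> P b \<boxdot> P c)"
    by (simp_all add: whisker_cancel ainterchange)
  have "?z \<Zcomp> ?r = aid (P (a + b + c))"
    unfolding join_assoc by (simp add: whisker_cancel add.assoc)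
  with l show "?z \<Zcomp> ?l = ?z \<Zcomp> ?r" "?l \<Zcomp> ?z = aid (P a \<boxdot> P b \<boxdot> P c)" by simp_all
qed (simp_all add: add.assoc)

text \<open>\<open>join_assoc\<close> above and \<open>join'_assoc\<close> below produce one
  associator and one inverse associator; naturality carries the first through the three arrows and
  they cancel.\<close>

lemma ptns_assoc:
  assumes [simp]: "pok x" "pok y" "pok z"
  shows "ptns (ptns x y) z = ptns x (ptns y z)"
proof (rule lift_eqI)
  have [simp]: "arr (lift x)" "arr (lift y)" "arr (lift z)" using assms by (simp_all add: pok_def)
  let ?x = "lift x" and ?y = "lift y" and ?z = "lift z"
  let ?a = "src_of x" and ?b = "src_of y" and ?c = "src_of z"
  let ?a' = "tgt_of x" and ?b' = "tgt_of y" and ?c' = "tgt_of z"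
  have 1: "(join ?a' ?b' \<Zcomp> ((?x \<Otimes> ?y) \<Zcomp> join' ?a ?b)) \<Otimes> ?z =
      (join ?a' ?b' \<Otimes> aid (P ?c')) \<Zcomp> ((?x \<Otimes> ?y \<Otimes> ?z) \<Zcomp> (join' ?a ?b \<Otimes> aid (P ?c)))"
    by (simp add: ainterchange)
  have 2: "?x \<Otimes> (join ?b' ?c' \<Zcomp> ((?y \<Otimes> ?z) \<Zcomp> join' ?b ?c)) =
      (aid (P ?a') \<Otimes> join ?b' ?c') \<Zcomp> ((?x \<Otimes> (?y \<Otimes> ?z)) \<Zcomp> (aid (P ?a) \<Otimes> join' ?b ?c))"
    by (simp add: ainterchange)
  have "lift (ptns (ptns x y) z) = (join (?a' + ?b') ?c' \<Zcomp> (join ?a' ?b' \<Otimes> aid (P ?c'))) \<Zcomp>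
      ((?x \<Otimes> ?y \<Otimes> ?z) \<Zcomp> ((join' ?a ?b \<Otimes> aid (P ?c)) \<Zcomp> join' (?a + ?b) ?c))"
    by (simp add: 1)
  also have "\<dots> = (join ?a' (?b' + ?c') \<Zcomp> (aid (P ?a') \<Otimes> join ?b' ?c')) \<Zcomp>
      ((aassoc (P ?a') (P ?b') (P ?c') \<Zcomp> (?x \<Otimes> ?y \<Otimes> ?z)) \<Zcomp> (aassoc' (P ?a) (P ?b) (P ?c) \<Zcomp>
        ((aid (P ?a) \<Otimes> join' ?b ?c) \<Zcomp> join' ?a (?b + ?c))))"
    unfolding join_assoc join'_assoc by (simp add: add.assoc)
  also have "aassoc (P ?a') (P ?b') (P ?c') \<Zcomp> (?x \<Otimes> ?y \<Otimes> ?z) =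
      (?x \<Otimes> (?y \<Otimes> ?z)) \<Zcomp> aassoc (P ?a) (P ?b) (P ?c)"
    using aassoc_natural[of ?x ?y ?z] by simp
  also have "(join ?a' (?b' + ?c') \<Zcomp> (aid (P ?a') \<Otimes> join ?b' ?c')) \<Zcomp>
      ((?x \<Otimes> (?y \<Otimes> ?z)) \<Zcomp> aassoc (P ?a) (P ?b) (P ?c) \<Zcomp> (aassoc' (P ?a) (P ?b) (P ?c) \<Zcomp>
        ((aid (P ?a) \<Otimes> join' ?b ?c) \<Zcomp> join' ?a (?b + ?c)))) = lift (ptns x (ptns y z))"
    by (simp add: 2)
  finally show "lift (ptns (ptns x y) z) = lift (ptns x (ptns y z))" .
qed (simp_all add: add.assoc)

sublocale strict_pro pok src_of tgt_of pcmp ptns pidn pzer ppls pscl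
proof
  fix x y assume [simp]: "pok x" "pok y" and e: "src_of x = tgt_of y"
  show "pok (pcmp x y)" using e \<open>pok x\<close> \<open>pok y\<close> by (simp add: pok_def del: tensor_pow.simps)
  fix z w assume "pok z" "pok w" "src_of z = tgt_of w"
  then show "pcmp (ptns x z) (ptns y w) = ptns (pcmp x y) (pcmp z w)"
    using e \<open>pok x\<close> \<open>pok y\<close>
    by (intro lift_eqI) (simp_all add: pok_def ainterchange[symmetric] del: tensor_pow.simps)
next
  fix x y z assume "pok x" "pok y" "pok z" "src_of x = tgt_of y" "src_of y = tgt_of z"
  then show "pcmp (pcmp x y) z = pcmp x (pcmp y z)"
    by (intro lift_eqI) (simp_all add: pok_def del: tensor_pow.simps)
next
  fix x a assume "pok x" "tgt_of x = a"
  then show "pcmp (pidn a) x = x" by (intro lift_eqI) (auto simp: pok_def simp del: tensor_pow.simps)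
next
  fix x a assume "pok x" "src_of x = a"
  then show "pcmp x (pidn a) = x" by (intro lift_eqI) (auto simp: pok_def simp del: tensor_pow.simps)
next
  fix x y z assume "pok x" "pok y" "pok z"
  then show "ptns (ptns x y) z = ptns x (ptns y z)" by (rule ptns_assoc)
next
  fix x assume x: "pok x"
  then have l: "arr (lift x)" by (simp add: pok_def)
  have "join 0 (tgt_of x) \<Zcomp> ((aid (unit_ob C) \<Otimes> lift x) \<Zcomp> join' 0 (src_of x)) =
      (alunit (P (tgt_of x)) \<Zcomp> (aid (unit_ob C) \<Otimes> lift x)) \<Zcomp> join' 0 (src_of x)"
    using l by (simp add: join_zero_left)
  also have "\<dots> = lift x \<Zcomp> (join 0 (src_of x) \<Zcomp> join' 0 (src_of x))"
    using l alunit_natural[OF l] by (simp add: join_zero_left)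
  also have "\<dots> = lift x" using l by (subst join_inverse) simp_all
  finally show "ptns (pidn 0) x = x" by (intro lift_eqI) simp_all
  have "arunit (P (tgt_of x)) \<Zcomp> ((lift x \<Otimes> aid (unit_ob C)) \<Zcomp> arunit' (P (src_of x))) =
      (arunit (P (tgt_of x)) \<Zcomp> (lift x \<Otimes> aid (unit_ob C))) \<Zcomp> arunit' (P (src_of x))"
    using l by simp
  also have "\<dots> = lift x" using l arunit_natural[OF l] by simp
  finally show "ptns x (pidn 0) = x" by (intro lift_eqI) simp_all
next
  fix x y z assume "pok x" "pok y" "pok z" "src_of x = src_of y" "tgt_of x = tgt_of y"
    "src_of y = src_of z" "tgt_of y = tgt_of z"
  then show "ppls (ppls x y) z = ppls x (ppls y z)"
    by (intro lift_eqI) (simp_all add: pok_def apls_laws(2))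
next
  fix x y assume "pok x" "pok y" "src_of x = src_of y" "tgt_of x = tgt_of y"
  then show "ppls x y = ppls y x" "pscl r (ppls x y) = ppls (pscl r x) (pscl r y)" for r
    by (intro lift_eqI; simp add: pok_def apls_laws)+
next
  fix x a b assume "pok x" "src_of x = a" "tgt_of x = b"
  then show "ppls x (pzer a b) = x" using ascl_laws(1)[of "lift x"] by (intro lift_eqI) (auto simp: pok_def)
next
  fix x assume "pok x"
  then have l: "arr (lift x)" by (simp add: pok_def)
  show "pscl 0 x = pzer (src_of x) (tgt_of x)" "pscl 1 x = x" "pscl r (pscl s x) = pscl (r * s) x"
    "pscl (r + s) x = ppls (pscl r x) (pscl s x)" for r s
    using ascl_laws(2-)[OF l] by (intro lift_eqI; simp)+
next
  fix x y z assume "pok x" "pok y" "pok z" "src_of x = src_of y" "tgt_of x = tgt_of y" "src_of x = tgt_of z"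
  then show "pcmp (ppls x y) z = ppls (pcmp x z) (pcmp y z)"
    by (intro lift_eqI) (simp_all add: pok_def acomp_linear)
next
  fix x y z assume "pok x" "pok y" "pok z" "src_of x = src_of y" "tgt_of x = tgt_of y" "tgt_of x = src_of z"
  then show "pcmp z (ppls x y) = ppls (pcmp z x) (pcmp z y)"
    by (intro lift_eqI) (simp_all add: pok_def acomp_linear)
next
  fix x y r assume "pok x" "pok y" "src_of x = tgt_of y"
  then show "pcmp (pscl r x) y = pscl r (pcmp x y)" "pcmp x (pscl r y) = pscl r (pcmp x y)"
    by (intro lift_eqI; simp add: pok_def acomp_linear)+
next
  fix x y z assume "pok x" "pok y" "pok z" "src_of x = src_of y" "tgt_of x = tgt_of y"
  then show "ptns (ppls x y) z = ppls (ptns x z) (ptns y z)"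
    "ptns z (ppls x y) = ppls (ptns z x) (ptns z y)"
    by (intro lift_eqI; simp add: pok_def acomp_linear atens_linear)+
next
  fix x y r assume "pok x" "pok y"
  then show "ptns (pscl r x) y = pscl r (ptns x y)" "ptns x (pscl r y) = pscl r (ptns x y)"
    by (intro lift_eqI; simp add: pok_def acomp_linear atens_linear)+
qed (auto simp: pok_def intro: lift_eqI)

end

section \<open>Transport of the braiding to the powers\<close>

locale braided_object = monoidal_object C X + linear_braided_category C
  for C :: "('o, 'm) cat_data" (structure) and X
begin

definition pswp where "pswp a b = (a + b, b + a, und (join b a \<Zcomp> (abraid (P a) (P b) \<Zcomp> join' a b)))"
definition pswp' where "pswp' a b = (b + a, a + b, und (join a b \<Zcomp> (abraid' (P a) (P b) \<Zcomp> join' b a)))"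

lemma pswp_simps [simp]:
  "src_of (pswp a b) = a + b" "tgt_of (pswp a b) = b + a"
  "src_of (pswp' a b) = b + a" "tgt_of (pswp' a b) = a + b"
  "lift (pswp a b) = join b a \<Zcomp> (abraid (P a) (P b) \<Zcomp> join' a b)"
  "lift (pswp' a b) = join a b \<Zcomp> (abraid' (P a) (P b) \<Zcomp> join' b a)"
  unfolding pswp_def pswp'_def by (simp_all add: lift_def und_collapse)

lemma abraid_cancel [simp]:
  "arr z \<Longrightarrow> tgt_of z = b \<boxdot> a \<Longrightarrow> abraid a b \<Zcomp> (abraid' a b \<Zcomp> z) = z"
  "arr z \<Longrightarrow> tgt_of z = a \<boxdot> b \<Longrightarrow> abraid' a b \<Zcomp> (abraid a b \<Zcomp> z) = z"
  by (simp_all add: acancel[OF abraid_simps(7)] acancel[OF abraid_simps(8)])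

text \<open>Rewriting nested joins by associativity gathers the associators around the two braidings
  into one side of \<open>ahexagon1\<close>. The remaining join passes through the braiding by
  naturality.\<close>

lemma pswp_hexagon_right: "pswp a (b + c) = pcmp (ptns (pidn b) (pswp a c)) (ptns (pswp a b) (pidn c))"
proof (rule lift_eqI)
  let ?A = "P a" and ?B = "P b" and ?C = "P c"
  have 1: "join b (c + a) \<Zcomp> (aid ?B \<Otimes> join c a) = join (b + c) a \<Zcomp> ((join b c \<Otimes> aid ?A) \<Zcomp> aassoc' ?B ?C ?A)"
    (is "?l = ?r")
  proof -
    have "?l = (join b (c + a) \<Zcomp> ((aid ?B \<Otimes> join c a) \<Zcomp> aassoc ?B ?C ?A)) \<Zcomp> aassoc' ?B ?C ?A" by simp
    then show ?thesis unfolding join_assoc[symmetric] by (simp add: add.assoc)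
  qed
  have 2: "join' b (a + c) \<Zcomp> (join (b + a) c \<Zcomp> (join b a \<Otimes> aid ?C)) = (aid ?B \<Otimes> join a c) \<Zcomp> aassoc ?B ?A ?C"
    unfolding join_assoc by (simp add: add.assoc)
  have "lift (pcmp (ptns (pidn b) (pswp a c)) (ptns (pswp a b) (pidn c))) =
      (join b (c + a) \<Zcomp> (aid ?B \<Otimes> join c a)) \<Zcomp> ((aid ?B \<Otimes> abraid ?A ?C) \<Zcomp> ((aid ?B \<Otimes> join' a c) \<Zcomp>
      ((join' b (a + c) \<Zcomp> (join (b + a) c \<Zcomp> (join b a \<Otimes> aid ?C))) \<Zcomp> ((abraid ?A ?B \<Otimes> aid ?C) \<Zcomp>
        ((join' a b \<Otimes> aid ?C) \<Zcomp> join' (a + b) c)))))"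
    by (simp add: whisker_left whisker_right add_ac)
  also have "\<dots> = join (b + c) a \<Zcomp> ((join b c \<Otimes> aid ?A) \<Zcomp> (aassoc' ?B ?C ?A \<Zcomp> 
      (((aid ?B \<Otimes> abraid ?A ?C) \<Zcomp> (aassoc ?B ?A ?C \<Zcomp> (abraid ?A ?B \<Otimes> aid ?C))) \<Zcomp>
        (aassoc' ?A ?B ?C \<Zcomp> ((aid ?A \<Otimes> join' b c) \<Zcomp> join' a (b + c))))))"
    unfolding 1 2 join'_assoc by (simp add: whisker_cancel add.assoc)
  also have "\<dots> = join (b + c) a \<Zcomp> (((join b c \<Otimes> aid ?A) \<Zcomp> abraid ?A (?B \<boxdot> ?C)) \<Zcomp> 
        ((aid ?A \<Otimes> join' b c) \<Zcomp> join' a (b + c)))"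
    unfolding ahexagon1[symmetric] by (simp add: add.assoc)
  also have "(join b c \<Otimes> aid ?A) \<Zcomp> abraid ?A (?B \<boxdot> ?C) = abraid ?A (P (b + c)) \<Zcomp> (aid ?A \<Otimes> join b c)"
    using abraid_natural[of "aid ?A" "join b c"] by simp
  finally show "lift (pswp a (b + c)) = lift (pcmp (ptns (pidn b) (pswp a c)) (ptns (pswp a b) (pidn c)))"
    by (simp add: whisker_cancel add.assoc)
qed (simp_all add: add_ac)

lemma pswp_hexagon_left: "pswp (a + b) c = pcmp (ptns (pswp a c) (pidn b)) (ptns (pidn a) (pswp b c))"
proof (rule lift_eqI)
  let ?A = "P a" and ?B = "P b" and ?C = "P c"
  have 2: "join' (a + c) b \<Zcomp> (join a (c + b) \<Zcomp> (aid ?A \<Otimes> join c b)) = (join a c \<Otimes> aid ?B) \<Zcomp> aassoc' ?A ?C ?B"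
    (is "?l = ?r")
  proof -
    have "?l = join' (a + c) b \<Zcomp> ((join a (c + b) \<Zcomp> ((aid ?A \<Otimes> join c b) \<Zcomp> aassoc ?A ?C ?B)) \<Zcomp> aassoc' ?A ?C ?B)"
      by (simp add: add.assoc)
    then show ?thesis unfolding join_assoc[symmetric] by (simp add: add.assoc)
  qed
  have 3: "(aid ?A \<Otimes> join' b c) \<Zcomp> join' a (b + c) = aassoc ?A ?B ?C \<Zcomp> ((join' a b \<Otimes> aid ?C) \<Zcomp> join' (a + b) c)"
    unfolding join'_assoc by (simp add: add.assoc)
  have "lift (pcmp (ptns (pswp a c) (pidn b)) (ptns (pidn a) (pswp b c))) =
      (join (c + a) b \<Zcomp> (join c a \<Otimes> aid ?B)) \<Zcomp> ((abraid ?A ?C \<Otimes> aid ?B) \<Zcomp> ((join' a c \<Otimes> aid ?B) \<Zcomp>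
      ((join' (a + c) b \<Zcomp> (join a (c + b) \<Zcomp> (aid ?A \<Otimes> join c b))) \<Zcomp> ((aid ?A \<Otimes> abraid ?B ?C) \<Zcomp>
        ((aid ?A \<Otimes> join' b c) \<Zcomp> join' a (b + c))))))"
    by (simp add: whisker_left whisker_right add_ac)
  also have "\<dots> = join c (a + b) \<Zcomp> ((aid ?C \<Otimes> join a b) \<Zcomp> (aassoc ?C ?A ?B \<Zcomp> 
      (((abraid ?A ?C \<Otimes> aid ?B) \<Zcomp> (aassoc' ?A ?C ?B \<Zcomp> (aid ?A \<Otimes> abraid ?B ?C))) \<Zcomp>
        (aassoc ?A ?B ?C \<Zcomp> ((join' a b \<Otimes> aid ?C) \<Zcomp> join' (a + b) c)))))"
    unfolding 2 3 join_assoc by (simp add: whisker_cancel add.assoc)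
  also have "\<dots> = join c (a + b) \<Zcomp> (((aid ?C \<Otimes> join a b) \<Zcomp> abraid (?A \<boxdot> ?B) ?C) \<Zcomp> 
        ((join' a b \<Otimes> aid ?C) \<Zcomp> join' (a + b) c))"
    unfolding ahexagon2[symmetric] by (simp add: add.assoc)
  also have "(aid ?C \<Otimes> join a b) \<Zcomp> abraid (?A \<boxdot> ?B) ?C = abraid (P (a + b)) ?C \<Zcomp> (join a b \<Otimes> aid ?C)"
    using abraid_natural[of "join a b" "aid ?C"] by simp
  finally show "lift (pswp (a + b) c) = lift (pcmp (ptns (pswp a c) (pidn b)) (ptns (pidn a) (pswp b c)))"
    by (simp add: whisker_cancel add.assoc)
qed (simp_all add: add_ac)

sublocale strict_braided_pro pok src_of tgt_of pcmp ptns pidn pzer ppls pscl pswp pswp'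
proof
  fix a b c
  show "pok (pswp a b)" "pok (pswp' a b)" by (simp_all add: pok_def add.commute)
  show "pcmp (pswp' a b) (pswp a b) = pidn (a + b)" "pcmp (pswp a b) (pswp' a b) = pidn (b + a)"
    by (intro lift_eqI; simp add: add.commute)+
  show "pswp a (b + c) = pcmp (ptns (pidn b) (pswp a c)) (ptns (pswp a b) (pidn c))"
    by (rule pswp_hexagon_right)
  show "pswp (a + b) c = pcmp (ptns (pswp a c) (pidn b)) (ptns (pidn a) (pswp b c))"
    by (rule pswp_hexagon_left)
next
  fix x y assume "pok x" "pok y"
  then have l: "arr (lift x)" "arr (lift y)" by (simp_all add: pok_def)
  have "lift (pcmp (pswp (tgt_of x) (tgt_of y)) (ptns x y)) =
      join (tgt_of y) (tgt_of x) \<Zcomp> ((abraid (P (tgt_of x)) (P (tgt_of y)) \<Zcomp> (lift x \<Otimes> lift y)) \<Zcomp> join' (src_of x) (src_of y))"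
    using l by simp
  also have "\<dots> = lift (pcmp (ptns y x) (pswp (src_of x) (src_of y)))"
    using l abraid_natural[OF l] by simp
  finally show "pcmp (pswp (tgt_of x) (tgt_of y)) (ptns x y) = pcmp (ptns y x) (pswp (src_of x) (src_of y))"
    by (intro lift_eqI) simp_all
qed simp_all

end

section \<open>Diagram calculus of a trivalent vertex\<close>

context strict_pro
begin

lemma whisk_l: "ok x \<Longrightarrow> ok y \<Longrightarrow> src x = tgt y \<Longrightarrow> idn a \<diamondop> (x \<star> y) = (idn a \<diamondop> x) \<star> (idn a \<diamondop> y)"
  by (simp add: inter)

lemma whisk_r: "ok x \<Longrightarrow> ok y \<Longrightarrow> src x = tgt y \<Longrightarrow> (x \<star> y) \<diamondop> idn a = (x \<diamondop> idn a) \<star> (y \<diamondop> idn a)"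
  by (simp add: inter)

lemma idn_tns [simp]: "ok x \<Longrightarrow> idn a \<diamondop> (idn b \<diamondop> x) = idn (a + b) \<diamondop> x"
  by (simp add: tns_assoc[symmetric])

lemma tns_idn [simp]: "ok x \<Longrightarrow> x \<diamondop> idn a \<diamondop> idn b = x \<diamondop> idn (a + b)"
  by (simp add: tns_assoc)

lemma slide:
  assumes "ok x" "ok y"
  shows "(x \<diamondop> idn (tgt y)) \<star> (idn (src x) \<diamondop> y) = x \<diamondop> y" "(idn (tgt x) \<diamondop> y) \<star> (x \<diamondop> idn (src y)) = x \<diamondop> y"
  using assms by (simp_all add: inter)

lemma cmp_reassoc:
  assumes "x \<star> y = z" "ok x" "ok y" "src x = tgt y" "ok w" "src y = tgt w"
  shows "x \<star> (y \<star> w) = z \<star> w"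
  using assms cmp_assoc by metis

lemma pls_left_comm: "\<lbrakk>ok x; ok y; ok z; src x = src y; tgt x = tgt y; src y = src z; tgt y = tgt z\<rbrakk>
    \<Longrightarrow> x \<boxplus> (y \<boxplus> z) = y \<boxplus> (x \<boxplus> z)"
  by (metis pls_assoc pls_comm)

lemmas pls_ac = pls_assoc pls_comm pls_left_comm

lemma zer_pls [simp]: "\<lbrakk>ok x; src x = a; tgt x = b\<rbrakk> \<Longrightarrow> zer a b \<boxplus> x = x"
  by (metis ends(7,8) ok_simps(4) pls_comm pls_zer)

lemma scl_zer [simp]: "r \<Odot> zer a b = zer a b"
proof -
  have "r \<Odot> zer a b = r \<Odot> 0 \<Odot> zer a b" by (subst scl_zero) simp_all
  also have "\<dots> = zer a b" by (subst scl_scl) simp_all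
  finally show ?thesis .
qed

lemma cmp_zer [simp]: "ok x \<Longrightarrow> src x = b \<Longrightarrow> x \<star> zer a b = zer a (tgt x)"
  "ok x \<Longrightarrow> tgt x = a \<Longrightarrow> zer a b \<star> x = zer (src x) b"
  using scl_zero[of "zer a b"] scl_zero[of "x \<star> zer a b"] scl_zero[of "zer a b \<star> x"]
  by (metis cmp_scl ends ok_simps(1,4) )+

lemma tns_zer [simp]: "ok x \<Longrightarrow> x \<diamondop> zer a b = zer (src x + a) (tgt x + b)"
  "ok x \<Longrightarrow> zer a b \<diamondop> x = zer (a + src x) (b + tgt x)"
  using scl_zero[of "zer a b"] scl_zero[of "x \<diamondop> zer a b"] scl_zero[of "zer a b \<diamondop> x"]
  by (metis tns_scl ends ok_simps(2,4))+

lemma scl_eq_zer_iff: "ok x \<Longrightarrow> src x = a \<Longrightarrow> tgt x = b \<Longrightarrow> r \<Odot> x = zer a b \<longleftrightarrow> r = 0 \<or> x = zer a b"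
proof -
  assume x: "ok x" "src x = a" "tgt x = b"
  show ?thesis
  proof
    assume "r \<Odot> x = zer a b"
    then have "inverse r \<Odot> r \<Odot> x = zer a b" by (metis scl_zer)
    then show "r = 0 \<or> x = zer a b" using x by (cases "r = 0") simp_all
  next
    assume "r = 0 \<or> x = zer a b"
    then show "r \<Odot> x = zer a b" using x scl_zer scl_zero by metis
  qed
qed

lemma eq_if_diff_zer:
  assumes "x \<boxplus> (- 1) \<Odot> y = zer a b" "ok x" "ok y" "src x = a" "src y = a" "tgt x = b" "tgt y = b"
  shows "x = y"
proof -
  have "(- 1) \<Odot> y \<boxplus> y = zer a b" using scl_add[of y "- 1" 1] assms by simp
  then have "x = x \<boxplus> ((- 1) \<Odot> y \<boxplus> y)" using assms by simp
  also have "\<dots> = (x \<boxplus> (- 1) \<Odot> y) \<boxplus> y" using assms by (subst pls_assoc) simp_all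
  finally show ?thesis using assms by simp
qed

lemma scl_inj: "r \<Odot> x = s \<Odot> x \<Longrightarrow> ok x \<Longrightarrow> x \<noteq> zer (src x) (tgt x) \<Longrightarrow> r = s"
proof -
  assume a: "r \<Odot> x = s \<Odot> x" "ok x" "x \<noteq> zer (src x) (tgt x)"
  have "(r - s) \<Odot> x = r \<Odot> x \<boxplus> (- s) \<Odot> x" using scl_add[of x r "- s"] a by simp
  also have "\<dots> = (s + - s) \<Odot> x" unfolding a(1) using a by (subst scl_add) simp_all
  finally show ?thesis using a scl_eq_zer_iff[of x "src x" "tgt x" "r - s"] by simp
qed

end

context strict_braided_pro
begin

text \<open>At zero the hexagon makes the crossing idempotent, and an invertible idempotent is the
  identity.\<close>

lemma swp_zero_right [simp]: "swp a 0 = idn a"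
proof -
  have "swp a 0 = swp a 0 \<star> swp a 0" using hexagon_right[of a 0 0] by simp
  then have "swp' a 0 \<star> swp a 0 = swp' a 0 \<star> (swp a 0 \<star> swp a 0)" by simp
  also have "\<dots> = (swp' a 0 \<star> swp a 0) \<star> swp a 0" by (subst cmp_assoc) simp_all
  finally show ?thesis by (simp del: cmp_assoc)
qed

lemma swp_zero_left [simp]: "swp 0 a = idn a"
proof -
  have "swp 0 a = swp 0 a \<star> swp 0 a" using hexagon_left[of 0 0 a] by simp
  then have "swp' 0 a \<star> swp 0 a = swp' 0 a \<star> (swp 0 a \<star> swp 0 a)" by simp
  also have "\<dots> = (swp' 0 a \<star> swp 0 a) \<star> swp 0 a" by (subst cmp_assoc) simp_all
  finally show ?thesis by (simp del: cmp_assoc)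
qed

end

text \<open>The variables \<open>cap\<close>, \<open>cup\<close> and \<open>vtx\<close> stand for \<open>ev\<close>, \<open>coev\<close> and \<open>\<tau>\<close>.\<close>

locale vertex_pro = strict_braided_pro +
  fixes cap cup vtx :: 'a
  assumes gen_ok [simp]: "ok cap" "ok cup" "ok vtx"
    and gen_ends [simp]: "src cap = 2" "tgt cap = 0" "src cup = 0" "tgt cup = 2" "src vtx = 3" "tgt vtx = 0"
    and zigzag: "(cap \<diamondop> idn 1) \<star> (idn 1 \<diamondop> cup) = idn 1" "(idn 1 \<diamondop> cap) \<star> (cup \<diamondop> idn 1) = idn 1"
begin

context
  notes numeral_2_eq_2 [simp] and numeral_3_eq_3 [simp]
begin

definition mrg where "mrg = (vtx \<diamondop> idn 1) \<star> (idn 2 \<diamondop> cup)"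
definition spl where "spl = (mrg \<diamondop> idn 1) \<star> (idn 1 \<diamondop> cup)"
definition "H = (idn 1 \<diamondop> mrg) \<star> (spl \<diamondop> idn 1)"
definition "I = spl \<star> mrg"
definition "U = cup \<star> cap"

lemma elem_simps [simp]:
  "ok mrg" "ok spl" "ok H" "ok I" "ok U" "src mrg = 2" "tgt mrg = 1" "src spl = 1" "tgt spl = 2"
  "src H = 2" "tgt H = 2" "src I = 2" "tgt I = 2" "src U = 2" "tgt U = 2"
  by (simp_all add: mrg_def spl_def H_def I_def U_def)

lemma cap_mrg_right: "cap \<star> (mrg \<diamondop> idn 1) = vtx"
proof -
  have "cap \<star> (mrg \<diamondop> idn 1) = cap \<star> ((vtx \<diamondop> idn 2) \<star> (idn 2 \<diamondop> (cup \<diamondop> idn 1)))"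
    by (simp add: mrg_def whisk_r tns_assoc)
  also have "\<dots> = (idn 0 \<diamondop> cap) \<star> (vtx \<diamondop> idn 2) \<star> (idn 2 \<diamondop> (cup \<diamondop> idn 1))"
    by simp
  also have "(idn 0 \<diamondop> cap) \<star> (vtx \<diamondop> idn 2) = vtx \<star> (idn 2 \<diamondop> (idn 1 \<diamondop> cap))"
    using slide[of vtx cap] by simp
  also have "\<dots> \<star> (idn 2 \<diamondop> (cup \<diamondop> idn 1)) = vtx \<star> (idn 2 \<diamondop> ((idn 1 \<diamondop> cap) \<star> (cup \<diamondop> idn 1)))"
    by (simp add: whisk_l)
  finally show ?thesis by (simp add: zigzag[unfolded One_nat_def])
qed

lemma mrg_eq_cap_spl: "(idn 1 \<diamondop> cap) \<star> (spl \<diamondop> idn 1) = mrg"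
proof -
  have "(idn 1 \<diamondop> cap) \<star> (spl \<diamondop> idn 1) = (idn 1 \<diamondop> cap) \<star> (mrg \<diamondop> idn 2) \<star> (idn 1 \<diamondop> (cup \<diamondop> idn 1))"
    by (simp add: spl_def whisk_r tns_assoc)
  also have "(idn 1 \<diamondop> cap) \<star> (mrg \<diamondop> idn 2) = mrg \<star> (idn 1 \<diamondop> (idn 1 \<diamondop> cap))"
    using slide[of mrg cap] by simp
  also have "\<dots> \<star> (idn 1 \<diamondop> (cup \<diamondop> idn 1)) = mrg \<star> (idn 1 \<diamondop> ((idn 1 \<diamondop> cap) \<star> (cup \<diamondop> idn 1)))"
    by (simp add: whisk_l)
  finally show ?thesis by (simp add: zigzag[unfolded One_nat_def])
qed

text \<open>The cap passes a strand by naturality, and the hexagon splits that strand's double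
  crossing into two. Cancelling one of them shows that a crossing turns into its inverse when it
  slides round a cap.\<close>

lemma cap_swp_right: "(cap \<diamondop> idn 1) \<star> (idn 1 \<diamondop> swp 1 1) = (idn 1 \<diamondop> cap) \<star> (swp' 1 1 \<diamondop> idn 1)"
proof -
  have "idn 1 \<diamondop> cap = (cap \<diamondop> idn 1) \<star> swp 1 2"
    using swp_natural[of "idn 1" cap] by simp
  also have "swp 1 2 = (idn 1 \<diamondop> swp 1 1) \<star> (swp 1 1 \<diamondop> idn 1)"
    using hexagon_right[of 1 1 1] by simp
  finally have "(idn 1 \<diamondop> cap) \<star> (swp' 1 1 \<diamondop> idn 1) =
      (cap \<diamondop> idn 1) \<star> ((idn 1 \<diamondop> swp 1 1) \<star> ((swp 1 1 \<diamondop> idn 1) \<star> (swp' 1 1 \<diamondop> idn 1)))"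
    by simp
  then show ?thesis by (simp add: inter)
qed

lemma cap_swp'_right: "(cap \<diamondop> idn 1) \<star> (idn 1 \<diamondop> swp' 1 1) = (idn 1 \<diamondop> cap) \<star> (swp 1 1 \<diamondop> idn 1)"
proof -
  have "cap \<diamondop> idn 1 = (idn 1 \<diamondop> cap) \<star> swp 2 1"
    using swp_natural[of cap "idn 1"] by simp
  also have "swp 2 1 = (swp 1 1 \<diamondop> idn 1) \<star> (idn 1 \<diamondop> swp 1 1)"
    using hexagon_left[of 1 1 1] by (simp add: numeral_2_eq_2)
  finally have "(cap \<diamondop> idn 1) \<star> (idn 1 \<diamondop> swp' 1 1) =
      (idn 1 \<diamondop> cap) \<star> ((swp 1 1 \<diamondop> idn 1) \<star> ((idn 1 \<diamondop> swp 1 1) \<star> (idn 1 \<diamondop> swp' 1 1)))"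
    by simp
  then show ?thesis by (simp add: inter)
qed

text \<open>The quarter turn: the first output of \<open>A\<close> is capped off with a new first
  input, and its second input is bent up to become the last output.\<close>

definition rot where "rot A = (cap \<diamondop> idn 2) \<star> ((idn 1 \<diamondop> A \<diamondop> idn 1) \<star> (idn 2 \<diamondop> cup))"

lemma cup_zigzag: "(idn 1 \<diamondop> cap \<diamondop> idn n) \<star> (cup \<diamondop> idn (Suc n)) = idn (Suc n)"
proof -
  have "(idn 1 \<diamondop> cap \<diamondop> idn n) \<star> (cup \<diamondop> idn (Suc n)) = ((idn 1 \<diamondop> cap) \<star> (cup \<diamondop> idn 1)) \<diamondop> idn n"
    by (simp add: whisk_r)
  then show ?thesis by (simp add: zigzag[unfolded One_nat_def])
qed

lemma rot_idn: "rot (idn 2) = U"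
  unfolding rot_def U_def using slide[of cap cup] by (simp add: inter)

lemma rot_U: "rot U = idn 2"
proof -
  have "rot U = (cap \<diamondop> idn 1 \<diamondop> idn 1) \<star> (((idn 1 \<diamondop> cup \<diamondop> idn 1) \<star> (idn 1 \<diamondop> cap \<diamondop> idn 1)) \<star> (idn 1 \<diamondop> (idn 1 \<diamondop> cup)))"
    unfolding rot_def U_def by (simp add: whisk_l whisk_r tns_assoc)
  also have "\<dots> = (((cap \<diamondop> idn 1) \<star> (idn 1 \<diamondop> cup)) \<diamondop> idn 1) \<star> (idn 1 \<diamondop> ((cap \<diamondop> idn 1) \<star> (idn 1 \<diamondop> cup)))"
    by (simp add: whisk_l whisk_r tns_assoc)
  finally show ?thesis by (simp add: zigzag[unfolded One_nat_def])
qed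

lemma rot_swp': "rot (swp' 1 1) = swp 1 1"
proof -
  have "rot (swp' 1 1) = (((cap \<diamondop> idn 1) \<star> (idn 1 \<diamondop> swp' 1 1)) \<diamondop> idn 1) \<star> (idn 2 \<diamondop> cup)"
    unfolding rot_def by (simp add: whisk_r tns_assoc)
  also have "\<dots> = (idn 1 \<diamondop> cap \<diamondop> idn 1) \<star> ((swp 1 1 \<diamondop> idn 2) \<star> (idn 2 \<diamondop> cup))"
    unfolding cap_swp'_right by (simp add: whisk_r tns_assoc)
  also have "(swp 1 1 \<diamondop> idn 2) \<star> (idn 2 \<diamondop> cup) = (idn 1 \<diamondop> (idn 1 \<diamondop> cup)) \<star> swp 1 1"
    using slide[of "swp 1 1" cup] by simp
  also have "(idn 1 \<diamondop> cap \<diamondop> idn 1) \<star> \<dots> = (idn 1 \<diamondop> ((cap \<diamondop> idn 1) \<star> (idn 1 \<diamondop> cup))) \<star> swp 1 1"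
    by (simp add: whisk_l tns_assoc)
  finally show ?thesis by (simp add: zigzag[unfolded One_nat_def])
qed

lemma rot_swp: "rot (swp 1 1) = swp' 1 1"
proof -
  have "rot (swp 1 1) = (((cap \<diamondop> idn 1) \<star> (idn 1 \<diamondop> swp 1 1)) \<diamondop> idn 1) \<star> (idn 2 \<diamondop> cup)"
    unfolding rot_def by (simp add: whisk_r tns_assoc)
  also have "\<dots> = (idn 1 \<diamondop> cap \<diamondop> idn 1) \<star> ((swp' 1 1 \<diamondop> idn 2) \<star> (idn 2 \<diamondop> cup))"
    unfolding cap_swp_right by (simp add: whisk_r tns_assoc)
  also have "(swp' 1 1 \<diamondop> idn 2) \<star> (idn 2 \<diamondop> cup) = (idn 1 \<diamondop> (idn 1 \<diamondop> cup)) \<star> swp' 1 1"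
    using slide[of "swp' 1 1" cup] by simp
  also have "(idn 1 \<diamondop> cap \<diamondop> idn 1) \<star> \<dots> = (idn 1 \<diamondop> ((cap \<diamondop> idn 1) \<star> (idn 1 \<diamondop> cup))) \<star> swp' 1 1"
    by (simp add: whisk_l tns_assoc)
  finally show ?thesis by (simp add: zigzag[unfolded One_nat_def])
qed

lemma rot_linear:
  "ok A \<Longrightarrow> src A = 2 \<Longrightarrow> tgt A = 2 \<Longrightarrow> rot (r \<Odot> A) = r \<Odot> rot A"
  "ok A \<Longrightarrow> src A = 2 \<Longrightarrow> tgt A = 2 \<Longrightarrow> ok B \<Longrightarrow> src B = 2 \<Longrightarrow> tgt B = 2 \<Longrightarrow> rot (A \<boxplus> B) = rot A \<boxplus> rot B"
  "rot (zer 2 2) = zer 2 2"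
  by (simp_all add: rot_def tns_pls cmp_pls)

lemma rot_ends [simp]: "src (rot A) = 2" "tgt (rot A) = 2"
  by (simp_all add: rot_def)

text \<open>By naturality the bent leg can be pulled across the vertex. This leaves a crossing of
  one leg past two, and a kink in the bent strand that \<open>loop\<close> removes.\<close>

lemma rotated_vertex:
  assumes loop: "swp' 1 1 \<star> cup = cup"
  shows "cap \<star> ((idn 1 \<diamondop> vtx \<diamondop> idn 1) \<star> (idn 3 \<diamondop> cup)) = vtx \<star> swp 1 2"
proof -
  have "idn 1 \<diamondop> vtx = (vtx \<diamondop> idn 1) \<star> swp 1 3"
    using swp_natural[of "idn 1" vtx] by simp
  also have "swp 1 3 = (idn 2 \<diamondop> swp 1 1) \<star> (swp 1 2 \<diamondop> idn 1)"
    using hexagon_right[of 1 2 1] by simp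
  finally have "cap \<star> ((idn 1 \<diamondop> vtx \<diamondop> idn 1) \<star> (idn 3 \<diamondop> cup)) =
      (idn 0 \<diamondop> cap) \<star> (vtx \<diamondop> idn 2) \<star> ((idn 2 \<diamondop> (swp 1 1 \<diamondop> idn 1)) \<star> ((swp 1 2 \<diamondop> idn 2) \<star> (idn 3 \<diamondop> cup)))"
    by (simp add: whisk_r tns_assoc)
  also have "(idn 0 \<diamondop> cap) \<star> (vtx \<diamondop> idn 2) = vtx \<star> (idn 2 \<diamondop> (idn 1 \<diamondop> cap))"
    using slide[of vtx cap] by simp
  also have "(swp 1 2 \<diamondop> idn 2) \<star> (idn 3 \<diamondop> cup) = (idn 2 \<diamondop> (idn 1 \<diamondop> cup)) \<star> swp 1 2"
    using slide[of "swp 1 2" cup] by simp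
  also have "vtx \<star> (idn 2 \<diamondop> (idn 1 \<diamondop> cap)) \<star> ((idn 2 \<diamondop> (swp 1 1 \<diamondop> idn 1)) \<star> ((idn 2 \<diamondop> (idn 1 \<diamondop> cup)) \<star> swp 1 2)) =
      vtx \<star> ((idn 2 \<diamondop> ((idn 1 \<diamondop> cap) \<star> (swp 1 1 \<diamondop> idn 1) \<star> (idn 1 \<diamondop> cup))) \<star> swp 1 2)"
    by (simp add: whisk_l)
  also have "(idn 1 \<diamondop> cap) \<star> (swp 1 1 \<diamondop> idn 1) \<star> (idn 1 \<diamondop> cup) = (cap \<diamondop> idn 1) \<star> (idn 1 \<diamondop> (swp' 1 1 \<star> cup))"
    unfolding cap_swp'_right[symmetric] by (simp add: whisk_l)
  finally show ?thesis unfolding loop by (simp add: zigzag[unfolded One_nat_def])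
qed

end

end

section \<open>Bending outputs into inputs\<close>

context vertex_pro
begin

context
  notes numeral_2_eq_2 [simp] and numeral_3_eq_3 [simp]
begin

text \<open>Turns the last output into a last input. Applied twice it carries endomorphisms of two
  strands into \<open>C(4)\<close>, where the dimension bound is available; \<open>unbend\<close>
  recovers the original.\<close>

definition bend where "bend n x = (idn n \<diamondop> cap) \<star> (x \<diamondop> idn 1)"

lemma bend_simps [simp]: "ok x \<Longrightarrow> tgt x = Suc n \<Longrightarrow> ok (bend n x)" "src (bend n x) = Suc (src x)"
  "tgt (bend n x) = n"
  by (simp_all add: bend_def)

lemma bend_linear:
  "ok x \<Longrightarrow> tgt x = Suc n \<Longrightarrow> bend n (r \<Odot> x) = r \<Odot> bend n x"
  "ok x \<Longrightarrow> tgt x = Suc n \<Longrightarrow> ok y \<Longrightarrow> src x = src y \<Longrightarrow> tgt y = Suc n \<Longrightarrow>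
    bend n (x \<boxplus> y) = bend n x \<boxplus> bend n y"
  "bend n (zer a (Suc n)) = zer (Suc a) n"
  by (simp_all add: bend_def tns_pls cmp_pls)

lemma unbend:
  assumes "ok x" "tgt x = Suc n"
  shows "(bend n x \<diamondop> idn 1) \<star> (idn (src x) \<diamondop> cup) = x"
proof -
  have "(bend n x \<diamondop> idn 1) \<star> (idn (src x) \<diamondop> cup) = (idn n \<diamondop> cap \<diamondop> idn 1) \<star> ((x \<diamondop> idn 2) \<star> (idn (src x) \<diamondop> cup))"
    using assms by (simp add: bend_def whisk_r)
  also have "(x \<diamondop> idn 2) \<star> (idn (src x) \<diamondop> cup) = (idn n \<diamondop> (idn 1 \<diamondop> cup)) \<star> x"
    using assms slide[of x cup] by simp
  also have "(idn n \<diamondop> cap \<diamondop> idn 1) \<star> \<dots> = (idn n \<diamondop> ((cap \<diamondop> idn 1) \<star> (idn 1 \<diamondop> cup))) \<star> x"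
    using assms by (simp add: whisk_l tns_assoc)
  finally show ?thesis using assms by (simp add: zigzag[unfolded One_nat_def])
qed

lemma bend_inj: "bend n x = bend n y \<Longrightarrow> ok x \<Longrightarrow> ok y \<Longrightarrow> src x = src y \<Longrightarrow> tgt x = Suc n \<Longrightarrow> tgt y = Suc n \<Longrightarrow> x = y"
  using unbend[of x n] unbend[of y n] by simp

end

end

text \<open>For \<open>w = v^4\<close> and \<open>\<beta> = v^3 \<alpha>\<close>, where \<open>v^6 = 1\<close>, the last assumption is (QEJac-\<open>\<alpha>\<close>) multiplied by
  \<open>v^3\<close>.\<close>

locale qe_pro = vertex_pro +
  fixes d b t w \<beta> :: complex
  assumes idn_0: "idn 0 \<noteq> zer 0 0"
    and d: "d \<noteq> 0" and cap_cup: "cap \<star> cup = d \<Odot> idn 0"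
    and b: "b \<noteq> 0" and bigon: "mrg \<star> spl = b \<Odot> idn 1"
    and lollipop: "mrg \<star> cup = zer 0 1"
    and triangle: "H \<star> spl = t \<Odot> spl"
    and swp'_spl: "swp' 1 1 \<star> spl = (- 1) \<Odot> spl"
    and swp'_cup: "swp' 1 1 \<star> cup = cup"
    and dim2: "\<lbrakk>ok x; src x = 2; tgt x = 0\<rbrakk> \<Longrightarrow> \<exists>r. x = r \<Odot> cap"
    and dim3: "\<lbrakk>ok x; src x = 3; tgt x = 0\<rbrakk> \<Longrightarrow> \<exists>r. x = r \<Odot> vtx"
    and w: "(w * w) + w + 1 = 0"
    and qe: "H \<star> swp' 1 1 \<boxplus> (w \<Odot> I \<boxplus> ((- (w * w)) \<Odot> H \<boxplus>
        \<beta> \<Odot> (swp' 1 1 \<boxplus> (w \<Odot> U \<boxplus> (w * w) \<Odot> idn 2)))) = zer 2 2"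
begin

context
  notes numeral_2_eq_2 [simp] and numeral_3_eq_3 [simp]
begin

section \<open>Behaviour of the generators under crossings\<close>

lemma idn_1: "idn 1 \<noteq> zer 1 1"
proof
  assume z: "idn 1 = zer 1 1"
  have "cap = cap \<star> (idn 1 \<diamondop> idn 1)" by simp
  also have "\<dots> = zer 2 0" unfolding z by simp
  finally have "d \<Odot> idn 0 = zer 0 0" using cap_cup by simp
  then show False using d idn_0 by (simp add: scl_eq_zer_iff)
qed

lemma cup_nonzero: "cup \<noteq> zer 0 2"
proof
  assume "cup = zer 0 2"
  then have "d \<Odot> idn 0 = zer 0 0" using cap_cup by simp
  then show False using d idn_0 by (simp add: scl_eq_zer_iff)
qed

lemma spl_nonzero: "spl \<noteq> zer 1 2"
proof
  assume "spl = zer 1 2"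
  then have "b \<Odot> idn 1 = zer 1 1" using bigon by simp
  then show False using b idn_1 by (simp add: scl_eq_zer_iff)
qed

lemma vtx_nonzero: "vtx \<noteq> zer 3 0"
  using spl_nonzero by (auto simp: spl_def mrg_def)

lemma swp_cup: "swp 1 1 \<star> cup = cup"
  using cmp_reassoc[OF swp_inverse(2)[of 1 1], of cup] swp'_cup by simp

lemma swp_spl: "swp 1 1 \<star> spl = (- 1) \<Odot> spl"
proof -
  have "spl = swp 1 1 \<star> (swp' 1 1 \<star> spl)"
    using cmp_reassoc[OF swp_inverse(2)[of 1 1], of spl] by simp
  also have "\<dots> = (- 1) \<Odot> (swp 1 1 \<star> spl)" unfolding swp'_spl by simp
  finally have "(- 1) \<Odot> spl = (- 1) \<Odot> (- 1) \<Odot> (swp 1 1 \<star> spl)" by simp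
  then show ?thesis by simp
qed

text \<open>\<open>C(2)\<close> is a line, so the crossing acts on \<open>cap\<close> by a scalar;
  composing with \<open>cup\<close> shows that it is 1, because \<open>d \<noteq> 0\<close>.\<close>

lemma cap_swp: "cap \<star> swp 1 1 = cap"
proof -
  obtain x where x: "cap \<star> swp 1 1 = x \<Odot> cap" using dim2[of "cap \<star> swp 1 1"] by auto
  have "x \<Odot> (cap \<star> cup) = (cap \<star> swp 1 1) \<star> cup" unfolding x by simp
  also have "\<dots> = cap \<star> cup" using swp_cup by simp
  finally have "(x * d) \<Odot> idn 0 = d \<Odot> idn 0" unfolding cap_cup by simp
  then have "x * d = d" using idn_0 by (intro scl_inj[of _ "idn 0"]) simp_all
  then show ?thesis using d x by simp
qed

text \<open>The vertex is \<open>spl\<close> with both outputs bent down by the nested caps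
  \<open>?n\<close>. A crossing of the last two inputs slides round these caps onto the outputs of
  \<open>spl\<close>, where it acts by -1.\<close>

lemma vtx_swp_right: "vtx \<star> (idn 1 \<diamondop> swp 1 1) = (- 1) \<Odot> vtx"
proof -
  let ?n = "cap \<star> (idn 1 \<diamondop> cap \<diamondop> idn 1)"
  have n1: "?n \<star> (swp 1 1 \<diamondop> idn 2) = cap \<star> ((cap \<diamondop> idn 2) \<star> (idn 1 \<diamondop> swp' 1 1 \<diamondop> idn 1))"
  proof -
    have "?n \<star> (swp 1 1 \<diamondop> idn 2) = cap \<star> (((idn 1 \<diamondop> cap) \<star> (swp 1 1 \<diamondop> idn 1)) \<diamondop> idn 1)"
      by (simp add: whisk_r)
    also have "\<dots> = cap \<star> (((cap \<diamondop> idn 1) \<star> (idn 1 \<diamondop> swp' 1 1)) \<diamondop> idn 1)"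
      unfolding cap_swp'_right ..
    finally show ?thesis by (simp add: whisk_r)
  qed
  have n2: "?n \<star> (idn 2 \<diamondop> swp 1 1) = cap \<star> ((idn 2 \<diamondop> cap) \<star> (idn 1 \<diamondop> swp' 1 1 \<diamondop> idn 1))"
  proof -
    have "?n \<star> (idn 2 \<diamondop> swp 1 1) = cap \<star> (idn 1 \<diamondop> ((cap \<diamondop> idn 1) \<star> (idn 1 \<diamondop> swp 1 1)))"
      by (simp add: whisk_l tns_assoc)
    also have "\<dots> = cap \<star> (idn 1 \<diamondop> ((idn 1 \<diamondop> cap) \<star> (swp' 1 1 \<diamondop> idn 1)))"
      unfolding cap_swp_right ..
    finally show ?thesis by (simp add: whisk_l tns_assoc)
  qed
  have cc: "cap \<star> (cap \<diamondop> idn 2) = cap \<star> (idn 2 \<diamondop> cap)"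
    using slide[of cap cap] by simp
  have cc': "cap \<star> ((cap \<diamondop> idn 2) \<star> z) = cap \<star> ((idn 2 \<diamondop> cap) \<star> z)" if "ok z" "tgt z = 4" for z
    using cmp_reassoc[OF cc, of z] that by simp
  \<comment> \<open>Both sides are two caps side by side on top of an inverse crossing of the two
    middle strands.\<close>
  have n: "?n \<star> (swp 1 1 \<diamondop> idn 2) = ?n \<star> (idn 2 \<diamondop> swp 1 1)"
    unfolding n1 n2 by (rule cc') simp_all
  have v: "vtx = ?n \<star> (spl \<diamondop> idn 2)"
    using cap_mrg_right mrg_eq_cap_spl by (simp add: whisk_r flip: mrg_eq_cap_spl)
  have "vtx \<star> (idn 1 \<diamondop> swp 1 1) = ?n \<star> ((spl \<diamondop> idn 2) \<star> (idn 1 \<diamondop> swp 1 1))"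
    by (subst v) simp
  also have "(spl \<diamondop> idn 2) \<star> (idn 1 \<diamondop> swp 1 1) = (idn 2 \<diamondop> swp 1 1) \<star> (spl \<diamondop> idn 2)"
    using slide[of spl "swp 1 1"] by simp
  also have "?n \<star> \<dots> = ?n \<star> (idn 2 \<diamondop> swp 1 1) \<star> (spl \<diamondop> idn 2)" by simp
  also have "\<dots> = ?n \<star> (swp 1 1 \<diamondop> idn 2) \<star> (spl \<diamondop> idn 2)" unfolding n ..
  also have "\<dots> = ?n \<star> ((swp 1 1 \<star> spl) \<diamondop> idn 2)" by (simp add: whisk_r)
  also have "\<dots> = (- 1) \<Odot> (?n \<star> (spl \<diamondop> idn 2))" unfolding swp_spl by simp
  finally show ?thesis unfolding v[symmetric] .
qed

text \<open>\<open>C(3)\<close> is a line, so the left crossing acts by some \<open>x\<close>, which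
  is nonzero as crossings are invertible. The right crossing acts by -1, and the braid relation
  becomes \<open>x = - x * x\<close>.\<close>

lemma vtx_swp_left: "vtx \<star> (swp 1 1 \<diamondop> idn 1) = (- 1) \<Odot> vtx"
proof -
  let ?l = "swp 1 1 \<diamondop> idn 1" and ?r = "idn 1 \<diamondop> swp 1 1"
  obtain x where x: "vtx \<star> ?l = x \<Odot> vtx" using dim3[of "vtx \<star> ?l"] by auto
  have lx: "vtx \<star> (?l \<star> z) = x \<Odot> (vtx \<star> z)" if "ok z" "tgt z = 3" for z
    using cmp_reassoc[OF x, of z] that by simp
  have rx: "vtx \<star> (?r \<star> z) = (- 1) \<Odot> (vtx \<star> z)" if "ok z" "tgt z = 3" for z
    using cmp_reassoc[OF vtx_swp_right, of z] that by simp
  have "x \<noteq> 0"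
  proof
    assume "x = 0"
    then have "vtx \<star> (?l \<star> (swp' 1 1 \<diamondop> idn 1)) = zer 3 0" using lx[of "swp' 1 1 \<diamondop> idn 1"] by simp
    then show False using vtx_nonzero by (simp add: inter)
  qed
  \<comment> \<open>Naturality of \<open>swp 1 2\<close> with respect to a crossing; the hexagon
    turns it into the braid relation on three strands.\<close>
  have "swp 1 2 \<star> ?r = ?l \<star> swp 1 2" using swp_natural[of "idn 1" "swp 1 1"] by simp
  then have "?r \<star> ?l \<star> ?r = ?l \<star> (?r \<star> ?l)" using hexagon_right[of 1 1 1] by simp
  then have "vtx \<star> (?r \<star> (?l \<star> ?r)) = vtx \<star> (?l \<star> (?r \<star> ?l))" by simp
  then have "x \<Odot> vtx = (- x * x) \<Odot> vtx"
    by (simp add: lx[unfolded One_nat_def] rx[unfolded One_nat_def] x[unfolded One_nat_def]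
        vtx_swp_right[unfolded One_nat_def])
  then have "x = - x * x" using vtx_nonzero by (intro scl_inj[of _ vtx]) simp_all
  then have "x + x * x = 0" by (simp add: eq_neg_iff_add_eq_0)
  then have "x * (x + 1) = 0" by (simp add: algebra_simps)
  then have "x = - 1" using \<open>x \<noteq> 0\<close> by (simp add: eq_neg_iff_add_eq_0)
  then show ?thesis using x by simp
qed

text \<open>Pulling the bent leg past the other two costs two crossings, and their signs
  cancel.\<close>

lemma rotation: "cap \<star> ((idn 1 \<diamondop> vtx \<diamondop> idn 1) \<star> (idn 3 \<diamondop> cup)) = vtx"
proof -
  have "vtx \<star> swp 1 2 = vtx \<star> (idn 1 \<diamondop> swp 1 1) \<star> (swp 1 1 \<diamondop> idn 1)"
    using hexagon_right[of 1 1 1] by simp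
  also have "\<dots> = vtx" unfolding vtx_swp_right using vtx_swp_left by simp
  finally show ?thesis using rotated_vertex[OF swp'_cup] by simp
qed

section \<open>Ladders, squares and their quarter turns\<close>

lemma mrg_swp: "mrg \<star> swp 1 1 = (- 1) \<Odot> mrg"
proof -
  have "mrg \<star> swp 1 1 = (vtx \<diamondop> idn 1) \<star> ((idn 2 \<diamondop> cup) \<star> swp 1 1)" by (simp add: mrg_def)
  also have "(idn 2 \<diamondop> cup) \<star> swp 1 1 = (swp 1 1 \<diamondop> idn 2) \<star> (idn 2 \<diamondop> cup)"
    using slide[of "swp 1 1" cup] by simp
  also have "(vtx \<diamondop> idn 1) \<star> \<dots> = ((vtx \<star> (swp 1 1 \<diamondop> idn 1)) \<diamondop> idn 1) \<star> (idn 2 \<diamondop> cup)"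
    by (simp add: whisk_r)
  finally show ?thesis unfolding vtx_swp_left by (simp add: mrg_def)
qed

lemma cap_mrg_left: "cap \<star> (idn 1 \<diamondop> mrg) = vtx"
  using rotation by (simp add: mrg_def whisk_l tns_assoc)

lemma cap_spl_right: "(cap \<diamondop> idn 1) \<star> (idn 1 \<diamondop> spl) = mrg"
proof -
  have "(cap \<diamondop> idn 1) \<star> (idn 1 \<diamondop> spl) = ((cap \<star> (idn 1 \<diamondop> mrg)) \<diamondop> idn 1) \<star> (idn 2 \<diamondop> cup)"
    by (simp add: spl_def whisk_l whisk_r tns_assoc)
  then show ?thesis unfolding cap_mrg_left by (simp add: mrg_def)
qed

lemma unbend_left: assumes "ok x" "tgt x = Suc n"
  shows "(idn 1 \<diamondop> ((cap \<diamondop> idn n) \<star> (idn 1 \<diamondop> x))) \<star> (cup \<diamondop> idn (src x)) = x"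
proof -
  have "(idn 1 \<diamondop> ((cap \<diamondop> idn n) \<star> (idn 1 \<diamondop> x))) \<star> (cup \<diamondop> idn (src x)) =
      (idn 1 \<diamondop> cap \<diamondop> idn n) \<star> ((idn 2 \<diamondop> x) \<star> (cup \<diamondop> idn (src x)))"
    using assms by (simp add: whisk_l tns_assoc)
  also have "(idn 2 \<diamondop> x) \<star> (cup \<diamondop> idn (src x)) = (cup \<diamondop> idn (Suc n)) \<star> x"
    using slide[of cup x] assms by simp
  also have "(idn 1 \<diamondop> cap \<diamondop> idn n) \<star> \<dots> = (idn 1 \<diamondop> cap \<diamondop> idn n) \<star> (cup \<diamondop> idn (Suc n)) \<star> x"
    using assms by simp
  finally show ?thesis using assms unfolding cup_zigzag by simp
qed

lemma spl_alt: "(idn 1 \<diamondop> mrg) \<star> (cup \<diamondop> idn 1) = spl"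
  using unbend_left[of spl 1] cap_spl_right by simp

text \<open>The rung of the ladder may be read from either side. This is an isotopy that becomes
  available through the rotational invariance used in \<open>spl_alt\<close>.\<close>

lemma H_alt: "(mrg \<diamondop> idn 1) \<star> (idn 1 \<diamondop> spl) = H"
proof -
  have "(mrg \<diamondop> idn 1) \<star> (idn 1 \<diamondop> spl) = ((mrg \<diamondop> idn 1) \<star> (idn 2 \<diamondop> mrg)) \<star> (idn 1 \<diamondop> (cup \<diamondop> idn 1))"
    by (subst spl_alt[symmetric]) (simp add: whisk_l)
  also have "(mrg \<diamondop> idn 1) \<star> (idn 2 \<diamondop> mrg) = (idn 1 \<diamondop> mrg) \<star> (mrg \<diamondop> idn 2)"
    using slide[of mrg mrg] by simp
  finally show ?thesis by (simp add: H_def spl_def whisk_r tns_assoc)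
qed

lemma spl_cup: "(spl \<diamondop> idn 1) \<star> cup = (idn 1 \<diamondop> spl) \<star> cup"
proof -
  have "(cap \<diamondop> idn 2) \<star> (idn 1 \<diamondop> ((spl \<diamondop> idn 1) \<star> cup)) = (((cap \<diamondop> idn 1) \<star> (idn 1 \<diamondop> spl)) \<diamondop> idn 1) \<star> (idn 1 \<diamondop> cup)"
    by (simp add: whisk_l whisk_r tns_assoc)
  also have "\<dots> = spl" unfolding cap_spl_right by (simp add: spl_def)
  finally show ?thesis using unbend_left[of "(spl \<diamondop> idn 1) \<star> cup" 2] by simp
qed

lemma H_cup: "H \<star> cup = b \<Odot> cup"
proof -
  have "H \<star> cup = (idn 1 \<diamondop> mrg) \<star> ((idn 1 \<diamondop> spl) \<star> cup)"
    by (simp add: H_def spl_cup[unfolded One_nat_def])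
  also have "\<dots> = (idn 1 \<diamondop> (mrg \<star> spl)) \<star> cup" by (simp add: whisk_l)
  finally show ?thesis unfolding bigon by simp
qed

lemma rot_I: "rot I = H"
proof -
  have "rot I = (((cap \<diamondop> idn 1) \<star> (idn 1 \<diamondop> spl)) \<diamondop> idn 1) \<star> (idn 1 \<diamondop> ((mrg \<diamondop> idn 1) \<star> (idn 1 \<diamondop> cup)))"
    by (simp add: rot_def I_def whisk_l whisk_r tns_assoc)
  then show ?thesis unfolding cap_spl_right spl_def[symmetric] H_alt .
qed

text \<open>Capping the first output of a ladder absorbs it into two successive merges. The tail
  \<open>z\<close> lets this evaluate the quarter turn of anything whose last factor is
  \<open>H\<close>.\<close>

lemma cap_H: assumes "ok z" "tgt z = 4"
  shows "(cap \<diamondop> idn 2) \<star> ((idn 1 \<diamondop> H \<diamondop> idn 1) \<star> z) = (mrg \<diamondop> idn 1) \<star> ((mrg \<diamondop> idn 2) \<star> z)"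
proof -
  have "(cap \<diamondop> idn 2) \<star> (idn 1 \<diamondop> H \<diamondop> idn 1) =
      ((cap \<diamondop> idn 2) \<star> (idn 2 \<diamondop> (mrg \<diamondop> idn 1))) \<star> (idn 1 \<diamondop> (spl \<diamondop> idn 2))"
    by (simp add: H_def whisk_l whisk_r tns_assoc)
  also have "(cap \<diamondop> idn 2) \<star> (idn 2 \<diamondop> (mrg \<diamondop> idn 1)) = (mrg \<diamondop> idn 1) \<star> (cap \<diamondop> idn 3)"
    using slide[of cap "mrg \<diamondop> idn 1"] by simp
  also have "\<dots> \<star> (idn 1 \<diamondop> (spl \<diamondop> idn 2)) = (mrg \<diamondop> idn 1) \<star> (((cap \<diamondop> idn 1) \<star> (idn 1 \<diamondop> spl)) \<diamondop> idn 2)"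
    by (simp add: whisk_r tns_assoc)
  finally have "(cap \<diamondop> idn 2) \<star> (idn 1 \<diamondop> H \<diamondop> idn 1) = (mrg \<diamondop> idn 1) \<star> (mrg \<diamondop> idn 2)"
    unfolding cap_spl_right .
  from cmp_reassoc[OF this, of z] show ?thesis using assms by simp
qed

lemma rot_H: "rot H = I"
proof -
  have "rot H = (mrg \<diamondop> idn 1) \<star> ((mrg \<diamondop> idn 2) \<star> (idn 2 \<diamondop> cup))"
    unfolding rot_def by (rule cap_H) simp_all
  also have "(mrg \<diamondop> idn 2) \<star> (idn 2 \<diamondop> cup) = (idn 1 \<diamondop> cup) \<star> mrg"
    using slide[of mrg cup] by simp
  finally show ?thesis by (simp add: I_def spl_def)
qed

text \<open>The diagram is a square with one leg at each corner. Both sides are brought to the same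
  form: three merges on top of a cup whose second leg carries a \<open>spl\<close>.\<close>

lemma rot_H_H: "rot (H \<star> H) = H \<star> H"
proof -
  have "rot (H \<star> H) = (cap \<diamondop> idn 2) \<star> ((idn 1 \<diamondop> H \<diamondop> idn 1) \<star> ((idn 1 \<diamondop> H \<diamondop> idn 1) \<star> (idn 2 \<diamondop> cup)))"
    by (simp add: rot_def whisk_l whisk_r)
  also have "\<dots> = (mrg \<diamondop> idn 1) \<star> ((mrg \<diamondop> idn 2) \<star> ((idn 1 \<diamondop> H \<diamondop> idn 1) \<star> (idn 2 \<diamondop> cup)))"
    by (rule cap_H) simp_all
  also have "(idn 1 \<diamondop> H \<diamondop> idn 1) \<star> (idn 2 \<diamondop> cup) =
      (idn 1 \<diamondop> mrg \<diamondop> idn 2) \<star> (idn 2 \<diamondop> ((spl \<diamondop> idn 1) \<star> cup))"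
    unfolding H_alt[symmetric] by (simp add: whisk_l whisk_r tns_assoc)
  finally have l: "rot (H \<star> H) = (mrg \<diamondop> idn 1) \<star> ((mrg \<diamondop> idn 2) \<star> ((idn 1 \<diamondop> mrg \<diamondop> idn 2) \<star>
      (idn 2 \<diamondop> ((idn 1 \<diamondop> spl) \<star> cup))))"
    unfolding spl_cup .
  have "H \<star> H = (mrg \<diamondop> idn 1) \<star> (((idn 1 \<diamondop> spl) \<star> (mrg \<diamondop> idn 1)) \<star> (idn 1 \<diamondop> spl))"
    unfolding H_alt[symmetric] by simp
  also have "(idn 1 \<diamondop> spl) \<star> (mrg \<diamondop> idn 1) = (mrg \<diamondop> idn 2) \<star> (idn 2 \<diamondop> spl)"
    using slide[of mrg spl] by simp
  also have "\<dots> \<star> (idn 1 \<diamondop> spl) = (mrg \<diamondop> idn 2) \<star> (idn 1 \<diamondop> (((idn 1 \<diamondop> spl) \<star> (mrg \<diamondop> idn 1)) \<star> (idn 1 \<diamondop> cup)))"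
    by (subst (2) spl_def) (simp add: whisk_l)
  also have "(idn 1 \<diamondop> spl) \<star> (mrg \<diamondop> idn 1) = (mrg \<diamondop> idn 2) \<star> (idn 2 \<diamondop> spl)"
    using slide[of mrg spl] by simp
  finally show ?thesis unfolding l by (simp add: whisk_l whisk_r tns_assoc)
qed

text \<open>A crossing inserted between the two acts by 1 on \<open>cap\<close> and by -1 on
  \<open>spl\<close>.\<close>

lemma cap_spl: "cap \<star> spl = zer 1 0"
proof -
  have "cap \<star> spl = (cap \<star> swp 1 1) \<star> spl" unfolding cap_swp ..
  also have "\<dots> = (- 1) \<Odot> (cap \<star> spl)" using swp_spl by simp
  finally have "2 \<Odot> (cap \<star> spl) = zer 1 0"
    using scl_add[of "cap \<star> spl" 1 1] scl_add[of "cap \<star> spl" 1 "- 1"] by simp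
  then show ?thesis by (simp add: scl_eq_zer_iff)
qed

end

end

section \<open>Linear relations between the diagrams with four ends\<close>

context
  fixes w :: complex
  assumes w: "w * w + w + 1 = 0"
begin

text \<open>The hypothesis is the comparison of coefficients made in \<open>b_eq\<close>. Here and
  in the next three lemmas the proof splits off a multiple of \<open>w * w + w + 1\<close>.\<close>

lemma cube_root_b:
  assumes "- \<beta> * (w * w) + - \<beta> * w * d + w * w * b + - \<beta> + 0 = b" (is "?e = b")
  shows "b * (1 - w * w) = \<beta> * w * (1 - d)"
proof -
  have "b * (1 - w * w) - \<beta> * w * (1 - d) = (b - ?e) - \<beta> * (w * w + w + 1)" by (simp add: algebra_simps)
  then show ?thesis unfolding assms w by simp
qed

lemma cube_root_t:
  assumes "- \<beta> * (w * w) + - w * b + w * w * t - - \<beta> - 0 = - t" (is "?e = - t")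
  shows "w * (t + b) = \<beta> * (1 - w * w)"
proof -
  have "w * (t + b) - \<beta> * (1 - w * w) = t * (w * w + w + 1) - (?e + t)" by (simp add: algebra_simps)
  then show ?thesis unfolding assms w by simp
qed

lemma cube_root_b_value:
  assumes "b * (1 - w * w) = (w * w - w) * w * (1 - d)"
  shows "(b - (1 - d)) * (1 - w * w) = 0"
proof -
  have "(b - (1 - d)) * (1 - w * w) =
      b * (1 - w * w) - (w * w - w) * w * (1 - d) + (1 - d) * (w - 1) * (w * w + w + 1)"
    by (simp add: algebra_simps)
  then show ?thesis unfolding assms w by simp
qed

lemma cube_root_t_value:
  assumes "w * (t + b) = (w * w - w) * (1 - w * w)" "b = 1 - d"
  shows "(t - (d - 4)) * w = 0"
proof -
  have "(t - (d - 4)) * w = w * (t + b) - (w * w - w) * (1 - w * w) + w * (2 - w) * (w * w + w + 1)"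
    unfolding assms(2) by (simp add: algebra_simps)
  then show ?thesis unfolding assms(1) w by simp
qed

lemma cube_root_square: "w * w = - 1 - w" "w * (w * x) = - x - w * x"
proof -
  show "w * w = - 1 - w" using w by (metis add.commute add_diff_cancel_right' diff_0 diff_diff_eq2 minus_diff_eq)
  then have "w * w * x = (- 1 - w) * x" by simp
  then show "w * (w * x) = - x - w * x" by (simp add: algebra_simps)
qed

text \<open>This \<open>\<beta>\<close> is a square root of -3. The other identities are the
  coefficients that arise when a relation is composed with a crossing and when the two forms of
  (QEJac) are subtracted.\<close>

lemma cube_root_beta:
  assumes "\<beta> = w * w - w"
  shows "\<beta> * \<beta> = - 3" "\<beta> * (w * w) - w * w = 2 * w" "\<beta> * w - 1 + w * w = 0" "w - 1 - w * w = 2 * w"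
    "1 + \<beta> = - 2 * w" "- \<beta> * (w * w) - 3 * (w * w) = 4 + 2 * w" "3 - \<beta> * w - 3 * (w * w) = 4 + 2 * w"
    "- 1 - w - w * w = 0" "- \<beta> * (w * w) - \<beta> * w = \<beta>" "- \<beta> * w - \<beta> * (w * w) = \<beta>"
  unfolding assms by (simp_all add: algebra_simps cube_root_square)

end

section \<open>Relations between the six diagrams\<close>

context qe_pro
begin

context
  notes numeral_2_eq_2 [simp] and numeral_3_eq_3 [simp]
begin

text \<open>The arguments come in consecutive pairs that the quarter turn exchanges, so
  \<open>L_rot\<close> is a swap within each pair.\<close>

definition L :: "complex \<Rightarrow> complex \<Rightarrow> complex \<Rightarrow> complex \<Rightarrow> complex \<Rightarrow> complex \<Rightarrow> 'a" where
  "L x1 x2 x3 x4 x5 x6 = x1 \<Odot> idn 2 \<boxplus> (x2 \<Odot> U \<boxplus> (x3 \<Odot> I \<boxplus> (x4 \<Odot> H \<boxplus> (x5 \<Odot> swp' 1 1 \<boxplus> x6 \<Odot> swp 1 1))))"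

lemma L_simps [simp]: "ok (L x1 x2 x3 x4 x5 x6)" "src (L x1 x2 x3 x4 x5 x6) = 2" "tgt (L x1 x2 x3 x4 x5 x6) = 2"
  by (simp_all add: L_def)

lemma L_scl: "r \<Odot> L x1 x2 x3 x4 x5 x6 = L (r * x1) (r * x2) (r * x3) (r * x4) (r * x5) (r * x6)"
  by (simp add: L_def scl_pls)

lemma L_pls: "L x1 x2 x3 x4 x5 x6 \<boxplus> L y1 y2 y3 y4 y5 y6 =
    L (x1 + y1) (x2 + y2) (x3 + y3) (x4 + y4) (x5 + y5) (x6 + y6)"
  by (simp add: L_def scl_add pls_ac)

lemma L_lin:
  assumes "L x1 x2 x3 x4 x5 x6 = zer 2 2" "L y1 y2 y3 y4 y5 y6 = zer 2 2"
  shows "L (r * x1 + s * y1) (r * x2 + s * y2) (r * x3 + s * y3) (r * x4 + s * y4) (r * x5 + s * y5) (r * x6 + s * y6) = zer 2 2"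
proof -
  have "r \<Odot> L x1 x2 x3 x4 x5 x6 \<boxplus> s \<Odot> L y1 y2 y3 y4 y5 y6 = zer 2 2" unfolding assms by simp
  then show ?thesis by (simp add: L_scl L_pls)
qed

lemma L_rot: "rot (L x1 x2 x3 x4 x5 x6) = L x2 x1 x4 x3 x6 x5"
  unfolding L_def
  by (simp add: rot_linear[simplified] rot_idn[simplified] rot_U[simplified] rot_I rot_H rot_swp[simplified] rot_swp'[simplified] pls_ac)

lemma w_inverse: "w * (w * w) = 1" "w \<noteq> 0"
proof -
  have "(w - 1) * (w * w + w + 1) = 0" using w by simp
  then show "w * (w * w) = 1" by (simp add: algebra_simps)
  then show "w \<noteq> 0" by auto
qed

text \<open>The relation \<open>qe\<close> solved for its only term outside the list of six
  diagrams.\<close>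

lemma H_swp': "H \<star> swp' 1 1 = L (- \<beta> * (w * w)) (- \<beta> * w) (- w) ((w * w)) (- \<beta>) 0"
proof (rule eq_if_diff_zer)
  have "L (\<beta> * (w * w)) (\<beta> * w) w (- (w * w)) \<beta> 0 = (- 1) \<Odot> L (- \<beta> * (w * w)) (- \<beta> * w) (- w) ((w * w)) (- \<beta>) 0"
    by (simp add: L_scl)
  moreover have "H \<star> swp' 1 1 \<boxplus> L (\<beta> * (w * w)) (\<beta> * w) w (- (w * w)) \<beta> 0 = zer 2 2"
    using qe by (simp add: L_def scl_pls pls_ac)
  ultimately show "H \<star> swp' 1 1 \<boxplus> (- 1) \<Odot> L (- \<beta> * (w * w)) (- \<beta> * w) (- w) ((w * w)) (- \<beta>) 0 = zer 2 2"
    by simp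
qed simp_all

text \<open>\<open>cup\<close>, and likewise \<open>spl\<close>, is a common eigenvector of all six
  diagrams. Every linear relation among them therefore yields the two scalar equations of
  \<open>L_zero_scalars\<close>.\<close>

lemma L_cup: "L x1 x2 x3 x4 x5 x6 \<star> cup = (x1 + x2 * d + x4 * b + x5 + x6) \<Odot> cup"
proof -
  have "U \<star> cup = d \<Odot> cup" "I \<star> cup = zer 0 2" unfolding U_def I_def using cap_cup lollipop by simp_all
  then show ?thesis unfolding L_def
    by (simp add: cmp_pls H_cup swp_cup[simplified] swp'_cup[simplified] scl_add pls_assoc)
qed

lemma L_spl: "L x1 x2 x3 x4 x5 x6 \<star> spl = (x1 + x3 * b + x4 * t - x5 - x6) \<Odot> spl"
proof -
  have "U \<star> spl = zer 1 2" "I \<star> spl = b \<Odot> spl" unfolding U_def I_def using cap_spl bigon by simp_all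
  then have "L x1 x2 x3 x4 x5 x6 \<star> spl =
      x1 \<Odot> spl \<boxplus> ((x3 * b) \<Odot> spl \<boxplus> ((x4 * t) \<Odot> spl \<boxplus> ((- x5) \<Odot> spl \<boxplus> (- x6) \<Odot> spl)))"
    unfolding L_def
    by (simp add: cmp_pls triangle swp_spl[simplified] swp'_spl[simplified])
  also have "\<dots> = (x1 + x3 * b + x4 * t - x5 - x6) \<Odot> spl"
    by (simp flip: scl_add add: algebra_simps)
  finally show ?thesis .
qed

lemma L_zero_scalars:
  assumes "L x1 x2 x3 x4 x5 x6 = zer 2 2"
  shows "x1 + x2 * d + x4 * b + x5 + x6 = 0" "x1 + x3 * b + x4 * t - x5 - x6 = 0"
proof -
  have "(x1 + x2 * d + x4 * b + x5 + x6) \<Odot> cup = zer 0 2"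
    using L_cup[of x1 x2 x3 x4 x5 x6] unfolding assms by simp
  then show "x1 + x2 * d + x4 * b + x5 + x6 = 0"
    using cup_nonzero by (simp add: scl_eq_zer_iff)
  have "(x1 + x3 * b + x4 * t - x5 - x6) \<Odot> spl = zer 1 2"
    using L_spl[of x1 x2 x3 x4 x5 x6] unfolding assms by simp
  then show "x1 + x3 * b + x4 * t - x5 - x6 = 0"
    using spl_nonzero by (simp add: scl_eq_zer_iff)
qed

text \<open>\<open>U\<close> absorbs the crossing, \<open>I\<close> changes sign and
  \<open>H\<close> is covered by \<open>H_swp'\<close>. The conditions keep the double crossing out,
  for which no expression is at hand.\<close>

lemma L_swp':
  "x6 = 0 \<Longrightarrow> x5 = 0 \<Longrightarrow> L x1 x2 x3 x4 x5 x6 \<star> swp' 1 1 =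
    L (- x4 * \<beta> * (w * w)) (x2 - x4 * \<beta> * w) (- x3 - x4 * w) (x4 * (w * w)) (x1 - x4 * \<beta>) 0"
proof -
  have c: "x = x \<star> swp 1 1 \<star> swp' 1 1" if "ok x" "src x = 2" for x
    using that by simp
  have U: "U \<star> swp' 1 1 = U"
  proof -
    have "U \<star> swp 1 1 = U" using cap_swp by (simp add: U_def)
    then show ?thesis using c[of U] by simp
  qed
  have I: "I \<star> swp' 1 1 = (- 1) \<Odot> I"
  proof -
    have "I \<star> swp 1 1 = (- 1) \<Odot> I" using mrg_swp by (simp add: I_def)
    then have "I = (- 1) \<Odot> (I \<star> swp' 1 1)" using c[of I] by simp
    then have "(- 1) \<Odot> I = (- 1) \<Odot> (- 1) \<Odot> (I \<star> swp' 1 1)" by simp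
    then show ?thesis by simp
  qed
  assume "x6 = 0" "x5 = 0"
  then have "L x1 x2 x3 x4 x5 x6 \<star> swp' 1 1 = L 0 x2 (- x3) 0 x1 0 \<boxplus> x4 \<Odot> (H \<star> swp' 1 1)"
    unfolding L_def by (simp add: cmp_pls U[simplified] I[simplified] pls_ac)
  then show ?thesis unfolding H_swp' by (simp add: L_scl L_pls algebra_simps)
qed

text \<open>Composing \<open>H_swp'\<close> with \<open>swp 1 1\<close> gives \<open>H\<close> on
  the left and the wanted composite with coefficient \<open>w * w\<close> on the right. Multiplying
  by \<open>w\<close> isolates it, since \<open>w * (w * w) = 1\<close>.\<close>

lemma H_swp: "H \<star> swp 1 1 = L (\<beta> * w) (\<beta> * (w * w)) (- (w * w)) w 0 \<beta>"
proof -
  let ?y = "H \<star> swp 1 1"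
  have U: "U \<star> swp 1 1 = U" using cap_swp by (simp add: U_def)
  have I: "I \<star> swp 1 1 = (- 1) \<Odot> I" using mrg_swp by (simp add: I_def)
  have "H = H \<star> swp' 1 1 \<star> swp 1 1" by simp
  also have "\<dots> = L (- \<beta>) (- \<beta> * w) w 0 0 (- \<beta> * (w * w)) \<boxplus> (w * w) \<Odot> ?y"
    unfolding H_swp' unfolding L_def by (simp add: cmp_pls U[simplified] I[simplified] pls_ac)
  finally have H: "H = L (- \<beta>) (- \<beta> * w) w 0 0 (- \<beta> * (w * w)) \<boxplus> (w * w) \<Odot> ?y" .
  have z: "L 0 0 0 0 0 0 = zer 2 2" by (simp add: L_def)
  have "L \<beta> (\<beta> * w) (- w) 1 0 (\<beta> * (w * w)) = L \<beta> (\<beta> * w) (- w) 0 0 (\<beta> * (w * w)) \<boxplus> H"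
    using L_pls[of \<beta> "\<beta> * w" "- w" 0 0 "\<beta> * (w * w)" 0 0 0 1 0 0] by (simp add: L_def[of 0 0 0 1 0 0])
  also have "\<dots> = (L \<beta> (\<beta> * w) (- w) 0 0 (\<beta> * (w * w)) \<boxplus> L (- \<beta>) (- \<beta> * w) w 0 0 (- \<beta> * (w * w))) \<boxplus> (w * w) \<Odot> ?y"
    by (subst H) (simp add: pls_assoc)
  also have "\<dots> = (w * w) \<Odot> ?y" by (simp add: L_pls z)
  finally have "w \<Odot> L \<beta> (\<beta> * w) (- w) 1 0 (\<beta> * (w * w)) = w \<Odot> (w * w) \<Odot> ?y" by simp
  moreover have "w * (\<beta> * (w * w)) = \<beta>"
    using arg_cong[OF w_inverse(1), of "\<lambda>x. \<beta> * x"] by (simp add: mult_ac)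
  ultimately show ?thesis using w_inverse(1) by (simp add: L_scl mult_ac)
qed

lemma w_ne_1: "w * w \<noteq> 1"
proof
  assume a: "w * w = 1"
  then have "w = 1" using w_inverse(1) by simp
  then show False using w by simp
qed

text \<open>\<open>H \<star> swp' 1 1\<close> is applied to \<open>cup\<close> in two ways, directly
  and through \<open>H_swp'\<close>. The same comparison on \<open>spl\<close> gives
  \<open>t_eq\<close>.\<close>

lemma b_eq: "b * (1 - w * w) = \<beta> * w * (1 - d)"
proof -
  have "H \<star> swp' 1 1 \<star> cup = b \<Odot> cup" using swp'_cup H_cup by simp
  then have "L (- \<beta> * (w * w)) (- \<beta> * w) (- w) (w * w) (- \<beta>) 0 \<star> cup = b \<Odot> cup" unfolding H_swp' .
  then have "- \<beta> * (w * w) + - \<beta> * w * d + w * w * b + - \<beta> + 0 = b"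
    unfolding L_cup using cup_nonzero by (intro scl_inj[of _ cup]) simp_all
  then show ?thesis by (rule cube_root_b[OF w])
qed

lemma t_eq: "w * (t + b) = \<beta> * (1 - w * w)"
proof -
  have "H \<star> swp' 1 1 \<star> spl = (- t) \<Odot> spl" using swp'_spl triangle by simp
  then have "L (- \<beta> * (w * w)) (- \<beta> * w) (- w) (w * w) (- \<beta>) 0 \<star> spl = (- t) \<Odot> spl" unfolding H_swp' .
  then have "- \<beta> * (w * w) + - w * b + w * w * t - - \<beta> - 0 = - t"
    unfolding L_spl using spl_nonzero by (intro scl_inj[of _ spl]) simp_all
  then show ?thesis by (rule cube_root_t[OF w])
qed

lemma beta_nonzero: "\<beta> \<noteq> 0"
proof
  assume "\<beta> = 0"
  then have "b * (1 - w * w) = 0" using b_eq by simp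
  then show False using b w_ne_1 by simp
qed

text \<open>Five of the six composites stay among the six diagrams. Only the coefficient of
  \<open>H\<close> contributes the square, which is kept as a separate term.\<close>

lemma H_L: "H \<star> L x1 x2 x3 x4 x5 x6 =
    L (x6 * \<beta> * w - x5 * \<beta> * (w * w)) (x2 * b - x5 * \<beta> * w + x6 * \<beta> * (w * w)) (x3 * t - x5 * w - x6 * (w * w))
      (x1 + x5 * (w * w) + x6 * w) (- x5 * \<beta>) (x6 * \<beta>) \<boxplus> x4 \<Odot> (H \<star> H)" (is "_ = ?r")
proof -
  have U: "H \<star> U = b \<Odot> U" unfolding U_def using cmp_reassoc[OF H_cup, of cap] by simp
  have I: "H \<star> I = t \<Odot> I" unfolding I_def using cmp_reassoc[OF triangle, of mrg] by simp
  have "H \<star> L x1 x2 x3 x4 x5 x6 = L 0 (x2 * b) (x3 * t) x1 0 0 \<boxplus> (x4 \<Odot> (H \<star> H) \<boxplus>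
      (x5 \<Odot> (H \<star> swp' 1 1) \<boxplus> x6 \<Odot> (H \<star> swp 1 1)))"
    unfolding L_def by (simp add: cmp_pls U[simplified] I[simplified] pls_ac)
  also have "\<dots> = (L 0 (x2 * b) (x3 * t) x1 0 0 \<boxplus> (x5 \<Odot> (H \<star> swp' 1 1) \<boxplus> x6 \<Odot> (H \<star> swp 1 1))) \<boxplus> x4 \<Odot> (H \<star> H)"
    by (simp add: pls_ac)
  finally show ?thesis unfolding H_swp H_swp' by (simp add: L_scl L_pls algebra_simps)
qed

text \<open>Stacking the ladder \<open>H\<close> on a relation and subtracting the rotated relation
  removes the square \<open>H \<star> H\<close>, which is invariant under rotation.\<close>

lemma H_antisymmetrized:
  assumes "L x1 x2 x3 x4 x5 x6 = zer 2 2"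
  shows "L (\<beta> * (w - w * w) * (x5 + x6) - x2 * b) (- (\<beta> * (w - w * w) * (x5 + x6) - x2 * b))
    (x3 * t - x1 + x5 + x6) (- (x3 * t - x1 + x5 + x6)) (- \<beta> * (x5 + x6)) (- (- \<beta> * (x5 + x6))) = zer 2 2"
proof -
  define y1 y2 y3 y4 where "y1 = x6 * \<beta> * w - x5 * \<beta> * (w * w)"
    and "y2 = x2 * b - x5 * \<beta> * w + x6 * \<beta> * (w * w)" and "y3 = x3 * t - x5 * w - x6 * (w * w)"
    and "y4 = x1 + x5 * (w * w) + x6 * w"
  note y = this
  let ?y5 = "- x5 * \<beta>" and ?y6 = "x6 * \<beta>" and ?B = "x4 \<Odot> (H \<star> H)"
  have 1: "L y1 y2 y3 y4 ?y5 ?y6 \<boxplus> ?B = zer 2 2"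
    using H_L[of x1 x2 x3 x4 x5 x6] unfolding assms y by simp
  then have "rot (L y1 y2 y3 y4 ?y5 ?y6 \<boxplus> ?B) = zer 2 2" by (simp add: rot_linear[simplified])
  then have 2: "L y2 y1 y4 y3 ?y6 ?y5 \<boxplus> ?B = zer 2 2" by (simp add: rot_linear L_rot rot_H_H)
  have "L y1 y2 y3 y4 ?y5 ?y6 \<boxplus> (- 1) \<Odot> L y2 y1 y4 y3 ?y6 ?y5 =
      (L y1 y2 y3 y4 ?y5 ?y6 \<boxplus> ?B) \<boxplus> (- 1) \<Odot> (L y2 y1 y4 y3 ?y6 ?y5 \<boxplus> ?B)"
  proof -
    have "zer 2 2 = ?B \<boxplus> (- 1) \<Odot> ?B" using scl_add[of "H \<star> H" x4 "- x4"] by simp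
    then have "L y1 y2 y3 y4 ?y5 ?y6 \<boxplus> (- 1) \<Odot> L y2 y1 y4 y3 ?y6 ?y5 =
      L y1 y2 y3 y4 ?y5 ?y6 \<boxplus> (- 1) \<Odot> L y2 y1 y4 y3 ?y6 ?y5 \<boxplus> (?B \<boxplus> (- 1) \<Odot> ?B)" by (metis L_simps ends(9-12) ok_simps(5,6) pls_zer)
    then show ?thesis by (simp add: scl_pls pls_ac)
  qed
  also have "\<dots> = zer 2 2" unfolding 1 2 by simp
  finally have "L (y1 - y2) (y2 - y1) (y3 - y4) (y4 - y3) (?y5 - ?y6) (?y6 - ?y5) = zer 2 2"
    by (simp add: L_scl L_pls)
  moreover have "y1 - y2 = \<beta> * (w - w * w) * (x5 + x6) - x2 * b" "y3 - y4 = x3 * t - x1 + x5 + x6"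
    "?y5 - ?y6 = - \<beta> * (x5 + x6)"
  proof -
    show "y1 - y2 = \<beta> * (w - w * w) * (x5 + x6) - x2 * b" "?y5 - ?y6 = - \<beta> * (x5 + x6)"
      by (simp_all add: y algebra_simps)
    have "y3 - y4 = x3 * t - x1 - (x5 + x6) * (w * w + w)" by (simp add: y algebra_simps)
    also have "w * w + w = - 1" using w by (simp add: eq_neg_iff_add_eq_0)
    finally show "y3 - y4 = x3 * t - x1 + x5 + x6" by simp
  qed
  ultimately show ?thesis by (metis minus_diff_eq)
qed

end

end

text \<open>Rescaling the self-duality by \<open>k\<close> divides \<open>\<beta>\<close> by \<open>k^3\<close>. This is the normalization for which the
  coefficient of \<open>I + H\<close> becomes 1.\<close>

locale normalized_qe_pro = qe_pro +
  assumes beta: "\<beta> = w * w - w"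
begin

context
  notes numeral_2_eq_2 [simp] and numeral_3_eq_3 [simp]
begin

section \<open>Collapse of a relation for the normalized \<beta>\<close>

lemma b_value: "b = 1 - d"
proof -
  have "(b - (1 - d)) * (1 - w * w) = 0" using cube_root_b_value[OF w] b_eq unfolding beta .
  then show ?thesis using w_ne_1 by simp
qed

lemma t_value: "t = d - 4"
proof -
  have "(t - (d - 4)) * w = 0" using cube_root_t_value[OF w _ b_value] t_eq unfolding beta .
  then show ?thesis using w_inverse(2) by auto
qed

lemma braiding_symmetric_if:
  assumes "L 0 0 0 0 r (- r) = zer 2 2" "r \<noteq> 0"
  shows "swp' 1 1 = swp 1 1"
proof (rule eq_if_diff_zer)
  have "L 0 0 0 0 1 (- 1) = inverse r \<Odot> L 0 0 0 0 r (- r)" using assms(2) by (simp add: L_scl)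
  then have "L 0 0 0 0 1 (- 1) = zer 2 2" unfolding assms by simp
  then show "swp' 1 1 \<boxplus> (- 1) \<Odot> swp 1 1 = zer 2 2" by (simp add: L_def)
qed simp_all

text \<open>The eigenvalue on \<open>cup\<close> forces \<open>a = c\<close>, so up to a factor the
  relation is \<open>1 - U + I - H = 0\<close>. Composing with a crossing and eliminating
  \<open>H\<close> leaves \<open>1 + I\<close> equal to the inverse crossing; its quarter turn gives
  \<open>U + H\<close> equal to the crossing. The difference of these two, compared with the
  relation itself, identifies the crossings.\<close>

lemma relation_anti_uncrossed:
  assumes r: "L a (- a) c (- c) 0 0 = zer 2 2" and nz: "a \<noteq> 0 \<or> c \<noteq> 0"
  shows "swp' 1 1 = swp 1 1"
proof -
  have "(a - c) * b = a + - a * d + - c * b + 0 + 0" by (simp add: b_value algebra_simps)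
  then have "(a - c) * b = 0" unfolding L_zero_scalars(1)[OF r] .
  then have "a = c" using b by simp
  with nz have "a \<noteq> 0" "c = a" by auto
  then have 1: "L 1 (- 1) 1 (- 1) 0 0 = zer 2 2"
    using L_scl[of "inverse a" a "- a" c "- c" 0 0] r by simp
  have "L 1 (- 1) 1 (- 1) 0 0 \<star> swp' 1 1 = zer 2 2" unfolding 1 by simp
  then have 2: "L (\<beta> * (w * w)) (\<beta> * w - 1) (w - 1) (- (w * w)) (1 + \<beta>) 0 = zer 2 2"
    by (subst (asm) L_swp') (simp_all add: algebra_simps)
  have c: "\<beta> * (w * w) - w * w = 2 * w" "\<beta> * w - 1 + w * w = 0" "w - 1 - w * w = 2 * w" "1 + \<beta> = - 2 * w"
    by (rule cube_root_beta[OF w beta])+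
  \<comment> \<open>The multiple \<open>- (w * w)\<close> of the original relation is chosen to
    cancel \<open>H\<close>.\<close>
  have "L (\<beta> * (w * w) - w * w) (\<beta> * w - 1 + w * w) (w - 1 - w * w) 0 (1 + \<beta>) 0 = zer 2 2"
    using L_lin[OF 2 1, of 1 "- (w * w)"] by simp
  then have "L (2 * w) 0 (2 * w) 0 (- 2 * w) 0 = zer 2 2" unfolding c .
  then have 3: "L 1 0 1 0 (- 1) 0 = zer 2 2"
    using L_scl[of "inverse (2 * w)" "2 * w" 0 "2 * w" 0 "- 2 * w" 0] w_inverse(2) by simp
  then have 4: "L 0 1 0 1 0 (- 1) = zer 2 2"
    using L_rot[of 1 0 1 0 "- 1" 0] rot_linear(3) by simp
  have "L 1 (- 1) 1 (- 1) (- 1) 1 = zer 2 2" using L_lin[OF 3 4, of 1 "- 1"] by simp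
  from L_lin[OF 1 this, of 1 "- 1"] have "L 0 0 0 0 1 (- 1) = zer 2 2" by simp
  then show ?thesis by (rule braiding_symmetric_if) simp
qed

text \<open>On \<open>spl\<close> the relation gives \<open>a + c * (b + t) = 0\<close>, and
  \<open>b + t = - 3\<close>; so up to a factor it is \<open>3 (1 + U) + I + H = 0\<close>.
  Composing with a crossing and eliminating \<open>H\<close> also removes \<open>I\<close>. The
  result involves one crossing beside \<open>1 + U\<close>, which the quarter turn fixes, so its
  rotation has the other crossing in the same place.\<close>

lemma relation_sym_uncrossed:
  assumes r: "L a a c c 0 0 = zer 2 2" and nz: "a \<noteq> 0 \<or> c \<noteq> 0"
  shows "swp' 1 1 = swp 1 1"
proof -
  have "a - 3 * c = a + c * b + c * t - 0 - 0" by (simp add: b_value t_value algebra_simps)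
  then have "a = 3 * c" unfolding L_zero_scalars(2)[OF r] by simp
  with nz have "c \<noteq> 0" by auto
  then have 1: "L 3 3 1 1 0 0 = zer 2 2"
    using L_scl[of "inverse c" a a c c 0 0] r by (simp add: \<open>a = 3 * c\<close> field_simps)
  have "L 3 3 1 1 0 0 \<star> swp' 1 1 = zer 2 2" unfolding 1 by simp
  then have 2: "L (- \<beta> * (w * w)) (3 - \<beta> * w) (- 1 - w) (w * w) (3 - \<beta>) 0 = zer 2 2"
    by (subst (asm) L_swp') (simp_all add: algebra_simps)
  have c: "- \<beta> * (w * w) - 3 * (w * w) = 4 + 2 * w" "3 - \<beta> * w - 3 * (w * w) = 4 + 2 * w" "- 1 - w - w * w = 0"
    by (rule cube_root_beta[OF w beta])+
  have "L (- \<beta> * (w * w) - 3 * (w * w)) (3 - \<beta> * w - 3 * (w * w)) (- 1 - w - w * w) 0 (3 - \<beta>) 0 = zer 2 2"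
    using L_lin[OF 2 1, of 1 "- (w * w)"] by (simp add: mult.commute)
  then have 3: "L (4 + 2 * w) (4 + 2 * w) 0 0 (3 - \<beta>) 0 = zer 2 2" unfolding c .
  then have 4: "L (4 + 2 * w) (4 + 2 * w) 0 0 0 (3 - \<beta>) = zer 2 2"
    using L_rot[of "4 + 2 * w" "4 + 2 * w" 0 0 "3 - \<beta>" 0] rot_linear(3) by simp
  have "L 0 0 0 0 (3 - \<beta>) (- (3 - \<beta>)) = zer 2 2" using L_lin[OF 3 4, of 1 "- 1"] by simp
  \<comment> \<open>\<open>\<beta> = 3\<close> would contradict
    \<open>\<beta> * \<beta> = - 3\<close>.\<close>
  moreover have "3 - \<beta> \<noteq> 0" using cube_root_beta(1)[OF w beta] by auto
  ultimately show ?thesis by (rule braiding_symmetric_if)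
qed

text \<open>The crossings enter with opposite coefficients, so stacking \<open>H\<close> and
  antisymmetrizing removes them. If the outcome is trivial then \<open>a = 0\<close>, the eigenvalue
  on \<open>cup\<close> gives \<open>c = 0\<close>, and only the difference of the crossings is
  left.\<close>

lemma relation_anti:
  assumes r: "L a (- a) c (- c) e (- e) = zer 2 2" and nz: "a \<noteq> 0 \<or> c \<noteq> 0 \<or> e \<noteq> 0"
  shows "swp' 1 1 = swp 1 1"
proof (cases "e = 0")
  case True
  then show ?thesis using relation_anti_uncrossed r nz by simp
next
  case False
  have h: "L (a * b) (- (a * b)) (c * t - a) (- (c * t - a)) 0 0 = zer 2 2"
    using H_antisymmetrized[OF r] by simp
  show ?thesis
  proof (cases "a * b \<noteq> 0 \<or> c * t - a \<noteq> 0")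
    case True
    then show ?thesis using relation_anti_uncrossed[OF h] by simp
  next
    case False
    then have "a = 0" using b by simp
    moreover from this have "c = 0" using L_zero_scalars(1)[OF r] b by simp
    ultimately show ?thesis using braiding_symmetric_if[of e] r \<open>e \<noteq> 0\<close> by simp
  qed
qed

text \<open>Stacking \<open>H\<close> and antisymmetrizing leads to the antisymmetric case. The new
  crossing coefficient \<open>- \<beta> * (e + e)\<close> is nonzero, so the new relation is not
  trivial.\<close>

lemma relation_sym:
  assumes r: "L a a c c e e = zer 2 2" and nz: "a \<noteq> 0 \<or> c \<noteq> 0 \<or> e \<noteq> 0"
  shows "swp' 1 1 = swp 1 1"
proof (cases "e = 0")
  case True
  then show ?thesis using relation_sym_uncrossed r nz by simp
next
  case False
  then have "- \<beta> * (e + e) \<noteq> 0" using beta_nonzero by simp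
  then show ?thesis using relation_anti[OF H_antisymmetrized[OF r]] by blast
qed

lemma relation_symmetric_braiding:
  assumes r: "L x1 x2 x3 x4 x5 x6 = zer 2 2"
    and nz: "x1 \<noteq> 0 \<or> x2 \<noteq> 0 \<or> x3 \<noteq> 0 \<or> x4 \<noteq> 0 \<or> x5 \<noteq> 0 \<or> x6 \<noteq> 0"
  shows "swp' 1 1 = swp 1 1"
proof -
  have r': "L x2 x1 x4 x3 x6 x5 = zer 2 2"
    using L_rot[of x1 x2 x3 x4 x5 x6] r rot_linear(3) by simp
  have p: "L (x1 + x2) (x1 + x2) (x3 + x4) (x3 + x4) (x5 + x6) (x5 + x6) = zer 2 2"
    using L_lin[OF r r', of 1 1] by (simp add: add.commute)
  have m: "L (x1 - x2) (- (x1 - x2)) (x3 - x4) (- (x3 - x4)) (x5 - x6) (- (x5 - x6)) = zer 2 2"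
    using L_lin[OF r r', of 1 "- 1"] by simp
  have "x = 0" if "x + y = 0" "x - y = 0" for x y :: complex
    using that by (metis add_cancel_right_left eq_iff_diff_eq_0 mult_2 mult_eq_0_iff zero_neq_numeral)
  \<comment> \<open>If the sum and the difference with the rotated relation were both trivial, all
    six coefficients would vanish.\<close>
  then have "\<not> (x1 + x2 = 0 \<and> x3 + x4 = 0 \<and> x5 + x6 = 0 \<and> x1 - x2 = 0 \<and> x3 - x4 = 0 \<and> x5 - x6 = 0)"
    using nz by (metis add_0)
  then show ?thesis using relation_sym[OF p] relation_anti[OF m] by blast
qed

text \<open>With equal crossings \<open>H_swp'\<close> and \<open>H_swp\<close> have the same left
  side. For \<open>\<beta> = w * w - w\<close> every coefficient of the difference of their right
  sides is \<open>\<beta>\<close> or \<open>- \<beta>\<close>, and dividing by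
  \<open>\<beta>\<close> gives the defining relation.\<close>

lemma I_plus_H:
  assumes s: "swp' 1 1 = swp 1 1"
  shows "I \<boxplus> H = 2 \<Odot> swp 1 1 \<boxplus> (- 1) \<Odot> idn 2 \<boxplus> (- 1) \<Odot> U"
proof -
  have "L (- \<beta> * (w * w)) (- \<beta> * w) (- w) (w * w) (- \<beta>) 0 = L (\<beta> * w) (\<beta> * (w * w)) (- (w * w)) w 0 \<beta>"
    using H_swp H_swp' s by simp
  then have "L (- \<beta> * (w * w)) (- \<beta> * w) (- w) (w * w) (- \<beta>) 0 \<boxplus>
      (- 1) \<Odot> L (\<beta> * w) (\<beta> * (w * w)) (- (w * w)) w 0 \<beta> = L 0 0 0 0 0 0" (is "_ = ?z")
    by (simp add: L_scl L_pls)
  then have 1: "L (- \<beta> * (w * w) - \<beta> * w) (- \<beta> * w - \<beta> * (w * w)) (- w + w * w) (w * w - w) (- \<beta>) (- \<beta>) = zer 2 2"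
    by (simp add: L_scl L_pls L_def[of 0 0 0 0 0 0])
  have c: "- \<beta> * (w * w) - \<beta> * w = \<beta>" "- \<beta> * w - \<beta> * (w * w) = \<beta>" "- w + w * w = \<beta>" "w * w - w = \<beta>"
    using cube_root_beta[OF w beta] beta by simp_all
  have "L 1 1 1 1 (- 1) (- 1) = zer 2 2"
    using 1 L_scl[of "inverse \<beta>" \<beta> \<beta> \<beta> \<beta> "- \<beta>" "- \<beta>"] beta_nonzero unfolding c by simp
  then have z: "L 1 1 1 1 0 (- 2) = zer 2 2"
    unfolding L_def s by (simp add: scl_add[symmetric])
  have "I \<boxplus> H = L 0 0 1 1 0 0" by (simp add: L_def)
  also have "\<dots> = L 1 1 1 1 0 (- 2) \<boxplus> L (- 1) (- 1) 0 0 0 2" by (simp add: L_pls)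
  also have "\<dots> = 2 \<Odot> swp 1 1 \<boxplus> (- 1) \<Odot> idn 2 \<boxplus> (- 1) \<Odot> U"
    unfolding z by (simp add: L_def pls_ac)
  finally show ?thesis .
qed

end

end

section \<open>Symmetry, twists and the interpretation of diagrams\<close>

text \<open>The vertex stays fixed. \<open>mrg\<close> contains one \<open>cup\<close> and
  \<open>spl\<close> two, so \<open>H\<close> and \<open>I\<close> scale by
  \<open>1 / k ^ 3\<close>, while \<open>U\<close>, \<open>d\<close> and the crossings do not
  change. Dividing \<open>qe\<close> by \<open>k ^ 3\<close> restores its shape with a new
  \<open>\<beta>\<close>.\<close>

lemma (in qe_pro) rescaled:
  assumes k: "k \<noteq> 0"
  shows "qe_pro ok src tgt cmp tns idn zer pls scl swp swp' (k \<Odot> cap) (inverse k \<Odot> cup) vtx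
    d (b / k ^ 3) (t / k ^ 3) w (\<beta> / k ^ 3)"
proof -
  interpret V: vertex_pro ok src tgt cmp tns idn zer pls scl swp swp' "k \<Odot> cap" "inverse k \<Odot> cup" vtx
    by unfold_locales (use k zigzag in simp_all)
  have m: "V.mrg = inverse k \<Odot> mrg" by (simp add: V.mrg_def mrg_def)
  have s: "V.spl = (inverse k ^ 2) \<Odot> spl" by (simp add: V.spl_def spl_def m power2_eq_square)
  have H: "V.H = (1 / k ^ 3) \<Odot> H"
    by (simp add: V.H_def H_def m s power2_eq_square power3_eq_cube divide_inverse mult_ac)
  have I: "V.I = (1 / k ^ 3) \<Odot> I"
    by (simp add: V.I_def I_def m s power2_eq_square power3_eq_cube divide_inverse mult_ac)
  have U: "V.U = U" using k by (simp add: V.U_def U_def)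
  show ?thesis
  proof unfold_locales
    show "V.mrg \<star> V.spl = (b / k ^ 3) \<Odot> idn 1"
      by (simp add: m s bigon power2_eq_square power3_eq_cube divide_inverse mult_ac)
    show "(k \<Odot> cap) \<star> (inverse k \<Odot> cup) = d \<Odot> idn 0"
      using k by (simp add: cap_cup field_simps)
    show "V.mrg \<star> (inverse k \<Odot> cup) = zer 0 1" by (simp add: m lollipop)
    show "V.H \<star> V.spl = (t / k ^ 3) \<Odot> V.spl" by (simp add: s H triangle divide_inverse mult_ac)
    show "\<exists>r. x = r \<Odot> k \<Odot> cap" if "ok x" "src x = 2" "tgt x = 0" for x
    proof -
      have "\<exists>r. x = r \<Odot> cap" using dim2 that by blast
      then obtain r where "x = r \<Odot> cap" by blast
      then have "x = (r / k) \<Odot> k \<Odot> cap" using k by simp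
      then show ?thesis by blast
    qed
    have "(1 / k ^ 3) \<Odot> (H \<star> swp' 1 1 \<boxplus> (w \<Odot> I \<boxplus> ((- (w * w)) \<Odot> H \<boxplus>
        \<beta> \<Odot> (swp' 1 1 \<boxplus> (w \<Odot> U \<boxplus> (w * w) \<Odot> idn 2))))) = zer 2 2"
      unfolding qe by simp
    then show "V.H \<star> swp' 1 1 \<boxplus> (w \<Odot> V.I \<boxplus> ((- (w * w)) \<Odot> V.H \<boxplus>
        (\<beta> / k ^ 3) \<Odot> (swp' 1 1 \<boxplus> (w \<Odot> V.U \<boxplus> (w * w) \<Odot> idn 2)))) = zer 2 2"
      by (simp add: U I H scl_pls mult_ac)
  qed (use k d b idn_0 swp'_cup swp'_spl dim3 w in \<open>simp_all add: s\<close>)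
qed

section \<open>Symmetry and twists on all powers\<close>

context strict_braided_pro
begin

text \<open>The hexagons build every crossing from crossings of single strands; the innermost pair
  cancels first, by induction on each number of strands.\<close>

lemma symmetric_if:
  assumes "swp 1 1 \<star> swp 1 1 = idn 2"
  shows "swp b a \<star> swp a b = idn (a + b)"
proof -
  have 1: "swp n 1 \<star> swp 1 n = idn (1 + n)" for n
  proof (induction n)
    case (Suc n)
    have "swp 1 (Suc n) = (idn n \<diamondop> swp 1 1) \<star> (swp 1 n \<diamondop> idn 1)"
      "swp (Suc n) 1 = (swp n 1 \<diamondop> idn 1) \<star> (idn n \<diamondop> swp 1 1)"
      using hexagon_right[of 1 n 1] hexagon_left[of n 1 1] by simp_all
    then have "swp (Suc n) 1 \<star> swp 1 (Suc n) =
        (swp n 1 \<diamondop> idn 1) \<star> ((idn n \<diamondop> (swp 1 1 \<star> swp 1 1)) \<star> (swp 1 n \<diamondop> idn 1))"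
      by (simp add: whisk_l)
    also have "\<dots> = (swp n 1 \<star> swp 1 n) \<diamondop> idn 1" unfolding assms by (simp add: whisk_r)
    finally show ?case unfolding Suc.IH by simp
  qed simp
  show ?thesis
  proof (induction a)
    case (Suc a)
    have "swp (Suc a) b = (swp a b \<diamondop> idn 1) \<star> (idn a \<diamondop> swp 1 b)"
      "swp b (Suc a) = (idn a \<diamondop> swp b 1) \<star> (swp b a \<diamondop> idn 1)"
      using hexagon_left[of a 1 b] hexagon_right[of b a 1] by simp_all
    then have "swp b (Suc a) \<star> swp (Suc a) b =
        (idn a \<diamondop> swp b 1) \<star> (((swp b a \<star> swp a b) \<diamondop> idn 1) \<star> (idn a \<diamondop> swp 1 b))"
      by (simp add: whisk_r)
    also have "\<dots> = idn a \<diamondop> (swp b 1 \<star> swp 1 b)" unfolding Suc.IH by (simp add: whisk_l)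
    finally show ?case unfolding 1 by simp
  qed simp
qed

end

locale twisted_pro = strict_braided_pro +
  fixes tw :: "nat \<Rightarrow> 'a"
  assumes tw_simps [simp]: "ok (tw n)" "src (tw n) = n" "tgt (tw n) = n"
    and tw_natural: "ok x \<Longrightarrow> tw (tgt x) \<star> x = x \<star> tw (src x)"
    and tw_balancing: "tw (a + b) = swp b a \<star> (swp a b \<star> (tw a \<diamondop> tw b))"
    and tw_inverse: "\<exists>y. ok y \<and> src y = n \<and> tgt y = n \<and> y \<star> tw n = idn n"
begin

lemma tw_zero: "tw 0 = idn 0"
proof -
  obtain y where y: "ok y" "src y = 0" "tgt y = 0" "y \<star> tw 0 = idn 0" using tw_inverse by blast
  have "tw 0 \<diamondop> tw 0 = (tw 0 \<diamondop> idn 0) \<star> (idn 0 \<diamondop> tw 0)" by (subst inter) simp_all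
  then have "tw 0 = tw 0 \<star> tw 0" using tw_balancing[of 0 0] by simp
  then have "idn 0 = y \<star> (tw 0 \<star> tw 0)" using y by simp
  also have "\<dots> = y \<star> tw 0 \<star> tw 0" using y by (subst cmp_assoc) simp_all
  finally show ?thesis unfolding y(4) by simp
qed

lemma tw_trivial_if:
  assumes sym: "\<And>a b. swp b a \<star> swp a b = idn (a + b)" and "tw 1 = idn 1"
  shows "tw n = idn n"
proof (induction n)
  case 0
  show ?case by (rule tw_zero)
next
  case (Suc n)
  have "tw (Suc n) = swp 1 n \<star> swp n 1 \<star> (tw n \<diamondop> tw 1)" using tw_balancing[of n 1] by simp
  then show ?case unfolding sym Suc.IH assms(2) by simp
qed

end

locale twisted_qe_pro = qe_pro + twisted_pro
begin

lemma tw_trivial: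
  assumes "swp 1 1 \<star> swp 1 1 = idn 2"
  shows "tw n = idn n"
proof -
  note sym = symmetric_if[OF assms]
  \<comment> \<open>Bending carries an endomorphism of one strand into the line \<open>C(2)\<close>,
    so the twist is a scalar \<open>z\<close>.\<close>
  obtain z where z: "bend 0 (tw 1) = z \<Odot> cap" using dim2[of "bend 0 (tw 1)"] by auto
  also have "\<dots> = bend 0 (z \<Odot> idn 1)" by (simp add: bend_def numeral_2_eq_2)
  finally have tw1: "tw 1 = z \<Odot> idn 1" by (rule bend_inj) simp_all
  have "tw 2 = swp 1 1 \<star> swp 1 1 \<star> (tw 1 \<diamondop> tw 1)" using tw_balancing[of 1 1] by (simp add: numeral_2_eq_2)
  then have tw2: "tw 2 = (z * z) \<Odot> idn 2" unfolding sym tw1 by (simp add: numeral_2_eq_2)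
  have "tw 3 = swp 1 2 \<star> swp 2 1 \<star> (tw 2 \<diamondop> tw 1)" using tw_balancing[of 2 1] by (simp add: numeral_2_eq_2 numeral_3_eq_3)
  then have tw3: "tw 3 = (z * z * z) \<Odot> idn 3" unfolding sym tw1 tw2 by (simp add: numeral_3_eq_3 mult.assoc)
  have "(z * z) \<Odot> cup = 1 \<Odot> cup" using tw_natural[of cup] tw2 tw_zero by simp
  then have zz: "z * z = 1" using cup_nonzero by (intro scl_inj[of _ cup]) simp_all
  have "(z * z * z) \<Odot> vtx = 1 \<Odot> vtx" using tw_natural[of vtx] tw3 tw_zero by simp
  then have "z * z * z = 1" using vtx_nonzero by (intro scl_inj[of _ vtx]) simp_all
  then have "z = 1" unfolding zz by simp
  then have "tw 1 = idn 1" using tw1 by simp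
  then show ?thesis by (rule tw_trivial_if[OF sym])
qed

end

text \<open>The relations of \<open>g2_eq\<close> that are not yet available in every
  \<open>vertex_pro\<close>.\<close>

locale g2_pro = vertex_pro +
  fixes d :: complex
  assumes sym: "swp b a \<star> swp a b = idn (a + b)"
    and cap_swp: "cap \<star> swp 1 1 = cap"
    and vtx_rotation: "cap \<star> ((idn 1 \<diamondop> vtx \<diamondop> idn 1) \<star> (idn 3 \<diamondop> cup)) = vtx"
    and circle: "cap \<star> cup = d \<Odot> idn 0"
    and swp_cup: "swp 1 1 \<star> cup = cup"
    and swp_spl: "swp 1 1 \<star> spl = (- 1) \<Odot> spl"
    and lollipop: "mrg \<star> cup = zer 0 1"
    and bigon: "mrg \<star> spl = (1 - d) \<Odot> idn 1"
    and triangle: "H \<star> spl = (d - 4) \<Odot> spl"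
    and I_H: "I \<boxplus> H = 2 \<Odot> swp 1 1 \<boxplus> (- 1) \<Odot> idn 2 \<boxplus> (- 1) \<Odot> U"

section \<open>Interpretation of diagram expressions\<close>

context vertex_pro
begin

primrec interp :: "diagram \<Rightarrow> 'a" where
  "interp (DId n) = idn n"
| "interp (f \<circ>\<^sub>D g) = interp f \<star> interp g"
| "interp (f \<otimes>\<^sub>D g) = interp f \<diamondop> interp g"
| "interp (DZero a b) = zer a b"
| "interp (f +\<^sub>D g) = interp f \<boxplus> interp g"
| "interp (r *\<^sub>D f) = r \<Odot> interp f"
| "interp (DSwap a b) = swp a b"
| "interp DCap = cap"
| "interp DCup = cup"
| "interp DVertex = vtx"

lemma interp_typed: "typed f a b \<Longrightarrow> ok (interp f) \<and> src (interp f) = a \<and> tgt (interp f) = b"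
  by (induction rule: typed.induct) auto

lemma interp_diagrams: "interp d_merge = mrg" "interp d_split = spl" "interp d_H = H" "interp d_I = I"
  "interp d_U = U"
  by (simp_all add: d_defs mrg_def spl_def H_def I_def U_def)

end

lemma (in g2_pro) interp_respects: "g2_eq d a b f g \<Longrightarrow> interp f = interp g"
proof (induction rule: g2_eq.induct)
  case rotation
  show ?case using vtx_rotation by (simp add: d_rotated_vertex_def del: One_nat_def)
next
  case (swap_natural f a b g a' b')
  then show ?case using interp_typed[OF swap_natural(1)] interp_typed[OF swap_natural(2)]
      swp_natural[of "interp f" "interp g"] by simp
next
  case (swap_hexagon a b c)
  show ?case by (simp add: hexagon_left)
qed (auto dest!: interp_typed simp: interp_diagrams sym cap_swp circle swp_cup swp_spl lollipop bigon triangle I_H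
    zigzag pls_ac scl_add scl_pls cmp_pls tns_pls tns_assoc inter
    simp del: One_nat_def)

lemma (in normalized_qe_pro) g2_pro:
  assumes "swp' 1 1 = swp 1 1"
  shows "g2_pro ok src tgt cmp tns idn zer pls scl swp swp' cap cup vtx d"
proof unfold_locales
  have "swp' 1 1 \<star> swp 1 1 = idn (1 + 1)" by (rule swp_inverse)
  then have "swp 1 1 \<star> swp 1 1 = idn 2" unfolding assms one_add_one .
  then show "swp b a \<star> swp a b = idn (a + b)" for a b by (rule symmetric_if)
qed (use cap_swp rotation cap_cup swp_cup swp_spl lollipop bigon triangle I_plus_H[OF assms]
    in \<open>simp_all only: b_value t_value\<close>)

text \<open>Stated for a family rather than a set, because the diagrams to which it is applied might
  coincide as morphisms; \<open>{..n}\<close> has \<open>n + 1\<close> elements. An injective family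
  reduces to linear dependence of its image.\<close>

lemma (in vectorspace) relation_if_exceeds_dim:
  fixes f :: "nat \<Rightarrow> 'c"
  assumes fd: "fin_dim" and n: "dim \<le> n" and f: "f \<in> {..n} \<rightarrow> carrier V"
  shows "\<exists>w. w \<in> UNIV \<rightarrow> carrier K \<and> (\<exists>i\<le>n. w i \<noteq> \<zero>\<^bsub>K\<^esub>) \<and> (\<Oplus>\<^bsub>V\<^esub>i\<in>{..n}. w i \<odot>\<^bsub>V\<^esub> f i) = \<zero>\<^bsub>V\<^esub>"
proof (cases "inj_on f {..n}")
  case True
  have fA: "f ` {..n} \<subseteq> carrier V" using f by auto
  have "card (f ` {..n}) = Suc n" using True by (simp add: card_image)
  then have "lin_dep (f ` {..n})" using li_le_dim(2)[OF fd fA] n by linarith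
  then obtain A a v where A: "finite A" "A \<subseteq> f ` {..n}" "a \<in> A \<rightarrow> carrier K"
      "lincomb a A = \<zero>\<^bsub>V\<^esub>" "v \<in> A" "a v \<noteq> \<zero>\<^bsub>K\<^esub>"
    unfolding lin_dep_def by blast
  define w where "w i = (if i \<le> n \<and> f i \<in> A then a (f i) else \<zero>\<^bsub>K\<^esub>)" for i
  define B where "B = {i \<in> {..n}. f i \<in> A}"
  have fB: "A = f ` B" using A(2) by (auto simp: B_def)
  have B: "B \<subseteq> {..n}" by (auto simp: B_def)
  have w: "w \<in> UNIV \<rightarrow> carrier K" using A(3) by (auto simp: w_def)
  have "(\<Oplus>\<^bsub>V\<^esub>i\<in>{..n}. w i \<odot>\<^bsub>V\<^esub> f i) = (\<Oplus>\<^bsub>V\<^esub>i\<in>B. w i \<odot>\<^bsub>V\<^esub> f i)"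
  proof (rule M.add.finprod_mono_neutral_cong[symmetric])
    show "w i \<odot>\<^bsub>V\<^esub> f i = \<zero>\<^bsub>V\<^esub>" if "i \<in> {..n} - B" for i
      using that Pi_mem[OF f, of i] by (auto simp: w_def B_def)
    show "(\<lambda>i. w i \<odot>\<^bsub>V\<^esub> f i) \<in> B \<rightarrow> carrier V" "(\<lambda>i. w i \<odot>\<^bsub>V\<^esub> f i) \<in> {..n} \<rightarrow> carrier V"
      using w f B by (auto intro!: smult_closed)
  qed (use B in \<open>auto intro: finite_subset\<close>)
  also have "\<dots> = (\<Oplus>\<^bsub>V\<^esub>i\<in>B. a (f i) \<odot>\<^bsub>V\<^esub> f i)"
    using A(3) f by (intro M.finsum_cong') (auto simp: w_def B_def intro!: smult_closed)
  also have "\<dots> = (\<Oplus>\<^bsub>V\<^esub>v\<in>A. a v \<odot>\<^bsub>V\<^esub> v)"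
    unfolding fB
    by (rule M.finsum_reindex[symmetric]) (use A(3) f B inj_on_subset[OF True B] in \<open>auto simp: fB intro!: smult_closed\<close>)
  also have "\<dots> = \<zero>\<^bsub>V\<^esub>" using A(4) by (simp add: lincomb_def)
  finally have "(\<Oplus>\<^bsub>V\<^esub>i\<in>{..n}. w i \<odot>\<^bsub>V\<^esub> f i) = \<zero>\<^bsub>V\<^esub>" .
  moreover obtain i where "i \<le> n" "v = f i" using A(2,5) by auto
  then have "\<exists>i\<le>n. w i \<noteq> \<zero>\<^bsub>K\<^esub>" using A(5,6) by (auto simp: w_def)
  ultimately show ?thesis using w by blast
next
  case False
  then obtain i j where ij: "i \<le> n" "j \<le> n" "i \<noteq> j" "f i = f j" by (auto simp: inj_on_def)
  \<comment> \<open>A repeated vector gives the relation \<open>f i - f j = 0\<close>.\<close>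
  define w where "w k = (if k = i then \<one>\<^bsub>K\<^esub> else if k = j then \<ominus>\<^bsub>K\<^esub> \<one>\<^bsub>K\<^esub> else \<zero>\<^bsub>K\<^esub>)" for k
  have w: "w \<in> UNIV \<rightarrow> carrier K" by (auto simp: w_def)
  have fi: "f i \<in> carrier V" using f ij by auto
  have "(\<Oplus>\<^bsub>V\<^esub>k\<in>{..n}. w k \<odot>\<^bsub>V\<^esub> f k) = (\<Oplus>\<^bsub>V\<^esub>k\<in>{i, j}. w k \<odot>\<^bsub>V\<^esub> f k)"
  proof (rule M.add.finprod_mono_neutral_cong[symmetric])
    show "w k \<odot>\<^bsub>V\<^esub> f k = \<zero>\<^bsub>V\<^esub>" if "k \<in> {..n} - {i, j}" for k
      using that Pi_mem[OF f, of k] by (auto simp: w_def)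
    show "(\<lambda>k. w k \<odot>\<^bsub>V\<^esub> f k) \<in> {i, j} \<rightarrow> carrier V" "(\<lambda>k. w k \<odot>\<^bsub>V\<^esub> f k) \<in> {..n} \<rightarrow> carrier V"
      using w f ij by (auto intro!: smult_closed)
  qed (use ij in auto)
  also have "\<dots> = \<one>\<^bsub>K\<^esub> \<odot>\<^bsub>V\<^esub> f i \<oplus>\<^bsub>V\<^esub> (\<ominus>\<^bsub>K\<^esub> \<one>\<^bsub>K\<^esub>) \<odot>\<^bsub>V\<^esub> f i"
  proof -
    have "w j \<odot>\<^bsub>V\<^esub> f j \<in> carrier V" "w i \<odot>\<^bsub>V\<^esub> f i \<in> carrier V" using w fi ij by (auto intro!: smult_closed)
    then show ?thesis using ij by (simp add: w_def)
  qed
  also have "\<dots> = \<zero>\<^bsub>V\<^esub>" using fi by (simp add: smult_l_minus M.r_neg)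
  finally show ?thesis using w ij(1) by (intro exI[of _ w]) (auto simp: w_def)
qed

lemma (in vectorspace) basis_singleton:
  assumes "basis {e}"
  shows "e \<noteq> \<zero>\<^bsub>V\<^esub>" "x \<in> carrier V \<Longrightarrow> \<exists>r\<in>carrier K. x = r \<odot>\<^bsub>V\<^esub> e"
proof -
  have e: "e \<in> carrier V" and li: "lin_indpt {e}" and sp: "span {e} = carrier V"
    using assms by (auto simp: basis_def)
  show "e \<noteq> \<zero>\<^bsub>V\<^esub>" using zero_nin_lin_indpt[of "{e}"] e li carrier_one_not_zero by auto
  assume "x \<in> carrier V"
  then obtain a where a: "a \<in> {e} \<rightarrow> carrier K" "x = lincomb a {e}"
    using finite_span[of "{e}"] e sp by auto
  then have "x = a e \<odot>\<^bsub>V\<^esub> e" using e by (simp add: lincomb_def)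
  then show "\<exists>r\<in>carrier K. x = r \<odot>\<^bsub>V\<^esub> e" using a by auto
qed

section \<open>Twists of the powers of \<open>X\<close>\<close>

locale ribbon_object = braided_object C X + ribbon_category C
  for C :: "('o, 'm) cat_data" (structure) and X
begin

definition atw where "atw a = (a, a, twist C a)"
definition ptw where "ptw n = (n, n, twist C (P n))"

lemma atw_simps [simp]: "src_of (atw a) = a" "tgt_of (atw a) = a" "arr (atw a)"
  using is_iso_inv_mor[OF twist_iso[of a]] by (simp_all add: atw_def arr_def inverse_pair_def)

lemma ptw_simps [simp]: "src_of (ptw n) = n" "tgt_of (ptw n) = n" "lift (ptw n) = atw (P n)"
  by (simp_all add: ptw_def atw_def lift_def)

lemma atw_natural: "arr x \<Longrightarrow> atw (tgt_of x) \<Zcomp> x = x \<Zcomp> atw (src_of x)"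
  by (simp add: atw_def adefs twist_natural)

lemma atw_balancing: "atw (a \<boxdot> b) = abraid b a \<Zcomp> (abraid a b \<Zcomp> (atw a \<Otimes> atw b))"
proof -
  have "atw (a \<boxdot> b) = abraid b a \<Zcomp> abraid a b \<Zcomp> (atw a \<Otimes> atw b)"
    by (simp add: atw_def abraid_def adefs balancing)
  then show ?thesis by simp
qed

sublocale twisted_pro pok src_of tgt_of pcmp ptns pidn pzer ppls pscl pswp pswp' ptw
proof
  show "pok (ptw n)" for n by (simp add: pok_def)
  fix x assume "pok x"
  then show "pcmp (ptw (tgt_of x)) x = pcmp x (ptw (src_of x))"
    using atw_natural[of "lift x"] by (intro lift_eqI) (simp_all add: pok_def)
next
  fix a b
  have "lift (pcmp (pswp b a) (pcmp (pswp a b) (ptns (ptw a) (ptw b)))) =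
      join a b \<Zcomp> (abraid (P b) (P a) \<Zcomp> (abraid (P a) (P b) \<Zcomp> (atw (P a) \<Otimes> atw (P b)))) \<Zcomp> join' a b"
    by (simp add: add.commute)
  also have "\<dots> = (join a b \<Zcomp> atw (P a \<boxdot> P b)) \<Zcomp> join' a b"
    unfolding atw_balancing[symmetric] by simp
  also have "join a b \<Zcomp> atw (P a \<boxdot> P b) = atw (P (a + b)) \<Zcomp> join a b"
    using atw_natural[of "join a b"] by simp
  finally show "ptw (a + b) = pcmp (pswp b a) (pcmp (pswp a b) (ptns (ptw a) (ptw b)))"
    by (intro lift_eqI) simp_all
next
  fix n
  let ?i = "inv_mor C (P n) (P n) (twist C (P n))"
  have i: "inverse_pair C (P n) (P n) (twist C (P n)) ?i" by (rule is_iso_inv_mor[OF twist_iso])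
  have "pok (n, n, ?i)" using i by (simp add: pok_def lift_def arr_def inverse_pair_def)
  moreover have "pcmp (n, n, ?i) (ptw n) = pidn n"
    using i by (simp add: pcmp_def pidn_def ptw_def aid_def acomp_def lift_def inverse_pair_def)
  ultimately show "\<exists>y. pok y \<and> src_of y = n \<and> tgt_of y = n \<and> pcmp y (ptw n) = pidn n"
    by (intro exI[of _ "(n, n, ?i)"]) simp
qed simp_all

end

context monoidal_object
begin

lemma pok_iff: "pok (a, b, f) \<longleftrightarrow> f \<in> Mor C (P a) (P b)"
  by (simp add: pok_def lift_def arr_def)

lemma pro_triples:
  "ppls (a, b, f) (a, b, g) = (a, b, f \<oplus>\<^bsub>Hom C (P a) (P b)\<^esub> g)"
  "pscl r (a, b, f) = (a, b, r \<odot>\<^bsub>Hom C (P a) (P b)\<^esub> f)"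
  "pcmp (b, c, f) (a, b, g) = (a, c, f \<cdot> g)" "pidn a = (a, a, ident C (P a))"
  "pzer a b = (a, b, \<zero>\<^bsub>Hom C (P a) (P b)\<^esub>)"
  by (simp_all add: ppls_def pscl_def pcmp_def pidn_def pzer_def lift_def adefs alinear_defs)

lemma join'_eqI: "x \<Zcomp> join a b = aid (P a \<boxdot> P b) \<Longrightarrow> arr x \<Longrightarrow> src_of x = P (a + b) \<Longrightarrow> tgt_of x = P a \<boxdot> P b \<Longrightarrow>
    join' a b = x"
  by (metis acomp_aid(1,2) acomp_assoc join_arr join_ends join_inverse(1))

text \<open>For small powers the joins are identities, unit constraints and inverse associators.
  These are the values needed to recognize the bracketed definitions of \<open>merge_mor\<close>,
  \<open>split_mor\<close> and \<open>H_mor\<close>.\<close>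

lemma small_joins:
  "join 0 1 = alunit X" "join 1 0 = arunit X" "join 1 1 = aid (X \<boxdot> X)" "join 2 1 = aid (X \<boxdot> X \<boxdot> X)"
  "join 3 1 = aid (X \<boxdot> X \<boxdot> X \<boxdot> X)"
  "join 1 2 = aassoc' X X X" "join 2 2 = aassoc' (X \<boxdot> X) X X" "join 2 0 = arunit (X \<boxdot> X)"
  using join_one[of 0] join_one[of 1] join_one[of 2] join_one[of 3]
  by (simp_all add: step_def step'_def numeral_2_eq_2 numeral_3_eq_3 del: join.simps(2)) (simp_all add: step_def step'_def)

lemma small_joins':
  "join' 0 1 = alunit' X" "join' 1 0 = arunit' X" "join' 1 1 = aid (X \<boxdot> X)" "join' 2 1 = aid (X \<boxdot> X \<boxdot> X)"
  "join' 3 1 = aid (X \<boxdot> X \<boxdot> X \<boxdot> X)"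
  "join' 1 2 = aassoc X X X" "join' 2 2 = aassoc (X \<boxdot> X) X X" "join' 2 0 = arunit' (X \<boxdot> X)"
  by (rule join'_eqI, unfold small_joins; simp add: numeral_2_eq_2 numeral_3_eq_3)+

end

section \<open>The functor from \<open>G2(d)\<close>\<close>

lemma (in linear_monoidal_category) und_simps:
  "und (x \<Zcomp> y) = und x \<cdot> und y" "und (x \<Otimes> y) = und x \<boxtimes> und y" "und (aid a) = ident C a"
  "und (aassoc a b c) = assoc C a b c" "und (alunit a) = lunit C a" "und (arunit a) = runit C a"
  by (simp_all add: adefs)

lemma (in linear_braided_category) und_abraid: "und (abraid a b) = braid C a b"
  by (simp add: abraid_def)

context ribbon_object
begin

text \<open>The functor sends \<open>n\<close> to \<open>P n\<close> and has \<open>join\<close> as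
  its tensor constraint, so its coherence axioms are \<open>join_assoc\<close>,
  \<open>join_zero_left\<close> and the value of \<open>join\<close> at 0.\<close>

lemma G2_algebra_objectI:
  assumes g2: "g2_pro pok src_of tgt_of pcmp ptns pidn pzer ppls pscl pswp pswp' (2, 0, e) (0, 2, k) (3, 0, \<tau>) d"
    and tw: "\<And>n. ptw n = pidn n" and sym: "symmetric_braiding C"
  shows "G2_algebra_object C X e k \<tau> d"
proof -
  interpret G: g2_pro pok src_of tgt_of pcmp ptns pidn pzer ppls pscl pswp pswp' "(2, 0, e)" "(0, 2, k)" "(3, 0, \<tau>)" d
    by (rule g2)
  let ?Cl = "g2_class d"
  \<comment> \<open>The representative of the class does not matter, by
    \<open>interp_respects\<close>.\<close>
  define Fm where "Fm F = und (G.interp (SOME f. f \<in> F))" for F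
  define J where "J a b = und (join a b)" for a b
  have Fm: "Fm (?Cl f) = und (G.interp f)" if "typed f a b" for f a b
  proof -
    have "(SOME g. g \<in> ?Cl f) \<in> ?Cl f" using g2_class_self[OF that] by (rule someI)
    then show ?thesis using G.interp_respects[OF g2_class_memE[OF _ that]] by (simp add: Fm_def)
  qed
  have arr: "arr (lift (G.interp f))" "src_of (G.interp f) = a" "tgt_of (G.interp f) = b" if "typed f a b" for f a b
    using G.interp_typed[OF that] by (simp_all add: pok_def)
  have Mor: "Fm F \<in> Mor C (P a) (P b)" if "F \<in> Mor (G2 d) a b" for F a b
    using that arr by (auto simp: Mor_G2 Fm arr_def)
  have FId: "Fm (?Cl (DId a)) = ident C (P a)" for a
    using Fm[OF typed.intros(1)[of a]] by (simp add: pidn_def und_simps)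
  have func: "ribbon_functor (G2 d) C P Fm (ident C (unit_ob C)) J"
  proof (intro ribbon_functor.intro ribbon_functor_axioms.intro)
    show "ribbon_category (G2 d)" using G2_symmetric_ribbon by (rule symmetric_ribbon_category.axioms)
    show "ribbon_category C" by (rule ribbon_category_axioms)
    show "Fm \<in> module_hom class_ring (Hom (G2 d) a b) (Hom C (P a) (P b))" for a b
    proof -
      have "Fm (F \<oplus>\<^bsub>Hom (G2 d) a b\<^esub> G) = Fm F \<oplus>\<^bsub>Hom C (P a) (P b)\<^esub> Fm G"
        if FG: "F \<in> Mor (G2 d) a b" "G \<in> Mor (G2 d) a b" for F G
      proof -
        obtain f g where f: "F = ?Cl f" "typed f a b" and g: "G = ?Cl g" "typed g a b"
          using FG by (auto simp: Mor_G2)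
        then show ?thesis
          using Fm[OF f(2)] Fm[OF g(2)] Fm[OF typed.intros(5)[OF f(2) g(2)]] arr[OF f(2)]
          by (simp add: add_g2_class ppls_def apls_def)
      qed
      moreover have "Fm (r \<odot>\<^bsub>Hom (G2 d) a b\<^esub> F) = r \<odot>\<^bsub>Hom C (P a) (P b)\<^esub> Fm F" if F: "F \<in> Mor (G2 d) a b" for r F
      proof -
        obtain f where f: "F = ?Cl f" "typed f a b" using F by (auto simp: Mor_G2)
        then show ?thesis
          using Fm[OF f(2)] Fm[OF typed.intros(6)[OF f(2)], of r] arr[OF f(2)]
          by (simp add: smult_g2_class pscl_def ascl_def)
      qed
      ultimately show ?thesis
        unfolding LinearCombinations.module_hom_def using Mor by auto
    qed
    show "Fm (ident (G2 d) a) = ident C (P a)" for a by (simp add: G2_simps FId)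
    show "Fm (F \<cdot>\<^bsub>G2 d\<^esub> G) = Fm F \<cdot> Fm G" if FG: "F \<in> Mor (G2 d) b c" "G \<in> Mor (G2 d) a b" for F G a b c
    proof -
      obtain f g where f: "F = ?Cl f" "typed f b c" and g: "G = ?Cl g" "typed g a b"
        using FG by (auto simp: Mor_G2)
      then show ?thesis
        using Fm[OF f(2)] Fm[OF g(2)] Fm[OF typed.intros(2)[OF f(2) g(2)]]
        by (simp add: comp_g2_class pcmp_def und_simps)
    qed
    show "is_iso C (unit_ob C) (P (unit_ob (G2 d))) (ident C (unit_ob C))"
      using ident_closed ident_comp[OF ident_closed] by (auto simp: G2_simps is_iso_def inverse_pair_def)
    show "is_iso C (P a \<boxdot> P b) (P (a \<boxdot>\<^bsub>G2 d\<^esub> b)) (J a b)" for a b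
    proof -
      have "inverse_pair C (P a \<boxdot> P b) (P (a + b)) (J a b) (und (join' a b))"
        using join_arr[of a b] arg_cong[OF join_inverse(1), of und, unfolded und_simps]
          arg_cong[OF join_inverse(2), of und, unfolded und_simps]
        by (simp add: inverse_pair_def J_def arr_def)
      then show ?thesis by (auto simp: is_iso_def G2_simps)
    qed
    show "Fm (F \<boxtimes>\<^bsub>G2 d\<^esub> G) \<cdot> J a b = J a' b' \<cdot> (Fm F \<boxtimes> Fm G)"
      if FG: "F \<in> Mor (G2 d) a a'" "G \<in> Mor (G2 d) b b'" for F G a a' b b'
    proof -
      obtain f g where f: "F = ?Cl f" "typed f a a'" and g: "G = ?Cl g" "typed g b b'"
        using FG by (auto simp: Mor_G2)
      have "lift (ptns (G.interp f) (G.interp g)) \<Zcomp> join a b = join a' b' \<Zcomp> (lift (G.interp f) \<Otimes> lift (G.interp g))"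
        using arr[OF f(2)] arr[OF g(2)] by simp
      from arg_cong[OF this, of und] show ?thesis
        using f g Fm[OF f(2)] Fm[OF g(2)] Fm[OF typed.intros(3)[OF f(2) g(2)]]
        by (simp add: tens_g2_class J_def und_simps ptns_def)
    qed
    show "Fm (assoc (G2 d) a b c) \<cdot> J (a \<boxdot>\<^bsub>G2 d\<^esub> b) c \<cdot> (J a b \<boxtimes> ident C (P c)) =
        J a (b \<boxdot>\<^bsub>G2 d\<^esub> c) \<cdot> (ident C (P a) \<boxtimes> J b c) \<cdot> assoc C (P a) (P b) (P c)" for a b c
    proof -
      have "aid (P (a + b + c)) \<Zcomp> join (a + b) c \<Zcomp> (join a b \<Otimes> aid (P c)) =
          join a (b + c) \<Zcomp> (aid (P a) \<Otimes> join b c) \<Zcomp> aassoc (P a) (P b) (P c)"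
        by (simp add: join_assoc add.assoc)
      from arg_cong[OF this, of und] show ?thesis unfolding G2_simps FId J_def und_simps .
    qed
    show "Fm (lunit (G2 d) a) \<cdot> J (unit_ob (G2 d)) a \<cdot> (ident C (unit_ob C) \<boxtimes> ident C (P a)) = lunit C (P a)" for a
    proof -
      have "aid (P a) \<Zcomp> join 0 a \<Zcomp> (aid (unit_ob C) \<Otimes> aid (P a)) = alunit (P a)" by (simp add: join_zero_left)
      from arg_cong[OF this, of und] show ?thesis unfolding G2_simps FId J_def und_simps .
    qed
    show "Fm (runit (G2 d) a) \<cdot> J a (unit_ob (G2 d)) \<cdot> (ident C (P a) \<boxtimes> ident C (unit_ob C)) = runit C (P a)" for a
    proof -
      have "aid (P a) \<Zcomp> join a 0 \<Zcomp> (aid (P a) \<Otimes> aid (unit_ob C)) = arunit (P a)" by simp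
      from arg_cong[OF this, of und] show ?thesis unfolding G2_simps FId J_def und_simps .
    qed
    show "Fm (braid (G2 d) a b) \<cdot> J a b = J b a \<cdot> braid C (P a) (P b)" for a b
    proof -
      have "lift (pswp a b) \<Zcomp> join a b = join b a \<Zcomp> abraid (P a) (P b)" by (simp add: add.commute)
      from arg_cong[OF this, of und] show ?thesis
        using Fm[OF typed.intros(7)[of a b]] by (simp add: G2_simps J_def und_simps und_abraid pswp_def)
    qed
    show "Fm (twist (G2 d) a) = twist C (P a)" for a
      using arg_cong[OF tw[of a], of und] by (simp add: G2_simps FId ptw_def pidn_def und_simps)
  qed
  have "symmetric_ribbon_category C"
    by (intro symmetric_ribbon_category.intro symmetric_ribbon_category_axioms.intro ribbon_category_axioms sym)
  then have "symmetric_ribbon_functor (G2 d) C P Fm (ident C (unit_ob C)) J"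
    by (intro symmetric_ribbon_functor.intro func G2_symmetric_ribbon)
  moreover have J: "J 1 1 = ident C (X \<boxdot> X)" "J 2 1 = ident C (X \<boxdot> X \<boxdot> X)"
    unfolding J_def small_joins by (simp_all add: und_simps)
  have gens: "Fm (?Cl DCap) = e" "Fm (?Cl DCup) = k" "Fm (?Cl DVertex) = \<tau>"
    using Fm[OF typed.intros(8)] Fm[OF typed.intros(9)] Fm[OF typed.intros(10)] by simp_all
  have Mors: "e \<in> Mor C (X \<boxdot> X) (unit_ob C)" "k \<in> Mor C (unit_ob C) (X \<boxdot> X)" "\<tau> \<in> Mor C (X \<boxdot> X \<boxdot> X) (unit_ob C)"
    using G.gen_ok by (simp_all add: pok_iff numeral_2_eq_2 numeral_3_eq_3)
  have "Fm (?Cl DCap) \<cdot> J 1 1 = ident C (unit_ob C) \<cdot> e"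
    "Fm (?Cl DCup) \<cdot> ident C (unit_ob C) = J 1 1 \<cdot> k"
    "Fm (?Cl DVertex) \<cdot> J 2 1 \<cdot> (J 1 1 \<boxtimes> ident C X) = ident C (unit_ob C) \<cdot> \<tau>"
    unfolding J gens using Mors by (simp_all add: ident_comp comp_ident tensor_ident)
  ultimately show ?thesis unfolding G2_algebra_object_def using sym
    by (intro conjI exI[of _ P] exI[of _ Fm] exI[of _ "ident C (unit_ob C)"] exI[of _ J]) simp_all
qed

text \<open>Exhibits the word as a retract of a power of \<open>X\<close>, which suffices to carry
  an identity between natural transformations from the powers to the word.\<close>

lemma tensor_word_iso:
  assumes "a \<in> tensor_words C X"
  shows "\<exists>n x y. arr x \<and> src_of x = P n \<and> tgt_of x = a \<and> arr y \<and> src_of y = a \<and> tgt_of y = P n \<and> x \<Zcomp> y = aid a"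
  using assms
proof (induction rule: tensor_words.induct)
  case 1
  show ?case by (intro exI[of _ "0 :: nat"] exI[of _ "aid (unit_ob C)"]) simp
next
  case 2
  show ?case by (intro exI[of _ "1 :: nat"] exI[of _ "aid X"]) simp
next
  case (3 a b)
  then obtain m n x y z w where
    x: "arr x" "src_of x = P m" "tgt_of x = a" "arr y" "src_of y = a" "tgt_of y = P m" "x \<Zcomp> y = aid a" and
    z: "arr z" "src_of z = P n" "tgt_of z = b" "arr w" "src_of w = b" "tgt_of w = P n" "z \<Zcomp> w = aid b"
    by metis
  show ?case
    by (intro exI[of _ "m + n"] exI[of _ "(x \<Otimes> z) \<Zcomp> join' m n"] exI[of _ "join m n \<Zcomp> (y \<Otimes> w)"])
      (use x z in \<open>simp add: ainterchange\<close>)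
qed

text \<open>Every object is a retract of a power of \<open>X\<close>, and naturality of the braiding
  along the retractions transports the symmetry from powers to all objects.\<close>

lemma symmetric_braidingI:
  assumes sym: "\<And>a b. pcmp (pswp b a) (pswp a b) = pidn (a + b)"
    and gen: "\<And>a. \<exists>a' \<in> tensor_words C X. \<exists>f. is_iso C a a' f"
  shows "symmetric_braiding C"
proof -
  have ex: "\<exists>n x y. arr x \<and> src_of x = P n \<and> tgt_of x = a \<and> arr y \<and> src_of y = a \<and> tgt_of y = P n \<and> x \<Zcomp> y = aid a" for a
  proof -
    obtain a' f where a': "a' \<in> tensor_words C X" and "is_iso C a a' f" using gen by blast
    then obtain g where g: "inverse_pair C a a' f g" by (auto simp: is_iso_def)
    let ?f = "(a, a', f)" and ?g = "(a', a, g)"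
    have gf: "arr ?f" "arr ?g" "?g \<Zcomp> ?f = aid a" using g by (simp_all add: adefs inverse_pair_def)
    obtain n x y where x: "arr x" "src_of x = P n" "tgt_of x = a'" "arr y" "src_of y = a'" "tgt_of y = P n"
        "x \<Zcomp> y = aid a'"
      using tensor_word_iso[OF a'] by blast
    have "x \<Zcomp> (y \<Zcomp> ?f) = ?f" using x gf by (intro acancel[OF x(7)]) simp_all
    then have "?g \<Zcomp> x \<Zcomp> (y \<Zcomp> ?f) = aid a" using x gf by simp
    then show ?thesis
      by (intro exI[of _ n] exI[of _ "?g \<Zcomp> x"] exI[of _ "y \<Zcomp> ?f"]) (use x gf in simp)
  qed
  have P: "abraid (P b) (P a) \<Zcomp> abraid (P a) (P b) = aid (P a \<boxdot> P b)" for a b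
  proof -
    have "join a b \<Zcomp> (abraid (P b) (P a) \<Zcomp> (abraid (P a) (P b) \<Zcomp> join' a b)) = aid (P (a + b))"
      using arg_cong[OF sym[of b a], of lift] by (simp add: add.commute)
    then have "join' a b \<Zcomp> (join a b \<Zcomp> (abraid (P b) (P a) \<Zcomp> (abraid (P a) (P b) \<Zcomp> join' a b))) \<Zcomp> join a b =
        join' a b \<Zcomp> aid (P (a + b)) \<Zcomp> join a b" by simp
    then show ?thesis by simp
  qed
  have "abraid b a \<Zcomp> abraid a b = aid (a \<boxdot> b)" for a b
  proof -
    obtain m x y where x: "arr x" "src_of x = P m" "tgt_of x = a" "arr y" "src_of y = a" "tgt_of y = P m" "x \<Zcomp> y = aid a"
      using ex[of a] by blast
    obtain n z w where z: "arr z" "src_of z = P n" "tgt_of z = b" "arr w" "src_of w = b" "tgt_of w = P n" "z \<Zcomp> w = aid b"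
      using ex[of b] by blast
    have xz: "(x \<Otimes> z) \<Zcomp> (y \<Otimes> w) = aid (a \<boxdot> b)" using x z by (simp add: ainterchange)
    have "abraid b a \<Zcomp> abraid a b = abraid b a \<Zcomp> ((abraid a b \<Zcomp> (x \<Otimes> z)) \<Zcomp> (y \<Otimes> w))"
      using x z xz by simp
    also have "abraid a b \<Zcomp> (x \<Otimes> z) = (z \<Otimes> x) \<Zcomp> abraid (P m) (P n)"
      using abraid_natural[of x z] x z by simp
    also have "abraid b a \<Zcomp> ((z \<Otimes> x) \<Zcomp> abraid (P m) (P n) \<Zcomp> (y \<Otimes> w)) =
        (abraid b a \<Zcomp> (z \<Otimes> x)) \<Zcomp> (abraid (P m) (P n) \<Zcomp> (y \<Otimes> w))"
      using x z by simp
    also have "abraid b a \<Zcomp> (z \<Otimes> x) = (x \<Otimes> z) \<Zcomp> abraid (P n) (P m)"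
      using abraid_natural[of z x] x z by simp
    also have "\<dots> \<Zcomp> (abraid (P m) (P n) \<Zcomp> (y \<Otimes> w)) =
        (x \<Otimes> z) \<Zcomp> ((abraid (P n) (P m) \<Zcomp> abraid (P m) (P n)) \<Zcomp> (y \<Otimes> w))"
      using x z by simp
    also have "\<dots> = aid (a \<boxdot> b)" unfolding P using x z xz by simp
    finally show ?thesis .
  qed
  from arg_cong[OF this, of und] show ?thesis
    by (simp add: symmetric_braiding_def und_simps und_abraid)
qed

end

section \<open>Trivalent ribbon categories\<close>

context qe_pro
begin

context
  notes numeral_2_eq_2 [simp] and numeral_3_eq_3 [simp]
begin

text \<open>Bending twice is linear and injective, so a relation found in \<open>C(4)\<close> holds
  between the endomorphisms of two strands.\<close>

lemma L_zero_if_bent: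
  assumes "x1 \<Odot> bend 0 (bend 1 (idn 2)) \<boxplus> (x2 \<Odot> bend 0 (bend 1 U) \<boxplus> (x3 \<Odot> bend 0 (bend 1 I) \<boxplus>
    (x4 \<Odot> bend 0 (bend 1 H) \<boxplus> (x5 \<Odot> bend 0 (bend 1 (swp' 1 1)) \<boxplus> x6 \<Odot> bend 0 (bend 1 (swp 1 1)))))) = zer 4 0"
  shows "L x1 x2 x3 x4 x5 x6 = zer 2 2"
proof -
  have "bend 0 (bend 1 (L x1 x2 x3 x4 x5 x6)) = bend 0 (bend 1 (zer 2 2))"
    using assms unfolding L_def by (simp add: bend_linear eval_nat_numeral)
  then have "bend 1 (L x1 x2 x3 x4 x5 x6) = bend 1 (zer 2 2)" by (rule bend_inj) simp_all
  then show ?thesis by (rule bend_inj) simp_all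
qed

end

end

section \<open>Diagrams of a trivalent category in strict form\<close>

context trivalent_ribbon_category
begin

sublocale ribbon_object C X ..

lemma Hom_V: "vectorspace class_ring (C_space C X n)"
  unfolding C_space_def by (rule Hom_vectorspace)

lemma gens_Mor: "ev \<in> Mor C (X \<boxdot> X) (unit_ob C)" "coev \<in> Mor C (unit_ob C) (X \<boxdot> X)"
  "\<tau> \<in> Mor C (X \<boxdot> X \<boxdot> X) (unit_ob C)"
proof -
  show "ev \<in> Mor C (X \<boxdot> X) (unit_ob C)" "coev \<in> Mor C (unit_ob C) (X \<boxdot> X)"
    using self_dual by (simp_all add: is_dual_def)
  show "\<tau> \<in> Mor C (X \<boxdot> X \<boxdot> X) (unit_ob C)"
    using C3 unfolding vectorspace.basis_def[OF Hom_V] by (simp add: C_space_def numeral_3_eq_3)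
qed

lemma lift_gens: "lift (2, 0, ev) = (X \<boxdot> X, unit_ob C, ev)" "lift (0, 2, coev) = (unit_ob C, X \<boxdot> X, coev)"
  "lift (3, 0, \<tau>) = (X \<boxdot> X \<boxdot> X, unit_ob C, \<tau>)"
  by (simp_all add: lift_def numeral_2_eq_2 numeral_3_eq_3)

lemma arr_gens [simp]: "arr (X \<boxdot> X, unit_ob C, ev)" "arr (unit_ob C, X \<boxdot> X, coev)"
  "arr (X \<boxdot> X \<boxdot> X, unit_ob C, \<tau>)"
  using gens_Mor by (simp_all add: arr_def)

lemma P_small: "P 0 = unit_ob C" "P 1 = X" "P 2 = X \<boxdot> X" "P 3 = X \<boxdot> X \<boxdot> X"
  by (simp_all add: numeral_2_eq_2 numeral_3_eq_3)

sublocale vertex_pro pok src_of tgt_of pcmp ptns pidn pzer ppls pscl pswp pswp'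
  "(2, 0, ev)" "(0, 2, coev)" "(3, 0, \<tau>)"
proof
  show "pok (2, 0, ev)" "pok (0, 2, coev)" "pok (3, 0, \<tau>)"
    using gens_Mor by (simp_all add: pok_iff numeral_2_eq_2 numeral_3_eq_3)
  let ?e = "(X \<boxdot> X, unit_ob C, ev)" and ?k = "(unit_ob C, X \<boxdot> X, coev)"
  have z: "arunit X \<Zcomp> (aid X \<Otimes> ?e) \<Zcomp> aassoc X X X \<Zcomp> (?k \<Otimes> aid X) \<Zcomp> alunit' X = aid X"
    "alunit X \<Zcomp> (?e \<Otimes> aid X) \<Zcomp> aassoc' X X X \<Zcomp> (aid X \<Otimes> ?k) \<Zcomp> arunit' X = aid X"
    using self_dual by (simp_all add: is_dual_def adefs)
  have "lift (pcmp (ptns (2, 0, ev) (pidn 1)) (ptns (pidn 1) (0, 2, coev))) = lift (pidn 1)"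
    unfolding lift_simps arrow_sel pro_ends add_0 add_0_right one_add_one small_joins small_joins' lift_gens P_small
    using z(2) by simp
  then show "pcmp (ptns (2, 0, ev) (pidn 1)) (ptns (pidn 1) (0, 2, coev)) = pidn 1"
    by (intro lift_eqI) simp_all
  have "lift (pcmp (ptns (pidn 1) (2, 0, ev)) (ptns (0, 2, coev) (pidn 1))) = lift (pidn 1)"
    unfolding lift_simps arrow_sel pro_ends add_0 add_0_right one_add_one small_joins small_joins' lift_gens P_small
    using z(1) by simp
  then show "pcmp (ptns (pidn 1) (2, 0, ev)) (ptns (0, 2, coev) (pidn 1)) = pidn 1"
    by (intro lift_eqI) simp_all
qed simp_all

lemma lift_triple: "lift (a, b, f) = (P a, P b, f)"
  by (simp add: lift_def)

text \<open>With the small joins inserted, the strict composite becomes the bracketed one. The next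
  lemmas extend this dictionary to the other diagrams.\<close>

lemma mrg_eq: "mrg = (2, 1, merge_mor C X coev \<tau>)"
proof (rule lift_eqI)
  let ?t = "(X \<boxdot> X \<boxdot> X, unit_ob C, \<tau>)" and ?k = "(unit_ob C, X \<boxdot> X, coev)"
  have "(X \<boxdot> X, X, merge_mor C X coev \<tau>) =
      alunit X \<Zcomp> (?t \<Otimes> aid X) \<Zcomp> aassoc' (X \<boxdot> X) X X \<Zcomp> (aid (X \<boxdot> X) \<Otimes> ?k) \<Zcomp> arunit' (X \<boxdot> X)"
    by (simp add: adefs merge_mor_def)
  moreover have "lift mrg =
      alunit X \<Zcomp> (?t \<Otimes> aid X) \<Zcomp> aassoc' (X \<boxdot> X) X X \<Zcomp> (aid (X \<boxdot> X) \<Otimes> ?k) \<Zcomp> arunit' (X \<boxdot> X)"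
    unfolding mrg_def lift_simps arrow_sel pro_ends small_joins small_joins' lift_gens P_small
    by simp
  ultimately show "lift mrg = lift (2, 1, merge_mor C X coev \<tau>)"
    unfolding lift_triple P_small by (simp only:)
qed simp_all

lemma merge_Mor: "merge_mor C X coev \<tau> \<in> Mor C (X \<boxdot> X) X"
  using elem_simps(1) unfolding mrg_eq pok_iff P_small .

lemma spl_eq: "spl = (1, 2, split_mor C X coev \<tau>)"
proof (rule lift_eqI)
  let ?m = "(X \<boxdot> X, X, merge_mor C X coev \<tau>)" and ?k = "(unit_ob C, X \<boxdot> X, coev)"
  have m: "arr ?m" "lift (2, 1, merge_mor C X coev \<tau>) = ?m"
    using merge_Mor by (simp_all add: arr_def lift_def numeral_2_eq_2)
  have "(X, X \<boxdot> X, split_mor C X coev \<tau>) =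
      (?m \<Otimes> aid X) \<Zcomp> aassoc' X X X \<Zcomp> (aid X \<Otimes> ?k) \<Zcomp> arunit' X"
    by (simp add: adefs split_mor_def)
  moreover have "lift spl = (?m \<Otimes> aid X) \<Zcomp> aassoc' X X X \<Zcomp> (aid X \<Otimes> ?k) \<Zcomp> arunit' X"
    unfolding spl_def mrg_eq lift_simps arrow_sel pro_ends small_joins small_joins' lift_gens P_small add_0 add_0_right one_add_one
    using m by simp
  ultimately show "lift spl = lift (1, 2, split_mor C X coev \<tau>)"
    unfolding lift_triple P_small by (simp only:)
qed simp_all

lemma split_Mor: "split_mor C X coev \<tau> \<in> Mor C X (X \<boxdot> X)"
  using elem_simps(2) unfolding spl_eq pok_iff P_small .

lemma H_eq: "H = (2, 2, H_mor C X coev \<tau>)"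
proof (rule lift_eqI)
  let ?m = "(X \<boxdot> X, X, merge_mor C X coev \<tau>)" and ?s = "(X, X \<boxdot> X, split_mor C X coev \<tau>)"
  have m: "arr ?m" "lift (2, 1, merge_mor C X coev \<tau>) = ?m" "arr ?s" "lift (1, 2, split_mor C X coev \<tau>) = ?s"
    using merge_Mor split_Mor by (simp_all add: arr_def lift_def numeral_2_eq_2)
  have "(X \<boxdot> X, X \<boxdot> X, H_mor C X coev \<tau>) = (aid X \<Otimes> ?m) \<Zcomp> aassoc X X X \<Zcomp> (?s \<Otimes> aid X)"
    by (simp add: adefs H_mor_def)
  moreover have "lift H = (aid X \<Otimes> ?m) \<Zcomp> aassoc X X X \<Zcomp> (?s \<Otimes> aid X)"
    unfolding H_def mrg_eq spl_eq lift_simps arrow_sel pro_ends small_joins small_joins' P_small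
    using m by simp
  ultimately show "lift H = lift (2, 2, H_mor C X coev \<tau>)"
    unfolding lift_triple P_small by (simp only:)
qed simp_all

lemma I_eq: "I = (2, 2, I_mor C X coev \<tau>)"
  unfolding I_def mrg_eq spl_eq pro_triples I_mor_def ..

lemma U_eq: "U = (2, 2, coev \<cdot> ev)"
  unfolding U_def pro_triples ..

lemma pswp'_eq: "pswp' 1 1 = (2, 2, braid_inv C X X)"
proof (rule lift_eqI)
  have "lift (pswp' 1 1) = abraid' X X"
    unfolding pswp_simps small_joins small_joins' P_small by simp
  then show "lift (pswp' 1 1) = lift (2, 2, braid_inv C X X)"
    unfolding lift_triple P_small abraid'_def .
qed simp_all

end

section \<open>Powers of the root \<open>v\<close>\<close>

context
  fixes v :: complex
  assumes v: "primitive_root_of_unity 3 v \<or> primitive_root_of_unity 6 v"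
begin

text \<open>In both cases \<open>v ^ 2\<close> is a primitive cube root of unity. The cases differ
  in \<open>v ^ 3\<close>, which is 1 or -1 and is absorbed into \<open>\<beta>\<close>.\<close>

lemma root_power_6: "v ^ 6 = 1" and root_square: "v ^ 2 \<noteq> 1"
proof -
  have "v ^ 2 \<noteq> 1 \<and> v ^ 6 = 1"
  proof (cases "primitive_root_of_unity 3 v")
    case True
    then have "v ^ 3 = 1" "v ^ 2 \<noteq> 1" by (simp_all add: primitive_root_of_unity_def)
    moreover have "v ^ 6 = (v ^ 3) ^ 2" by (simp flip: power_mult)
    ultimately show ?thesis by simp
  next
    case False
    then have "primitive_root_of_unity 6 v" using v by blast
    then show ?thesis by (simp add: primitive_root_of_unity_def)
  qed
  then show "v ^ 6 = 1" "v ^ 2 \<noteq> 1" by simp_all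
qed

lemma root_nonzero: "v \<noteq> 0"
  using root_power_6 by auto

lemma root_powers: "v ^ 12 = 1" "v ^ 4 * v ^ 4 = v ^ 2" "v ^ 3 * v powi (-3) = 1" "v ^ 3 * v = v ^ 4"
  "v ^ 3 * v powi (-1) = v ^ 2" "v powi (-4) = v ^ 2"
proof -
  have "v ^ 12 = v ^ 6 * v ^ 6" "v ^ 4 * v ^ 4 = v ^ 6 * v ^ 2" by (simp_all flip: power_add)
  then show "v ^ 12 = 1" "v ^ 4 * v ^ 4 = v ^ 2" by (simp_all add: root_power_6)
  show "v ^ 3 * v powi (-3) = 1" "v ^ 3 * v powi (-1) = v ^ 2"
    using root_nonzero by (simp_all add: power_int_minus field_simps eval_nat_numeral)
  show "v ^ 3 * v = v ^ 4" by (simp add: eval_nat_numeral)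
  have "v ^ 4 * v ^ 2 = 1" using root_power_6 by (simp flip: power_add)
  then show "v powi (-4) = v ^ 2" using root_nonzero by (simp add: power_int_minus field_simps)
qed

lemma root_cyclotomic: "v ^ 4 * v ^ 4 + v ^ 4 + 1 = 0"
proof -
  have "(v ^ 2 - 1) * (v ^ 2 + v ^ 4 + 1) = v ^ 6 - 1" by (simp add: algebra_simps flip: power_add)
  then show ?thesis using root_power_6 root_square unfolding root_powers by simp
qed

end

lemma (in abelian_monoid) finsum_atMost_5:
  fixes h :: "nat \<Rightarrow> 'a"
  assumes "h \<in> {..5} \<rightarrow> carrier G"
  shows "finsum G h {..5} = h 5 \<oplus> (h 4 \<oplus> (h 3 \<oplus> (h 2 \<oplus> (h 1 \<oplus> h 0))))"
  using assms by (simp add: eval_nat_numeral finsum_Suc Pi_def)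

text \<open>Brings the left-bracketed relation of \<open>QEJac\<close> to the right-bracketed normal
  form of \<open>qe_pro\<close> and makes its leading coefficient 1; it is applied with
  \<open>c = v ^ 3\<close>.\<close>

lemma (in strict_pro) rescaled_relation:
  assumes "p \<Odot> h \<boxplus> q \<Odot> i \<boxplus> (-1) \<Odot> r \<Odot> y \<boxplus> \<alpha> \<Odot> (s \<boxplus> x \<Odot> u \<boxplus> z \<Odot> j) = zer a b" (is "?e = _")
    and "c * p = 1"
    and "ok h" "ok i" "ok y" "ok s" "ok u" "ok j"
    and "src h = a" "src i = a" "src y = a" "src s = a" "src u = a" "src j = a"
    and "tgt h = b" "tgt i = b" "tgt y = b" "tgt s = b" "tgt u = b" "tgt j = b"
  shows "h \<boxplus> ((c * q) \<Odot> i \<boxplus> ((- (c * r)) \<Odot> y \<boxplus> (c * \<alpha>) \<Odot> (s \<boxplus> (x \<Odot> u \<boxplus> z \<Odot> j)))) = zer a b"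
proof -
  have "c \<Odot> ?e = zer a b" using assms(1) by (simp only: scl_zer)
  then show ?thesis using assms(2-) by (simp add: scl_pls pls_assoc mult.assoc)
qed

section \<open>From (QEJac) to the functor\<close>

context trivalent_ribbon_category
begin

lemma qe_pro_if_QEJac:
  assumes QE: "QEJac C X ev coev \<tau> v \<alpha>"
    and v: "primitive_root_of_unity 3 v \<or> primitive_root_of_unity 6 v"
    and d: "ev \<cdot> coev = d \<odot>\<^bsub>Hom C (unit_ob C) (unit_ob C)\<^esub> ident C (unit_ob C)"
  shows "\<exists>b t. qe_pro pok src_of tgt_of pcmp ptns pidn pzer ppls pscl pswp pswp'
    (2, 0, ev) (0, 2, coev) (3, 0, \<tau>) d b t (v ^ 4) (v ^ 3 * \<alpha>)"
proof -
  let ?m = "merge_mor C X coev \<tau>" and ?s = "split_mor C X coev \<tau>" and ?H = "H_mor C X coev \<tau>"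
  let ?I = "I_mor C X coev \<tau>" and ?\<sigma> = "braid_inv C X X"
  let ?E = "Hom C (X \<boxdot> X) (X \<boxdot> X)"
  obtain t where t: "?H \<cdot> ?s = t \<odot>\<^bsub>Hom C X (X \<boxdot> X)\<^esub> ?s"
    and lol: "?m \<cdot> coev = \<zero>\<^bsub>Hom C (unit_ob C) X\<^esub>"
    and \<sigma>: "?\<sigma> \<cdot> ?s = (- 1) \<odot>\<^bsub>Hom C X (X \<boxdot> X)\<^esub> ?s" "?\<sigma> \<cdot> coev = 1 \<odot>\<^bsub>Hom C (unit_ob C) (X \<boxdot> X)\<^esub> coev"
    and qe: "(v powi (-3) \<odot>\<^bsub>?E\<^esub> (?H \<cdot> ?\<sigma>)) \<oplus>\<^bsub>?E\<^esub> (v \<odot>\<^bsub>?E\<^esub> ?I) \<ominus>\<^bsub>?E\<^esub> (v powi (-1) \<odot>\<^bsub>?E\<^esub> ?H) \<oplus>\<^bsub>?E\<^esub>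
           (\<alpha> \<odot>\<^bsub>?E\<^esub> (?\<sigma> \<oplus>\<^bsub>?E\<^esub> (v ^ 4 \<odot>\<^bsub>?E\<^esub> (coev \<cdot> ev)) \<oplus>\<^bsub>?E\<^esub> (v powi (-4) \<odot>\<^bsub>?E\<^esub> ident C (X \<boxdot> X)))) = \<zero>\<^bsub>?E\<^esub>"
    using QE unfolding QEJac_def Let_def root_power_6[OF v] root_powers(1)[OF v] by blast
  \<comment> \<open>The bigon value is taken from the trivalent structure, which also says that it
    is nonzero.\<close>
  obtain b where b: "b \<noteq> 0" "?m \<cdot> ?s = b \<odot>\<^bsub>Hom C X X\<^esub> ident C X"
    using bigon_nonzero by blast
  have unit: "ident C (unit_ob C) \<noteq> \<zero>\<^bsub>Hom C (unit_ob C) (unit_ob C)\<^esub>"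
    using vectorspace.basis_singleton(1)[OF Hom_V C0] by (simp add: C_space_def)
  then have idn_0: "pidn 0 \<noteq> pzer 0 0" unfolding pro_triples P_small by simp
  have cap_cup: "pcmp (2, 0, ev) (0, 2, coev) = pscl d (pidn 0)"
    unfolding pro_triples P_small d ..
  \<comment> \<open>The nonzero circle value \<open>d'\<close> coincides with the given
    \<open>d\<close>, because the identity of the unit object is not zero.\<close>
  obtain d' where "d' \<noteq> 0" "ev \<cdot> coev = d' \<odot>\<^bsub>Hom C (unit_ob C) (unit_ob C)\<^esub> ident C (unit_ob C)"
    using circle_nonzero by blast
  then have "d' \<noteq> 0" "pscl d (pidn 0) = pscl d' (pidn 0)"
    unfolding cap_cup[symmetric] unfolding pro_triples P_small by simp_all
  then have "d \<noteq> 0" using scl_inj[of d "pidn 0" d'] idn_0 by simp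
  have spans: "\<exists>r. x = pscl r (n, 0, e)"
    if "vectorspace.basis class_ring (C_space C X n) {e}" "pok x" "src_of x = n" "tgt_of x = 0" for x n e
  proof -
    have "und x \<in> Mor C (P n) (unit_ob C)"
      using that(2-4) by (simp add: pok_def arr_def)
    then have "\<exists>r. und x = r \<odot>\<^bsub>Hom C (P n) (unit_ob C)\<^esub> e"
      using vectorspace.basis_singleton(2)[OF Hom_V that(1), of "und x"] by (auto simp: C_space_def)
    then obtain r where "und x = r \<odot>\<^bsub>Hom C (P n) (unit_ob C)\<^esub> e" ..
    then have "x = pscl r (n, 0, e)"
      using that(3,4) unfolding pro_triples P_small by (metis arrow_collapse)
    then show ?thesis ..
  qed
  let ?h = "pcmp H (pswp' 1 1)"
  have "ppls (ppls (ppls (pscl (v powi (-3)) ?h) (pscl v I)) (pscl (-1) (pscl (v powi (-1)) H)))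
      (pscl \<alpha> (ppls (ppls (pswp' 1 1) (pscl (v ^ 4) U)) (pscl (v powi (-4)) (pidn 2)))) = pzer 2 2"
  proof -
    interpret M: Module.module "class_ring :: complex ring" ?E by (rule Hom_module)
    have H: "?H \<in> carrier ?E" using elem_simps(3) unfolding H_eq pok_iff P_small .
    then have "(-1) \<odot>\<^bsub>?E\<^esub> (v powi (-1) \<odot>\<^bsub>?E\<^esub> ?H) = \<ominus>\<^bsub>?E\<^esub> (v powi (-1) \<odot>\<^bsub>?E\<^esub> ?H)"
      using M.smult_minus_1[of "v powi (-1) \<odot>\<^bsub>?E\<^esub> ?H"] M.smult_closed[of "v powi (-1)" ?H]
      by (simp add: class_ring_simps)
    then show ?thesis
      using qe unfolding H_eq I_eq U_eq pswp'_eq pro_triples P_small a_minus_def by simp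
  qed
  then have "ppls ?h (ppls (pscl (v ^ 3 * v) I) (ppls (pscl (- (v ^ 3 * v powi (-1))) H)
      (pscl (v ^ 3 * \<alpha>) (ppls (pswp' 1 1) (ppls (pscl (v ^ 4) U) (pscl (v powi (-4)) (pidn 2))))))) = pzer 2 2"
    by (rule rescaled_relation) (simp_all add: root_powers(3)[OF v])
  then have q: "ppls ?h (ppls (pscl (v ^ 4) I) (ppls (pscl (- (v ^ 4 * v ^ 4)) H)
      (pscl (v ^ 3 * \<alpha>) (ppls (pswp' 1 1) (ppls (pscl (v ^ 4) U) (pscl (v ^ 4 * v ^ 4) (pidn 2))))))) = pzer 2 2"
    unfolding root_powers(2,4,5,6)[OF v] .
  show ?thesis
  proof (rule exI[of _ b], rule exI[of _ t], rule qe_pro.intro, rule vertex_pro_axioms, rule qe_pro_axioms.intro)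
    show "pcmp mrg spl = pscl b (pidn 1)" "pcmp mrg (0, 2, coev) = pzer 0 1" "pcmp H spl = pscl t spl"
      "pcmp (pswp' 1 1) spl = pscl (-1) spl"
      unfolding mrg_eq spl_eq H_eq pswp'_eq pro_triples P_small using b t lol \<sigma> by simp_all
    have "pcmp (pswp' 1 1) (0, 2, coev) = pscl 1 (0, 2, coev)"
      unfolding pswp'_eq pro_triples P_small \<sigma> ..
    then show "pcmp (pswp' 1 1) (0, 2, coev) = (0, 2, coev)" by simp
    show "\<exists>r. x = pscl r (2, 0, ev)" if "pok x" "src_of x = 2" "tgt_of x = 0" for x
      using spans[OF C2 that] .
    show "\<exists>r. x = pscl r (3, 0, \<tau>)" if "pok x" "src_of x = 3" "tgt_of x = 0" for x
      using spans[OF C3 that] .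
  qed (fact idn_0 \<open>d \<noteq> 0\<close> b(1) cap_cup q root_cyclotomic[OF v])+
qed

lemma relation_in_C4:
  fixes g :: "nat \<Rightarrow> nat \<times> nat \<times> 'm"
  assumes fd: "vectorspace.fin_dim class_ring (C_space C X 4)"
    and dim: "vectorspace.dim class_ring (C_space C X 4) \<le> 5"
    and g: "\<And>i. i \<le> 5 \<Longrightarrow> pok (g i) \<and> src_of (g i) = 4 \<and> tgt_of (g i) = 0"
  shows "\<exists>w :: nat \<Rightarrow> complex. (\<exists>i\<le>5. w i \<noteq> 0) \<and> ppls (pscl (w 5) (g 5)) (ppls (pscl (w 4) (g 4)) (ppls (pscl (w 3) (g 3))
    (ppls (pscl (w 2) (g 2)) (ppls (pscl (w 1) (g 1)) (pscl (w 0) (g 0)))))) = pzer 4 0"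
proof -
  let ?V = "Hom C (P 4) (unit_ob C)"
  interpret V: vectorspace "class_ring :: complex ring" ?V by (rule Hom_vectorspace)
  have V: "C_space C X 4 = ?V" by (simp add: C_space_def)
  define f where "f i = und (g i)" for i :: nat
  have fV: "f i \<in> carrier ?V" if "i \<le> 5" for i
    using g[OF that] by (auto simp: f_def pok_def arr_def)
  have "\<exists>w. w \<in> UNIV \<rightarrow> carrier (class_ring :: complex ring) \<and> (\<exists>i\<le>5. w i \<noteq> \<zero>\<^bsub>class_ring\<^esub>) \<and>
      (\<Oplus>\<^bsub>?V\<^esub>i\<in>{..5}. w i \<odot>\<^bsub>?V\<^esub> f i) = \<zero>\<^bsub>?V\<^esub>"
    using V.relation_if_exceeds_dim[of 5 f] fd dim fV unfolding V by auto
  then obtain w :: "nat \<Rightarrow> complex" where w: "\<exists>i\<le>5. w i \<noteq> 0" "(\<Oplus>\<^bsub>?V\<^esub>i\<in>{..5}. w i \<odot>\<^bsub>?V\<^esub> f i) = \<zero>\<^bsub>?V\<^esub>"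
    by (auto simp: class_ring_simps)
  have wf: "w i \<odot>\<^bsub>?V\<^esub> f i \<in> carrier ?V" if "i \<le> 5" for i
    using fV[OF that] by (intro V.smult_closed) (simp_all add: class_ring_simps)
  have "(\<Oplus>\<^bsub>?V\<^esub>i\<in>{..5}. w i \<odot>\<^bsub>?V\<^esub> f i) = w 5 \<odot>\<^bsub>?V\<^esub> f 5 \<oplus>\<^bsub>?V\<^esub> (w 4 \<odot>\<^bsub>?V\<^esub> f 4 \<oplus>\<^bsub>?V\<^esub> (w 3 \<odot>\<^bsub>?V\<^esub> f 3 \<oplus>\<^bsub>?V\<^esub>
      (w 2 \<odot>\<^bsub>?V\<^esub> f 2 \<oplus>\<^bsub>?V\<^esub> (w 1 \<odot>\<^bsub>?V\<^esub> f 1 \<oplus>\<^bsub>?V\<^esub> w 0 \<odot>\<^bsub>?V\<^esub> f 0))))"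
    by (rule V.M.finsum_atMost_5) (use wf in auto)
  moreover have "g i = (4, 0, f i)" if "i \<le> 5" for i
    using g[OF that] unfolding f_def by (metis arrow_collapse)
  ultimately show ?thesis
    using w by (intro exI[of _ w]) (simp add: pro_triples)
qed

lemma G2_algebra_object_if_QEJac:
  assumes fd: "vectorspace.fin_dim class_ring (C_space C X 4)"
    and dim: "vectorspace.dim class_ring (C_space C X 4) \<le> 5"
    and QE: "QEJac C X ev coev \<tau> v \<alpha>"
    and v: "primitive_root_of_unity 3 v \<or> primitive_root_of_unity 6 v"
    and d: "ev \<cdot> coev = d \<odot>\<^bsub>Hom C (unit_ob C) (unit_ob C)\<^esub> ident C (unit_ob C)"
  shows "\<exists>k. k \<noteq> 0 \<and> G2_algebra_object C X (k \<odot>\<^bsub>Hom C (X \<boxdot> X) (unit_ob C)\<^esub> ev)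
    (inverse k \<odot>\<^bsub>Hom C (unit_ob C) (X \<boxdot> X)\<^esub> coev) \<tau> d"
proof -
  obtain b t where qe: "qe_pro pok src_of tgt_of pcmp ptns pidn pzer ppls pscl pswp pswp'
      (2, 0, ev) (0, 2, coev) (3, 0, \<tau>) d b t (v ^ 4) (v ^ 3 * \<alpha>)"
    using qe_pro_if_QEJac[OF QE v d] by blast
  let ?w = "v ^ 4" and ?\<beta> = "v ^ 3 * \<alpha>"
  have w: "?w * ?w - ?w \<noteq> 0"
  proof
    assume "?w * ?w - ?w = 0"
    moreover have "x = 0 \<or> x = 1" if "x * x - x = 0" for x :: complex
      using that by simp
    ultimately have "?w = 0 \<or> ?w = 1" by blast
    then show False using qe_pro.w_inverse(2)[OF qe] qe_pro.w_ne_1[OF qe] by (metis mult_1)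
  qed
  \<comment> \<open>Chosen so that dividing \<open>?\<beta>\<close> by \<open>k ^ 3 = c\<close>
    gives the normalized value \<open>?w * ?w - ?w\<close>.\<close>
  define c where "c = ?\<beta> / (?w * ?w - ?w)"
  have "c \<noteq> 0" using qe_pro.beta_nonzero[OF qe] w by (simp add: c_def)
  then have "card {z. z ^ 3 = c} = 3" by (intro card_nth_roots) simp_all
  then obtain k where k: "k ^ 3 = c" by (metis (mono_tags, lifting) card.empty empty_Collect_eq zero_neq_numeral)
  with \<open>c \<noteq> 0\<close> have "k \<noteq> 0" by auto
  let ?e = "k \<odot>\<^bsub>Hom C (X \<boxdot> X) (unit_ob C)\<^esub> ev" and ?u = "inverse k \<odot>\<^bsub>Hom C (unit_ob C) (X \<boxdot> X)\<^esub> coev"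
  have eu: "pscl k (2, 0, ev) = (2, 0, ?e)" "pscl (inverse k) (0, 2, coev) = (0, 2, ?u)"
    unfolding pro_triples P_small by simp_all
  interpret N: normalized_qe_pro pok src_of tgt_of pcmp ptns pidn pzer ppls pscl pswp pswp'
    "(2, 0, ?e)" "(0, 2, ?u)" "(3, 0, \<tau>)" d "b / k ^ 3" "t / k ^ 3" "v ^ 4" "?\<beta> / k ^ 3"
  proof (intro normalized_qe_pro.intro normalized_qe_pro_axioms.intro)
    show "qe_pro pok src_of tgt_of pcmp ptns pidn pzer ppls pscl pswp pswp'
        (2, 0, ?e) (0, 2, ?u) (3, 0, \<tau>) d (b / k ^ 3) (t / k ^ 3) (v ^ 4) (?\<beta> / k ^ 3)"
      using qe_pro.rescaled[OF qe \<open>k \<noteq> 0\<close>] unfolding eu .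
    show "?\<beta> / k ^ 3 = ?w * ?w - ?w"
      unfolding k c_def using qe_pro.beta_nonzero[OF qe] w by simp
  qed
  \<comment> \<open>The list runs against the order of the arguments of \<open>N.L\<close>, because
    the expanded sum of \<open>relation_in_C4\<close> starts with index 5.\<close>
  define g where "g i = N.bend 0 (N.bend 1 ([pswp 1 1, pswp' 1 1, N.H, N.I, N.U, pidn 2] ! i))" for i :: nat
  have "pok (g i) \<and> src_of (g i) = 4 \<and> tgt_of (g i) = 0" if "i \<le> 5" for i
  proof -
    have "i = 0 \<or> i = 1 \<or> i = 2 \<or> i = 3 \<or> i = 4 \<or> i = 5" using that by linarith
    then show ?thesis
      by (elim disjE) (simp_all add: g_def)
  qed
  from relation_in_C4[OF fd dim this] obtain w :: "nat \<Rightarrow> complex" where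
    w: "(\<exists>i\<le>5. w i \<noteq> 0) \<and> ppls (pscl (w 5) (g 5)) (ppls (pscl (w 4) (g 4)) (ppls (pscl (w 3) (g 3))
    (ppls (pscl (w 2) (g 2)) (ppls (pscl (w 1) (g 1)) (pscl (w 0) (g 0)))))) = pzer 4 0" ..
  have "g 0 = N.bend 0 (N.bend 1 (pswp 1 1))" "g 1 = N.bend 0 (N.bend 1 (pswp' 1 1))"
    "g 2 = N.bend 0 (N.bend 1 N.H)" "g 3 = N.bend 0 (N.bend 1 N.I)"
    "g 4 = N.bend 0 (N.bend 1 N.U)" "g 5 = N.bend 0 (N.bend 1 (pidn 2))"
    by (simp_all add: g_def)
  then have "N.L (w 5) (w 4) (w 3) (w 2) (w 1) (w 0) = pzer 2 2"
    using conjunct2[OF w] by (intro N.L_zero_if_bent) (simp only:)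
  moreover have "w 5 \<noteq> 0 \<or> w 4 \<noteq> 0 \<or> w 3 \<noteq> 0 \<or> w 2 \<noteq> 0 \<or> w 1 \<noteq> 0 \<or> w 0 \<noteq> 0"
    using conjunct1[OF w] by (auto simp: le_Suc_eq eval_nat_numeral)
  ultimately have s: "pswp' 1 1 = pswp 1 1" by (rule N.relation_symmetric_braiding)
  have g2: "g2_pro pok src_of tgt_of pcmp ptns pidn pzer ppls pscl pswp pswp' (2, 0, ?e) (0, 2, ?u) (3, 0, \<tau>) d"
    using N.g2_pro[OF s] .
  have sym: "pcmp (pswp b a) (pswp a b) = pidn (a + b)" for a b
    using g2_pro.sym[OF g2] .
  have "ptw n = pidn n" for n
    using twisted_qe_pro.tw_trivial[OF twisted_qe_pro.intro[OF N.qe_pro_axioms twisted_pro_axioms]] sym[of 1 1]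
    by (simp add: numeral_2_eq_2)
  then have "G2_algebra_object C X ?e ?u \<tau> d"
    using G2_algebra_objectI[OF g2] symmetric_braidingI[OF sym objects_generated] by blast
  with \<open>k \<noteq> 0\<close> show ?thesis by blast
qed

end

theorem proposition6p85:
  fixes C :: "('o, 'm) cat_data" and X :: 'o and ev coev \<tau> :: 'm and v \<alpha> d :: complex
  assumes "trivalent_ribbon_category C X ev coev \<tau>"
    and "vectorspace.fin_dim class_ring (C_space C X 4)"
    and "vectorspace.dim class_ring (C_space C X 4) \<le> 5"
    and "QEJac C X ev coev \<tau> v \<alpha>"
    and "primitive_root_of_unity 3 v \<or> primitive_root_of_unity 6 v"
    and "ev \<cdot>\<^bsub>C\<^esub> coev = d \<odot>\<^bsub>Hom C (unit_ob C) (unit_ob C)\<^esub> ident C (unit_ob C)"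
  shows "\<exists>k. k \<noteq> 0 \<and>
           G2_algebra_object C X
             (k \<odot>\<^bsub>Hom C (X \<boxdot>\<^bsub>C\<^esub> X) (unit_ob C)\<^esub> ev)
             (inverse k \<odot>\<^bsub>Hom C (unit_ob C) (X \<boxdot>\<^bsub>C\<^esub> X)\<^esub> coev) \<tau> d"
  using trivalent_ribbon_category.G2_algebra_object_if_QEJac[OF assms] .

end
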